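(* Let $D=(V,E)$ be a finite digraph and let $\mathcal{D}\mathfrak{X}$ be the Hopf algebroid over $A=\mathbb{K}(V)$ associated with the differential calculus of $D$ extended by $\Omega^2_{\mathrm{top}}$. Its isotopy quotient $\mathcal{D}\mathfrak{X}_{\mathrm{iso}}=\mathcal{D}\mathfrak{X}/\langle a-\overline{a}\mid a\in A\rangle$, with the induced structure, is isomorphic as a Hopf algebroid (over $\mathbb{K}(V)$) to the groupoid algebra $\mathbb{K}\Pi_D$ of the fundamental groupoid $\Pi_D$ of $D$.
   Context: $\mathbb{K}$ is a field. A digraph $D=(V,E)$ has a finite vertex set $V$ and a set of edges $E$; no edge has equal source and target, and an edge is determined by its source and target; write $a\to b\in E$ for an edge, $a\nrightarrow b$ if $a\to b\notin E$. $E_2$ is the set of paths $a\to b\to c$ of length two. **Digraph calculus.** $A=\mathbb{K}(V)$ with basis of idempotents $f_p$ ($p\in V$). $\Omega^1$ has basis $\omega_{a\to b}$ ($a\to b\in E$), with $f_p\omega_{a\to b}f_q=\delta_{p,a}\delta_{q,b}\omega_{a\to b}$, and $df_p=\sum_{a:a\to p\in E}\omega_{a\to p}-\sum_{b:p\to b\in E}\omega_{p\to b}$. $\mathfrak{X}^1$ has basis $e_{b\leftarrow a}$ ($a\to b\in E$) with $f_pe_{b\leftarrow a}f_q=\delta_{p,b}\delta_{a,q}e_{b\leftarrow a}$. Bimodule maps $\mathrm{ev}:\mathfrak{X}^1\otimes_A\Omega^1\to A$, $\mathrm{ev}(e_{b\leftarrow a}\otimes\omega_{p\to q})=\delta_{p,a}\delta_{q,b}f_b$,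 and $\underline{\mathrm{ev}}:\Omega^1\otimes_A\mathfrak{X}^1\to A$, $\underline{\mathrm{ev}}(\omega_{p\to q}\otimes e_{b\leftarrow a})=\delta_{p,a}\delta_{q,b}f_a$; $\mathrm{coev}(1)=\sum_{a\to b\in E}\omega_{a\to b}\otimes e_{b\leftarrow a}=\sum_{a\to b\in E} d(-f_a)\otimes e_{b\leftarrow a}$ and $\underline{\mathrm{coev}}(1)=\sum_{a\to b\in E} e_{b\leftarrow a}\otimes\omega_{a\to b}=\sum_{a\to b\in E} e_{b\leftarrow a}\otimes df_b$. Write $\mathrm{coev}(1)=\sum_i\omega_i\otimes x_i=\sum_i db_i\otimes x_i$ and $\underline{\mathrm{coev}}(1)=\sum_j y_j\otimes\rho_j=\sum_j y_j\otimes dc_j$ for these (so $i,j$ run over $E$). Repeated indices $i,j,k$ are summed. **$H\mathfrak{X}^1$** (presentation for surjective calculi): the $\mathbb{K}$-algebra (product $\bullet$, commutator $[\cdot,\cdot]$) generated by $A$, by $A^{\mathrm{op}}$ (elements $\overline a$, $\overline a\bullet\overline b=\overline{ba}$), and by two copies of the vector space $\mathfrak{X}^1$ (elements $x$ and $\overline x$), with relations, for $a,b\in A$, $x\in\mathfrak{X}^1$: $a\bullet\overline b=\overline b\bullet a$; $a\bullet x=ax$; $x\bullet a=xa+\mathrm{ev}(x\otimes da)$; $\overline a\bullet\overline x=\overline{xa}$; $\overline x\bullet\overline a=\overline{ax}+\overline{\underline{\mathrm{ev}}(da\otimes x)}$; $\sum_m\overline{s_m}\bullet x\bullet\overline{r_m}=0$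 and $\sum_m r_m\bullet\overline x\bullet s_m=0$ whenever $\sum_m r_m\otimes s_m\in A\otimes_{\mathbb K}A$ satisfies $\sum r_ms_m=0$ and $\sum r_m\,ds_m=0$ in $\Omega^1$; $[\overline x,b_i]\bullet x_i=\overline x$; $[x,\overline{c_j}]\bullet\overline{y_j}=x$; $[y_j,\overline a]\bullet[\overline x,c_j]=\overline{\mathrm{ev}(x\otimes da)}$; $[\overline{x_i},a]\bullet[x,\overline{b_i}]=\underline{\mathrm{ev}}(da\otimes x)$. It is a left Hopf algebroid over $A$ with source $a\mapsto a$, target $a\mapsto\overline a$, and coring structure for the bimodule structure $a\cdot h\cdot a'=a\bullet\overline{a'}\bullet h$ determined multiplicatively ($\Delta(hh')=\Delta(h)\Delta(h')$, $\varepsilon(hh')=\varepsilon(h\,\varepsilon(h'))$) by $\Delta(a\overline b)=a\otimes\overline b$, $\varepsilon(a\overline b)=ab$, $\Delta(x)=x\otimes1+[x,\overline{b_i}]\otimes x_i$, $\Delta(\overline y)=1\otimes\overline y+\overline{y_j}\otimes[\overline y,c_j]$, $\varepsilon(x)=\varepsilon(\overline y)=0$. **$\Omega^2_{\mathrm{top}}$ and $\mathcal{D}\mathfrak{X}$.** $\Omega^2_{\mathrm{top}}$ is the quotient of $\Omega^1\otimes_A\Omega^1$ by the span of the elements $\sum_{b:\,a\to b\to c\in E_2}\omega_{a\to b}\otimes\omega_{b\to c}$ for $a,c\in V$ with $a\nrightarrow c$ (including $a=c$); $\wedge$ is the projection; $d:\Omega^1\to\Omega^2_{\mathrm{top}}$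 is $d\omega_{a\to b}=\sum_{t:b\to t\in E}\omega_{a\to b}\wedge\omega_{b\to t}+\sum_{s:s\to a\in E}\omega_{s\to a}\wedge\omega_{a\to b}-\sum_{i:\,a\to i\to b\in E_2}\omega_{a\to i}\wedge\omega_{i\to b}$. For every $a,c$ with $a\nrightarrow c$ joined by some length-two path choose one such path, and let $\mathbf{E}_2\subseteq E_2$ be the set of paths not chosen; the $\omega_{a\to b}\wedge\omega_{b\to c}$ with $a\to b\to c\in\mathbf{E}_2$ form a basis of $\Omega^2_{\mathrm{top}}$. $\mathfrak{X}^2$ has basis $e_{c\leftarrow b\leftarrow a}$ ($a\to b\to c\in\mathbf{E}_2$), $f_pe_{c\leftarrow b\leftarrow a}f_q=\delta_{p,c}\delta_{q,a}e_{c\leftarrow b\leftarrow a}$, with pairings on basis elements $\mathrm{ev}^2(e_{z\leftarrow y\leftarrow x}\otimes\omega_{p\to q}\wedge\omega_{q\to r})=\delta_{x,p}\delta_{y,q}\delta_{z,r}f_z$ and $\underline{\mathrm{ev}}^2(\omega_{p\to q}\wedge\omega_{q\to r}\otimes e_{z\leftarrow y\leftarrow x})=\delta_{x,p}\delta_{y,q}\delta_{z,r}f_x$. $\mathcal{D}\mathfrak{X}$ is the quotient of $H\mathfrak{X}^1$ (with the induced Hopf algebroid structure) by the relations, for all $\xi\in\mathfrak{X}^2$: $\mathrm{ev}^2(\xi\otimes d\omega_i)\bullet x_i=\mathrm{ev}^2(\xi\otimes\omega_j\wedge\omega_k)\bullet x_k\bullet x_j$; and, whenever $\sum_m r_m\,da_m\otimes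 da'_m\in\ker(\wedge)$, $\sum_m\mathrm{ev}^2(\xi\otimes\omega_i\wedge\omega_j)\bullet[x_j,\overline{a'_m}]\bullet[x_i,\overline{a_m}]\bullet\overline{r_m}=0$ and $\sum_m\overline{\underline{\mathrm{ev}}^2(\rho_i\wedge\rho_j\otimes\xi)}\bullet r_m\bullet[\overline{y_i},a_m]\bullet[\overline{y_j},a'_m]=0$. **Groupoid algebra.** For a groupoid $\mathcal{G}$ with finite object set $\mathcal{G}_0$ and arrow set $\mathcal{G}_1$, $\mathbb{K}\mathcal{G}$ is the Hopf algebroid over $\mathbb{K}(\mathcal{G}_0)$ whose algebra has basis $\mathcal{G}_1$, with product of $e,e'$ equal to $e.e'$ if $s(e)=t(e')$ and $0$ otherwise, source = target map $f_p\mapsto\mathrm{id}_p$, $\Delta(e)=e\otimes e$, $\varepsilon(e)=f_{t(e)}$. **Fundamental groupoid.** $\Pi_D$ has object set $V$ and is the quotient of the free groupoid generated by arrows $(b\leftarrow a)$ from $a$ to $b$, one for each $a\to b\in E$, by: $(r\leftarrow q).(q\leftarrow p)=(r\leftarrow p)$ whenever $p\to q,\ q\to r,\ p\to r\in E$; and $(r\leftarrow q).(q\leftarrow p)=(r\leftarrow q').(q'\leftarrow p)$ whenever $p\to q,\ q\to r,\ p\to q',\ q'\to r\in E$. An isomorphism of Hopf algebroids over $\mathbb{K}(V)$ is an algebra isomorphism compatible with source, target, comultiplication and counit. *)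

theory Defs
  imports
    "HOL-Library.Poly_Mapping"
    "HOL-Library.Function_Algebras"
    "HOL-Library.Product_Plus"
    "HOL-Algebra.QuotRing"
    "HOL-Algebra.Module"
    "Graph_Theory.Pair_Digraph"
begin

section \<open>Finitely supported linear combinations\<close>

definition pm_scale :: "'k::field \<Rightarrow> ('i \<Rightarrow>\<^sub>0 'k) \<Rightarrow> ('i \<Rightarrow>\<^sub>0 'k)" where
  "pm_scale c u = Poly_Mapping.map ((*) c) u"

definition pm_extend :: "('i \<Rightarrow> ('j \<Rightarrow>\<^sub>0 'k)) \<Rightarrow> ('i \<Rightarrow>\<^sub>0 'k::field) \<Rightarrow> ('j \<Rightarrow>\<^sub>0 'k)" where
  "pm_extend f u = (\<Sum>i\<in>Poly_Mapping.keys u. pm_scale (Poly_Mapping.lookup u i) (f i))"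

abbreviation pm_basis :: "'i \<Rightarrow> ('i \<Rightarrow>\<^sub>0 'k::field)" where
  "pm_basis i \<equiv> Poly_Mapping.single i 1"

definition pm_tensor :: "('i \<Rightarrow>\<^sub>0 'k::field) \<Rightarrow> ('j \<Rightarrow>\<^sub>0 'k) \<Rightarrow> ('i \<times> 'j \<Rightarrow>\<^sub>0 'k)" where
  "pm_tensor u v = pm_extend (\<lambda>i. pm_extend (\<lambda>j. pm_basis (i, j)) v) u"


section \<open>Algebras over \<open>\<bbbK>(V)\<close> and their quotients\<close>

text \<open>The base algebra \<open>\<bbbK>(V)\<close> is \<open>fun_on V\<close> with the pointwise operations of
  Function_Algebras. Note that its unit is the indicator function of \<open>V\<close>, not \<open>1\<close>.\<close>

definition fun_on :: "'i set \<Rightarrow> ('i \<Rightarrow> 'k::zero) set" where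
  "fun_on S = {f. \<forall>i. i \<notin> S \<longrightarrow> f i = 0}"

definition bas :: "'i \<Rightarrow> 'i \<Rightarrow> 'k::zero_neq_one" where
  "bas i = (\<lambda>j. if j = i then 1 else 0)"

definition fun_span :: "('i \<Rightarrow> 'k::field) set \<Rightarrow> ('i \<Rightarrow> 'k) set" where
  "fun_span B = Modules.module.span (\<lambda>c f i. c * f i) B"

record ('k, 'h, 'v) algebroid = "('k, 'h) module" +
  src :: "('v \<Rightarrow> 'k) \<Rightarrow> 'h"
  tgt :: "('v \<Rightarrow> 'k) \<Rightarrow> 'h"

text \<open>The value of \<open>comul\<close> is an element of \<open>H \<otimes>\<^sub>A H\<close>, i.e. a coset of formal linear
  combinations of pairs.\<close>

record (overloaded) ('k::zero, 'h, 'v) hopf_algebroid = "('k, 'h, 'v) algebroid" +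
  comul :: "'h \<Rightarrow> ('h \<times> 'h \<Rightarrow>\<^sub>0 'k) set"
  counit :: "'h \<Rightarrow> 'v \<Rightarrow> 'k"

text \<open>\<open>H \<otimes>\<^sub>A H\<close> is taken for the bimodule structure \<open>a \<cdot> h \<cdot> a' = src a \<otimes> tgt a' \<otimes> h\<close>; hence the
  last rule.\<close>

inductive_set tensor_rels ::
    "'v set \<Rightarrow> ('k::field, 'h, 'v, 'm) algebroid_scheme \<Rightarrow> ('h \<times> 'h \<Rightarrow>\<^sub>0 'k) set"
  for V :: "'v set" and H :: "('k, 'h, 'v, 'm) algebroid_scheme" where
  add_left: "\<lbrakk>h \<in> carrier H; h' \<in> carrier H; g \<in> carrier H\<rbrakk> \<Longrightarrow>
    pm_basis (h \<oplus>\<^bsub>H\<^esub> h', g) - pm_basis (h, g) - pm_basis (h', g) \<in> tensor_rels V H"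
| add_right: "\<lbrakk>g \<in> carrier H; h \<in> carrier H; h' \<in> carrier H\<rbrakk> \<Longrightarrow>
    pm_basis (g, h \<oplus>\<^bsub>H\<^esub> h') - pm_basis (g, h) - pm_basis (g, h') \<in> tensor_rels V H"
| scale_left: "\<lbrakk>h \<in> carrier H; g \<in> carrier H\<rbrakk> \<Longrightarrow>
    pm_basis (c \<odot>\<^bsub>H\<^esub> h, g) - pm_scale c (pm_basis (h, g)) \<in> tensor_rels V H"
| scale_right: "\<lbrakk>g \<in> carrier H; h \<in> carrier H\<rbrakk> \<Longrightarrow>
    pm_basis (g, c \<odot>\<^bsub>H\<^esub> h) - pm_scale c (pm_basis (g, h)) \<in> tensor_rels V H"
| balanced: "\<lbrakk>h \<in> carrier H; g \<in> carrier H; a \<in> fun_on V\<rbrakk> \<Longrightarrow>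
    pm_basis (tgt H a \<otimes>\<^bsub>H\<^esub> h, g) - pm_basis (h, src H a \<otimes>\<^bsub>H\<^esub> g) \<in> tensor_rels V H"

definition tensor_class ::
    "'v set \<Rightarrow> ('k::field, 'h, 'v, 'm) algebroid_scheme \<Rightarrow> ('h \<times> 'h \<Rightarrow>\<^sub>0 'k) \<Rightarrow> ('h \<times> 'h \<Rightarrow>\<^sub>0 'k) set"
  where "tensor_class V H t = {t'. t' - t \<in> Modules.module.span pm_scale (tensor_rels V H)}"

definition tensor_square ::
    "'v set \<Rightarrow> ('k::field, 'h, 'v, 'm) algebroid_scheme \<Rightarrow> ('h \<times> 'h \<Rightarrow>\<^sub>0 'k) set set" where
  "tensor_square V H =
     {tensor_class V H t | t. Poly_Mapping.keys t \<subseteq> carrier H \<times> carrier H}"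

text \<open>The map \<open>\<phi> \<otimes> \<phi>\<close> into \<open>K \<otimes>\<^sub>A K\<close>, applied to a coset by taking the union over its
  representatives; the union is a single coset precisely when the value does not depend on the
  representative.\<close>

definition tensor_map :: "'v set \<Rightarrow> ('k::field, 'g, 'v, 'm) algebroid_scheme \<Rightarrow> ('h \<Rightarrow> 'g) \<Rightarrow>
    ('h \<times> 'h \<Rightarrow>\<^sub>0 'k) set \<Rightarrow> ('g \<times> 'g \<Rightarrow>\<^sub>0 'k) set" where
  "tensor_map V K \<phi> T =
     (\<Union>t\<in>T. tensor_class V K (pm_extend (\<lambda>(h, h'). pm_basis (\<phi> h, \<phi> h')) t))"

definition quot_algebroid :: "('k, 'h, 'v, 'm) algebroid_scheme \<Rightarrow> 'h set \<Rightarrow> ('k, 'h set, 'v) algebroid"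
  where "quot_algebroid H I =
    \<lparr>carrier = carrier (H Quot I), monoid.mult = monoid.mult (H Quot I), one = one (H Quot I),
     zero = zero (H Quot I), add = add (H Quot I),
     smult = (\<lambda>c X. \<Union>h\<in>X. I +>\<^bsub>H\<^esub> (c \<odot>\<^bsub>H\<^esub> h)),
     src = (\<lambda>a. I +>\<^bsub>H\<^esub> src H a), tgt = (\<lambda>a. I +>\<^bsub>H\<^esub> tgt H a)\<rparr>"

text \<open>Quotient by the two-sided ideal generated by \<open>R\<close>, with the induced structure.\<close>

definition quot_hopf :: "'v set \<Rightarrow> ('k::field, 'h, 'v) hopf_algebroid \<Rightarrow> 'h set \<Rightarrow>
    ('k, 'h set, 'v) hopf_algebroid" where
  "quot_hopf V H R =
    (let I = genideal H R; Q = quot_algebroid H I in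
     algebroid.extend Q (hopf_algebroid.fields
       (\<lambda>X. \<Union>h\<in>X. tensor_map V Q (\<lambda>h'. I +>\<^bsub>H\<^esub> h') (comul H h))
       (\<lambda>X. the_elem (counit H ` X))))"

definition isotopy_quotient :: "'v set \<Rightarrow> ('k::field, 'h, 'v) hopf_algebroid \<Rightarrow>
    ('k, 'h set, 'v) hopf_algebroid" where
  "isotopy_quotient V H = quot_hopf V H {src H a \<ominus>\<^bsub>H\<^esub> tgt H a | a. a \<in> fun_on V}"

text \<open>Since comultiplication and counit of a quotient are computed from representatives, we
  record that they take values in the proper places.\<close>

definition hopf_data :: "'v set \<Rightarrow> ('k::field, 'h, 'v) hopf_algebroid \<Rightarrow> bool" where
  "hopf_data V H \<longleftrightarrow> ring H \<and>
     (\<forall>c. \<forall>h\<in>carrier H. c \<odot>\<^bsub>H\<^esub> h \<in> carrier H) \<and>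
     (\<forall>a\<in>fun_on V. src H a \<in> carrier H \<and> tgt H a \<in> carrier H) \<and>
     (\<forall>h\<in>carrier H. comul H h \<in> tensor_square V H \<and> counit H h \<in> fun_on V)"

definition hopf_algebroid_iso :: "'v set \<Rightarrow> ('k::field, 'h, 'v) hopf_algebroid \<Rightarrow>
    ('k, 'g, 'v) hopf_algebroid \<Rightarrow> ('h \<Rightarrow> 'g) \<Rightarrow> bool" where
  "hopf_algebroid_iso V H K \<phi> \<longleftrightarrow> hopf_data V H \<and> hopf_data V K \<and>
     \<phi> \<in> ring_iso H K \<and>
     (\<forall>c. \<forall>h\<in>carrier H. \<phi> (c \<odot>\<^bsub>H\<^esub> h) = c \<odot>\<^bsub>K\<^esub> \<phi> h) \<and>
     (\<forall>a\<in>fun_on V. \<phi> (src H a) = src K a \<and> \<phi> (tgt H a) = tgt K a) \<and>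
     (\<forall>h\<in>carrier H. comul K (\<phi> h) = tensor_map V K \<phi> (comul H h)) \<and>
     (\<forall>h\<in>carrier H. counit K (\<phi> h) = counit H h)"


section \<open>The calculus of a digraph\<close>

text \<open>\<open>A\<close>, \<open>\<Omega>\<^sup>1\<close> and \<open>\<XX>\<^sup>1\<close> are modelled by coefficient functions with respect to the bases
  \<open>f\<^sub>p\<close>, \<open>\<omega>\<^bsub>a\<rightarrow>b\<^esub>\<close> and \<open>e\<^bsub>b\<leftarrow>a\<^esub>\<close>. Both \<open>\<omega>\<^bsub>a\<rightarrow>b\<^esub>\<close> and \<open>e\<^bsub>b\<leftarrow>a\<^esub>\<close> are indexed by the arc \<open>(a, b)\<close>, so
  the bimodule structure on \<open>\<Omega>\<^sup>1\<close> is \<open>(r \<omega> s)(a, b) = r a * \<omega> (a, b) * s b\<close>, while on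
  \<open>\<XX>\<^sup>1\<close> it is \<open>(r x s)(a, b) = r b * x (a, b) * s a\<close>.\<close>

definition algA :: "'v pair_pre_digraph \<Rightarrow> ('v \<Rightarrow> 'k::field) set" where
  "algA D = fun_on (pverts D)"

definition unitA :: "'v pair_pre_digraph \<Rightarrow> 'v \<Rightarrow> 'k::field" where
  "unitA D = (\<Sum>p\<in>pverts D. bas p)"

definition X1 :: "'v pair_pre_digraph \<Rightarrow> ('v \<times> 'v \<Rightarrow> 'k::field) set" where
  "X1 D = fun_on (parcs D)"

definition Om_lact :: "('v \<Rightarrow> 'k::field) \<Rightarrow> ('v \<times> 'v \<Rightarrow> 'k) \<Rightarrow> ('v \<times> 'v \<Rightarrow> 'k)" where
  "Om_lact r \<omega> = (\<lambda>(a, b). r a * \<omega> (a, b))"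

definition X_lact :: "('v \<Rightarrow> 'k::field) \<Rightarrow> ('v \<times> 'v \<Rightarrow> 'k) \<Rightarrow> ('v \<times> 'v \<Rightarrow> 'k)" where
  "X_lact r x = (\<lambda>(a, b). r b * x (a, b))"

definition X_ract :: "('v \<times> 'v \<Rightarrow> 'k::field) \<Rightarrow> ('v \<Rightarrow> 'k) \<Rightarrow> ('v \<times> 'v \<Rightarrow> 'k)" where
  "X_ract x s = (\<lambda>(a, b). x (a, b) * s a)"

definition d0_bas :: "'v pair_pre_digraph \<Rightarrow> 'v \<Rightarrow> ('v \<times> 'v \<Rightarrow> 'k::field)" where
  "d0_bas D p = (\<Sum>a\<in>{a. (a, p) \<in> parcs D}. bas (a, p)) - (\<Sum>b\<in>{b. (p, b) \<in> parcs D}. bas (p, b))"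

definition d0 :: "'v pair_pre_digraph \<Rightarrow> ('v \<Rightarrow> 'k::field) \<Rightarrow> ('v \<times> 'v \<Rightarrow> 'k)" where
  "d0 D a = (\<lambda>e. \<Sum>p\<in>pverts D. a p * d0_bas D p e)"

definition ev1 :: "'v pair_pre_digraph \<Rightarrow> ('v \<times> 'v \<Rightarrow> 'k::field) \<Rightarrow> ('v \<times> 'v \<Rightarrow> 'k) \<Rightarrow> ('v \<Rightarrow> 'k)" where
  "ev1 D x \<omega> = (\<lambda>p. \<Sum>(a, b)\<in>parcs D. x (a, b) * \<omega> (a, b) * bas b p)"

definition uev1 :: "'v pair_pre_digraph \<Rightarrow> ('v \<times> 'v \<Rightarrow> 'k::field) \<Rightarrow> ('v \<times> 'v \<Rightarrow> 'k) \<Rightarrow> ('v \<Rightarrow> 'k)" where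
  "uev1 D \<omega> x = (\<lambda>p. \<Sum>(a, b)\<in>parcs D. \<omega> (a, b) * x (a, b) * bas a p)"

text \<open>\<open>\<Omega>\<^sup>1 \<otimes>\<^sub>A \<Omega>\<^sup>1\<close> is modelled by coefficient functions with respect to its basis
  \<open>\<omega>\<^bsub>a\<rightarrow>b\<^esub> \<otimes> \<omega>\<^bsub>b\<rightarrow>c\<^esub>\<close>, indexed by the paths of length two. As \<open>\<omega>\<^bsub>a\<rightarrow>b\<^esub> \<otimes> \<omega>\<^bsub>b'\<rightarrow>c\<^esub> = 0\<close> for
  \<open>b \<noteq> b'\<close>, the tensor product of one-forms is given by multiplying coefficients.\<close>

definition paths2 :: "'v pair_pre_digraph \<Rightarrow> ('v \<times> 'v \<times> 'v) set" where
  "paths2 D = {(a, b, c). (a, b) \<in> parcs D \<and> (b, c) \<in> parcs D}"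

definition Om_tensor :: "('v \<times> 'v \<Rightarrow> 'k::field) \<Rightarrow> ('v \<times> 'v \<Rightarrow> 'k) \<Rightarrow> ('v \<times> 'v \<times> 'v \<Rightarrow> 'k)" where
  "Om_tensor \<omega> \<eta> = (\<lambda>(a, b, c). \<omega> (a, b) * \<eta> (b, c))"

definition wedge_ker :: "'v pair_pre_digraph \<Rightarrow> ('v \<times> 'v \<times> 'v \<Rightarrow> 'k::field) set" where
  "wedge_ker D = fun_span
     {\<Sum>b\<in>{b. (a, b, c) \<in> paths2 D}. Om_tensor (bas (a, b)) (bas (b, c)) | a c.
        a \<in> pverts D \<and> c \<in> pverts D \<and> (a, c) \<notin> parcs D}"

text \<open>\<open>ch a c\<close> is the midpoint of the path from \<open>a\<close> to \<open>c\<close> that is chosen when there is no arc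
  from \<open>a\<close> to \<open>c\<close>; the value of \<open>ch\<close> is irrelevant if no such path exists.\<close>

definition path_choice :: "'v pair_pre_digraph \<Rightarrow> ('v \<Rightarrow> 'v \<Rightarrow> 'v) \<Rightarrow> bool" where
  "path_choice D ch \<longleftrightarrow>
     (\<forall>a c. (a, c) \<notin> parcs D \<and> (\<exists>b. (a, b, c) \<in> paths2 D) \<longrightarrow> (a, ch a c, c) \<in> paths2 D)"

definition basis2 :: "'v pair_pre_digraph \<Rightarrow> ('v \<Rightarrow> 'v \<Rightarrow> 'v) \<Rightarrow> ('v \<times> 'v \<times> 'v) set" where
  "basis2 D ch = paths2 D - {(a, ch a c, c) | a c. (a, c) \<notin> parcs D}"

text \<open>\<open>\<Omega>\<^sup>2\<^sub>t\<^sub>o\<^sub>p\<close> is modelled by coefficient functions with respect to the basis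
  \<open>\<omega>\<^bsub>a\<rightarrow>b\<^esub> \<and> \<omega>\<^bsub>b\<rightarrow>c\<^esub>\<close>, \<open>(a, b, c) \<in> basis2 D ch\<close>. Accordingly the projection maps an element of
  \<open>\<Omega>\<^sup>1 \<otimes>\<^sub>A \<Omega>\<^sup>1\<close> to the coefficients of its class.\<close>

definition wedge_proj :: "'v pair_pre_digraph \<Rightarrow> ('v \<Rightarrow> 'v \<Rightarrow> 'v) \<Rightarrow>
    ('v \<times> 'v \<times> 'v \<Rightarrow> 'k::field) \<Rightarrow> ('v \<times> 'v \<times> 'v \<Rightarrow> 'k)" where
  "wedge_proj D ch \<tau> = (THE \<sigma>. \<sigma> \<in> fun_on (basis2 D ch) \<and> \<tau> - \<sigma> \<in> wedge_ker D)"

definition wedge :: "'v pair_pre_digraph \<Rightarrow> ('v \<Rightarrow> 'v \<Rightarrow> 'v) \<Rightarrow>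
    ('v \<times> 'v \<Rightarrow> 'k::field) \<Rightarrow> ('v \<times> 'v \<Rightarrow> 'k) \<Rightarrow> ('v \<times> 'v \<times> 'v \<Rightarrow> 'k)" where
  "wedge D ch \<omega> \<eta> = wedge_proj D ch (Om_tensor \<omega> \<eta>)"

fun d1_bas :: "'v pair_pre_digraph \<Rightarrow> ('v \<Rightarrow> 'v \<Rightarrow> 'v) \<Rightarrow> 'v \<times> 'v \<Rightarrow>
    ('v \<times> 'v \<times> 'v \<Rightarrow> 'k::field)" where
  "d1_bas D ch (a, b) =
     (\<Sum>t\<in>{t. (b, t) \<in> parcs D}. wedge D ch (bas (a, b)) (bas (b, t)))
   + (\<Sum>s\<in>{s. (s, a) \<in> parcs D}. wedge D ch (bas (s, a)) (bas (a, b)))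
   - (\<Sum>i\<in>{i. (a, i, b) \<in> paths2 D}. wedge D ch (bas (a, i)) (bas (i, b)))"

definition X2 :: "'v pair_pre_digraph \<Rightarrow> ('v \<Rightarrow> 'v \<Rightarrow> 'v) \<Rightarrow> ('v \<times> 'v \<times> 'v \<Rightarrow> 'k::field) set" where
  "X2 D ch = fun_on (basis2 D ch)"

definition ev2 :: "'v pair_pre_digraph \<Rightarrow> ('v \<Rightarrow> 'v \<Rightarrow> 'v) \<Rightarrow>
    ('v \<times> 'v \<times> 'v \<Rightarrow> 'k::field) \<Rightarrow> ('v \<times> 'v \<times> 'v \<Rightarrow> 'k) \<Rightarrow> ('v \<Rightarrow> 'k)" where
  "ev2 D ch \<xi> \<sigma> = (\<lambda>v. \<Sum>(p, q, r)\<in>basis2 D ch. \<xi> (p, q, r) * \<sigma> (p, q, r) * bas r v)"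

definition uev2 :: "'v pair_pre_digraph \<Rightarrow> ('v \<Rightarrow> 'v \<Rightarrow> 'v) \<Rightarrow>
    ('v \<times> 'v \<times> 'v \<Rightarrow> 'k::field) \<Rightarrow> ('v \<times> 'v \<times> 'v \<Rightarrow> 'k) \<Rightarrow> ('v \<Rightarrow> 'k)" where
  "uev2 D ch \<sigma> \<xi> = (\<lambda>v. \<Sum>(p, q, r)\<in>basis2 D ch. \<sigma> (p, q, r) * \<xi> (p, q, r) * bas p v)"

text \<open>For the arc \<open>i = (a, b)\<close> the coevaluations are \<open>\<Sum>\<^sub>i d b\<^sub>i \<otimes> x\<^sub>i\<close> with
  \<open>b\<^sub>i = - f\<^sub>a\<close> and \<open>\<Sum>\<^sub>i y\<^sub>i \<otimes> d c\<^sub>i\<close> with \<open>c\<^sub>i = f\<^sub>b\<close>; here \<open>x\<^sub>i = y\<^sub>i = e\<^bsub>b\<leftarrow>a\<^esub>\<close> and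
  \<open>\<omega>\<^sub>i = \<rho>\<^sub>i = \<omega>\<^bsub>a\<rightarrow>b\<^esub>\<close> are all \<open>bas i\<close>.\<close>

definition coev_b :: "'v \<times> 'v \<Rightarrow> ('v \<Rightarrow> 'k::field)" where
  "coev_b i = - bas (fst i)"

definition coev_c :: "'v \<times> 'v \<Rightarrow> ('v \<Rightarrow> 'k::field)" where
  "coev_c i = bas (snd i)"


section \<open>The Hopf algebroids \<open>H\<XX>\<^sup>1\<close> and \<open>\<D>\<XX>\<close>\<close>

text \<open>The free algebra on a set of generators consists of the linear combinations of words;
  its product comes from the instance of \<open>\<Rightarrow>\<^sub>0\<close> for additive monoids.\<close>

datatype 'g fword = FWord (letters: "'g list")

instantiation fword :: (type) monoid_add
begin
definition zero_fword :: "'a fword" where "0 = FWord []"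
definition plus_fword :: "'a fword \<Rightarrow> 'a fword \<Rightarrow> 'a fword" where
  "u + v = FWord (letters u @ letters v)"
instance by standard (simp_all add: zero_fword_def plus_fword_def)
end

text \<open>\<open>Src a\<close>, \<open>Tgt a\<close>, \<open>Vec x\<close>, \<open>CVec x\<close> stand for \<open>a\<close>, \<open>a\<close> overlined, \<open>x\<close>, \<open>x\<close> overlined.\<close>

datatype ('v, 'k) generator =
  Src "'v \<Rightarrow> 'k" | Tgt "'v \<Rightarrow> 'k" | Vec "'v \<times> 'v \<Rightarrow> 'k" | CVec "'v \<times> 'v \<Rightarrow> 'k"

type_synonym ('v, 'k) free = "('v, 'k) generator fword \<Rightarrow>\<^sub>0 'k"

definition generators :: "'v pair_pre_digraph \<Rightarrow> ('v, 'k::field) generator set" where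
  "generators D = Src ` algA D \<union> Tgt ` algA D \<union> Vec ` X1 D \<union> CVec ` X1 D"

definition gen :: "('v, 'k::field) generator \<Rightarrow> ('v, 'k) free" where
  "gen g = pm_basis (FWord [g])"

abbreviation gsrc :: "('v \<Rightarrow> 'k::field) \<Rightarrow> ('v, 'k) free" where "gsrc a \<equiv> gen (Src a)"
abbreviation gtgt :: "('v \<Rightarrow> 'k::field) \<Rightarrow> ('v, 'k) free" where "gtgt a \<equiv> gen (Tgt a)"
abbreviation gvec :: "('v \<times> 'v \<Rightarrow> 'k::field) \<Rightarrow> ('v, 'k) free" where "gvec x \<equiv> gen (Vec x)"
abbreviation gcvec :: "('v \<times> 'v \<Rightarrow> 'k::field) \<Rightarrow> ('v, 'k) free" where "gcvec x \<equiv> gen (CVec x)"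

definition cmt :: "'r::ring \<Rightarrow> 'r \<Rightarrow> 'r" where
  "cmt u v = u * v - v * u"

text \<open>The comultiplication on the free algebra, with values in the tensor square over \<open>\<bbbK>\<close>, which
  is the algebra of linear combinations of pairs of words with componentwise concatenation.\<close>

fun delta_gen :: "'v pair_pre_digraph \<Rightarrow> ('v, 'k::field) generator \<Rightarrow>
    (('v, 'k) generator fword \<times> ('v, 'k) generator fword \<Rightarrow>\<^sub>0 'k)" where
  "delta_gen D (Src a) = pm_tensor (gsrc a) 1"
| "delta_gen D (Tgt a) = pm_tensor 1 (gtgt a)"
| "delta_gen D (Vec x) = pm_tensor (gvec x) 1
     + (\<Sum>i\<in>parcs D. pm_tensor (cmt (gvec x) (gtgt (coev_b i))) (gvec (bas i)))"
| "delta_gen D (CVec y) = pm_tensor 1 (gcvec y)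
     + (\<Sum>j\<in>parcs D. pm_tensor (gcvec (bas j)) (cmt (gcvec y) (gsrc (coev_c j))))"

definition delta_free :: "'v pair_pre_digraph \<Rightarrow> ('v, 'k::field) free \<Rightarrow>
    (('v, 'k) generator fword \<times> ('v, 'k) generator fword \<Rightarrow>\<^sub>0 'k)" where
  "delta_free D = pm_extend (\<lambda>w. prod_list (map (delta_gen D) (letters w)))"

text \<open>By \<open>\<epsilon>(g h) = \<epsilon>(g \<epsilon>(h))\<close> the counit of a word is computed from the right, where
  \<open>eps_gen D g b = \<epsilon>(g b)\<close> for a generator \<open>g\<close> and \<open>b \<in> A\<close>. Here
  \<open>\<epsilon>(x b) = \<epsilon>(x b + ev(x \<otimes> db)) = ev(x \<otimes> db)\<close> by the relation between \<open>x\<close> and \<open>b\<close>; for overlined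
  vectors one uses the overlined \<open>b\<close> instead of \<open>b\<close>, which has the same counit.\<close>

fun eps_gen :: "'v pair_pre_digraph \<Rightarrow> ('v, 'k::field) generator \<Rightarrow> ('v \<Rightarrow> 'k) \<Rightarrow> ('v \<Rightarrow> 'k)" where
  "eps_gen D (Src a) b = a * b"
| "eps_gen D (Tgt a) b = b * a"
| "eps_gen D (Vec x) b = ev1 D x (d0 D b)"
| "eps_gen D (CVec x) b = uev1 D (d0 D b) x"

definition eps_free :: "'v pair_pre_digraph \<Rightarrow> ('v, 'k::field) free \<Rightarrow> ('v \<Rightarrow> 'k)" where
  "eps_free D u = (\<lambda>p. \<Sum>w\<in>Poly_Mapping.keys u.
     Poly_Mapping.lookup u w * foldr (eps_gen D) (letters w) (unitA D) p)"

text \<open>The free algebra with the structure maps on representatives. This is not yet a Hopf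
  algebroid; its quotient \<open>HX\<close> below is.\<close>

definition free_hopf :: "'v pair_pre_digraph \<Rightarrow> ('k::field, ('v, 'k) free, 'v) hopf_algebroid" where
  "free_hopf D =
    \<lparr>carrier = {u. \<forall>w\<in>Poly_Mapping.keys u. set (letters w) \<subseteq> generators D},
     monoid.mult = (*), one = 1, zero = 0, add = (+), smult = pm_scale, src = gsrc, tgt = gtgt,
     comul = (\<lambda>u. {pm_extend (\<lambda>(w, w'). pm_basis (pm_basis w, pm_basis w')) (delta_free D u)}),
     counit = eps_free D\<rparr>"

text \<open>A relation \<open>u = v\<close> is represented by \<open>u - v\<close>. The rules up to \<open>cvec_scale\<close> say that \<open>A\<close>
  and its opposite are mapped to \<open>H\<XX>\<^sup>1\<close> by unital algebra maps and \<open>\<XX>\<^sup>1\<close> by linear maps. Elements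
  of \<open>A \<otimes> A\<close> (over \<open>\<bbbK>\<close>) are given as sums \<open>\<Sum>m<n. r m \<otimes> s m\<close>.\<close>

inductive_set hx_rels :: "'v pair_pre_digraph \<Rightarrow> ('v, 'k::field) free set"
  for D :: "'v pair_pre_digraph" where
  src_add: "\<lbrakk>a \<in> algA D; b \<in> algA D\<rbrakk> \<Longrightarrow> gsrc (a + b) - (gsrc a + gsrc b) \<in> hx_rels D"
| src_scale: "a \<in> algA D \<Longrightarrow> gsrc (\<lambda>p. c * a p) - pm_scale c (gsrc a) \<in> hx_rels D"
| src_mult: "\<lbrakk>a \<in> algA D; b \<in> algA D\<rbrakk> \<Longrightarrow> gsrc a * gsrc b - gsrc (a * b) \<in> hx_rels D"
| src_one: "gsrc (unitA D) - 1 \<in> hx_rels D"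
| tgt_add: "\<lbrakk>a \<in> algA D; b \<in> algA D\<rbrakk> \<Longrightarrow> gtgt (a + b) - (gtgt a + gtgt b) \<in> hx_rels D"
| tgt_scale: "a \<in> algA D \<Longrightarrow> gtgt (\<lambda>p. c * a p) - pm_scale c (gtgt a) \<in> hx_rels D"
| tgt_mult: "\<lbrakk>a \<in> algA D; b \<in> algA D\<rbrakk> \<Longrightarrow> gtgt a * gtgt b - gtgt (b * a) \<in> hx_rels D"
| tgt_one: "gtgt (unitA D) - 1 \<in> hx_rels D"
| vec_add: "\<lbrakk>x \<in> X1 D; y \<in> X1 D\<rbrakk> \<Longrightarrow> gvec (x + y) - (gvec x + gvec y) \<in> hx_rels D"
| vec_scale: "x \<in> X1 D \<Longrightarrow> gvec (\<lambda>e. c * x e) - pm_scale c (gvec x) \<in> hx_rels D"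
| cvec_add: "\<lbrakk>x \<in> X1 D; y \<in> X1 D\<rbrakk> \<Longrightarrow> gcvec (x + y) - (gcvec x + gcvec y) \<in> hx_rels D"
| cvec_scale: "x \<in> X1 D \<Longrightarrow> gcvec (\<lambda>e. c * x e) - pm_scale c (gcvec x) \<in> hx_rels D"
| src_tgt: "\<lbrakk>a \<in> algA D; b \<in> algA D\<rbrakk> \<Longrightarrow> gsrc a * gtgt b - gtgt b * gsrc a \<in> hx_rels D"
| src_vec: "\<lbrakk>a \<in> algA D; x \<in> X1 D\<rbrakk> \<Longrightarrow> gsrc a * gvec x - gvec (X_lact a x) \<in> hx_rels D"
| vec_src: "\<lbrakk>a \<in> algA D; x \<in> X1 D\<rbrakk> \<Longrightarrow>
    gvec x * gsrc a - (gvec (X_ract x a) + gsrc (ev1 D x (d0 D a))) \<in> hx_rels D"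
| tgt_cvec: "\<lbrakk>a \<in> algA D; x \<in> X1 D\<rbrakk> \<Longrightarrow> gtgt a * gcvec x - gcvec (X_ract x a) \<in> hx_rels D"
| cvec_tgt: "\<lbrakk>a \<in> algA D; x \<in> X1 D\<rbrakk> \<Longrightarrow>
    gcvec x * gtgt a - (gcvec (X_lact a x) + gtgt (uev1 D (d0 D a) x)) \<in> hx_rels D"
| tgt_vec_tgt: "\<lbrakk>\<And>m. m < n \<Longrightarrow> r m \<in> algA D; \<And>m. m < n \<Longrightarrow> s m \<in> algA D;
    (\<Sum>m<(n::nat). r m * s m) = 0; (\<Sum>m<n. Om_lact (r m) (d0 D (s m))) = 0; x \<in> X1 D\<rbrakk> \<Longrightarrow>
    (\<Sum>m<n. gtgt (s m) * gvec x * gtgt (r m)) \<in> hx_rels D"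
| src_cvec_src: "\<lbrakk>\<And>m. m < n \<Longrightarrow> r m \<in> algA D; \<And>m. m < n \<Longrightarrow> s m \<in> algA D;
    (\<Sum>m<(n::nat). r m * s m) = 0; (\<Sum>m<n. Om_lact (r m) (d0 D (s m))) = 0; x \<in> X1 D\<rbrakk> \<Longrightarrow>
    (\<Sum>m<n. gsrc (r m) * gcvec x * gsrc (s m)) \<in> hx_rels D"
| cvec_coev: "x \<in> X1 D \<Longrightarrow>
    (\<Sum>i\<in>parcs D. cmt (gcvec x) (gsrc (coev_b i)) * gvec (bas i)) - gcvec x \<in> hx_rels D"
| vec_coev: "x \<in> X1 D \<Longrightarrow>
    (\<Sum>j\<in>parcs D. cmt (gvec x) (gtgt (coev_c j)) * gcvec (bas j)) - gvec x \<in> hx_rels D"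
| vec_cvec: "\<lbrakk>a \<in> algA D; x \<in> X1 D\<rbrakk> \<Longrightarrow>
    (\<Sum>j\<in>parcs D. cmt (gvec (bas j)) (gtgt a) * cmt (gcvec x) (gsrc (coev_c j)))
    - gtgt (ev1 D x (d0 D a)) \<in> hx_rels D"
| cvec_vec: "\<lbrakk>a \<in> algA D; x \<in> X1 D\<rbrakk> \<Longrightarrow>
    (\<Sum>i\<in>parcs D. cmt (gcvec (bas i)) (gsrc a) * cmt (gvec x) (gtgt (coev_b i)))
    - gsrc (uev1 D (d0 D a) x) \<in> hx_rels D"

definition HX :: "'v pair_pre_digraph \<Rightarrow> ('k::field, ('v, 'k) free set, 'v) hopf_algebroid" where
  "HX D = quot_hopf (pverts D) (free_hopf D) (hx_rels D)"

inductive_set dx_rels :: "'v pair_pre_digraph \<Rightarrow> ('v \<Rightarrow> 'v \<Rightarrow> 'v) \<Rightarrow> ('v, 'k::field) free set"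
  for D :: "'v pair_pre_digraph" and ch :: "'v \<Rightarrow> 'v \<Rightarrow> 'v" where
  curvature: "\<xi> \<in> X2 D ch \<Longrightarrow>
    (\<Sum>i\<in>parcs D. gsrc (ev2 D ch \<xi> (d1_bas D ch i)) * gvec (bas i))
    - (\<Sum>j\<in>parcs D. \<Sum>k\<in>parcs D.
        gsrc (ev2 D ch \<xi> (wedge D ch (bas j) (bas k))) * gvec (bas k) * gvec (bas j))
    \<in> dx_rels D ch"
| vec_vec: "\<lbrakk>\<xi> \<in> X2 D ch;
    \<And>m. m < n \<Longrightarrow> r m \<in> algA D; \<And>m. m < n \<Longrightarrow> a m \<in> algA D; \<And>m. m < n \<Longrightarrow> a' m \<in> algA D;
    (\<Sum>m<(n::nat). Om_tensor (Om_lact (r m) (d0 D (a m))) (d0 D (a' m))) \<in> wedge_ker D\<rbrakk> \<Longrightarrow>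
    (\<Sum>m<n. \<Sum>i\<in>parcs D. \<Sum>j\<in>parcs D. gsrc (ev2 D ch \<xi> (wedge D ch (bas i) (bas j)))
        * cmt (gvec (bas j)) (gtgt (a' m)) * cmt (gvec (bas i)) (gtgt (a m)) * gtgt (r m))
    \<in> dx_rels D ch"
| cvec_cvec: "\<lbrakk>\<xi> \<in> X2 D ch;
    \<And>m. m < n \<Longrightarrow> r m \<in> algA D; \<And>m. m < n \<Longrightarrow> a m \<in> algA D; \<And>m. m < n \<Longrightarrow> a' m \<in> algA D;
    (\<Sum>m<(n::nat). Om_tensor (Om_lact (r m) (d0 D (a m))) (d0 D (a' m))) \<in> wedge_ker D\<rbrakk> \<Longrightarrow>
    (\<Sum>m<n. \<Sum>i\<in>parcs D. \<Sum>j\<in>parcs D. gtgt (uev2 D ch (wedge D ch (bas i) (bas j)) \<xi>)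
        * gsrc (r m) * cmt (gcvec (bas i)) (gsrc (a m)) * cmt (gcvec (bas j)) (gsrc (a' m)))
    \<in> dx_rels D ch"

text \<open>The relations are expressed in the free algebra and imposed on the classes in \<open>HX D\<close>.\<close>

definition DX :: "'v pair_pre_digraph \<Rightarrow> ('v \<Rightarrow> 'v \<Rightarrow> 'v) \<Rightarrow>
    ('k::field, ('v, 'k) free set set, 'v) hopf_algebroid" where
  "DX D ch = quot_hopf (pverts D) (HX D)
     ((\<lambda>u. genideal (free_hopf D) (hx_rels D) +>\<^bsub>free_hopf D\<^esub> u) ` dx_rels D ch)"


section \<open>The fundamental groupoid and its groupoid algebra\<close>

text \<open>Existence of inverses is a property of a groupoid and not part of the data. The product
  \<open>acomp e e'\<close> is only meaningful if \<open>asrc e = atgt e'\<close>.\<close>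

record ('v, 'a) groupoid =
  objs :: "'v set"
  arrows :: "'a set"
  asrc :: "'a \<Rightarrow> 'v"
  atgt :: "'a \<Rightarrow> 'v"
  aid :: "'v \<Rightarrow> 'a"
  acomp :: "'a \<Rightarrow> 'a \<Rightarrow> 'a"

text \<open>\<open>Fwd a b\<close> is the generating arrow \<open>(b \<leftarrow> a)\<close> and \<open>Bwd a b\<close> its formal inverse.\<close>

datatype 'v step = Fwd 'v 'v | Bwd 'v 'v

fun step_src :: "'v step \<Rightarrow> 'v" where
  "step_src (Fwd a b) = a"
| "step_src (Bwd a b) = b"

fun step_tgt :: "'v step \<Rightarrow> 'v" where
  "step_tgt (Fwd a b) = b"
| "step_tgt (Bwd a b) = a"

fun step_arc :: "'v step \<Rightarrow> 'v \<times> 'v" where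
  "step_arc (Fwd a b) = (a, b)"
| "step_arc (Bwd a b) = (a, b)"

fun step_inv :: "'v step \<Rightarrow> 'v step" where
  "step_inv (Fwd a b) = Bwd a b"
| "step_inv (Bwd a b) = Fwd a b"

text \<open>\<open>zigzag D t w s\<close>: the word \<open>w\<close> is composable, with target \<open>t\<close> and source \<open>s\<close>. As in the
  product of arrows, the last step of a zigzag comes first in the word.\<close>

fun zigzag :: "'v pair_pre_digraph \<Rightarrow> 'v \<Rightarrow> 'v step list \<Rightarrow> 'v \<Rightarrow> bool" where
  "zigzag D t [] s \<longleftrightarrow> t = s \<and> t \<in> pverts D"
| "zigzag D t (g # w) s \<longleftrightarrow> step_arc g \<in> parcs D \<and> step_tgt g = t \<and> zigzag D (step_src g) w s"

definition zigzags :: "'v pair_pre_digraph \<Rightarrow> ('v \<times> 'v step list \<times> 'v) set" where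
  "zigzags D = {(t, w, s). zigzag D t w s}"

inductive_set pi_rels :: "'v pair_pre_digraph \<Rightarrow> ('v step list \<times> 'v step list) set"
  for D :: "'v pair_pre_digraph" where
  triangle: "\<lbrakk>(p, q) \<in> parcs D; (q, r) \<in> parcs D; (p, r) \<in> parcs D\<rbrakk> \<Longrightarrow>
    ([Fwd q r, Fwd p q], [Fwd p r]) \<in> pi_rels D"
| square: "\<lbrakk>(p, q) \<in> parcs D; (q, r) \<in> parcs D; (p, q') \<in> parcs D; (q', r) \<in> parcs D\<rbrakk> \<Longrightarrow>
    ([Fwd q r, Fwd p q], [Fwd q' r, Fwd p q']) \<in> pi_rels D"

text \<open>The congruence generated by a set of relations between words and by the relations
  \<open>g.g\<^sup>-\<^sup>1 = id\<close> defining the free groupoid (which is the case \<open>R = {}\<close>).\<close>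

inductive_set zigzag_eq ::
    "'v pair_pre_digraph \<Rightarrow> ('v step list \<times> 'v step list) set \<Rightarrow>
     (('v \<times> 'v step list \<times> 'v) \<times> ('v \<times> 'v step list \<times> 'v)) set"
  for D :: "'v pair_pre_digraph" and R :: "('v step list \<times> 'v step list) set" where
  refl: "x \<in> zigzags D \<Longrightarrow> (x, x) \<in> zigzag_eq D R"
| sym: "(x, y) \<in> zigzag_eq D R \<Longrightarrow> (y, x) \<in> zigzag_eq D R"
| trans: "\<lbrakk>(x, y) \<in> zigzag_eq D R; (y, z) \<in> zigzag_eq D R\<rbrakk> \<Longrightarrow> (x, z) \<in> zigzag_eq D R"
| cancel: "(t, u @ [g, step_inv g] @ v, s) \<in> zigzags D \<Longrightarrow>
    ((t, u @ [g, step_inv g] @ v, s), (t, u @ v, s)) \<in> zigzag_eq D R"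
| rel: "\<lbrakk>(l, r) \<in> R; (t, u @ l @ v, s) \<in> zigzags D; (t, u @ r @ v, s) \<in> zigzags D\<rbrakk> \<Longrightarrow>
    ((t, u @ l @ v, s), (t, u @ r @ v, s)) \<in> zigzag_eq D R"

definition presented_groupoid ::
    "'v pair_pre_digraph \<Rightarrow> ('v step list \<times> 'v step list) set \<Rightarrow>
     ('v, ('v \<times> 'v step list \<times> 'v) set) groupoid" where
  "presented_groupoid D R =
    \<lparr>objs = pverts D,
     arrows = zigzags D // zigzag_eq D R,
     asrc = (\<lambda>X. the_elem ((\<lambda>(t, w, s). s) ` X)),
     atgt = (\<lambda>X. the_elem ((\<lambda>(t, w, s). t) ` X)),
     aid = (\<lambda>p. zigzag_eq D R `` {(p, [], p)}),
     acomp = (\<lambda>X Y. zigzag_eq D R `` {(t, u @ v, s) | t u m v s. (t, u, m) \<in> X \<and> (m, v, s) \<in> Y})\<rparr>"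

definition fundamental_groupoid ::
    "'v pair_pre_digraph \<Rightarrow> ('v, ('v \<times> 'v step list \<times> 'v) set) groupoid" where
  "fundamental_groupoid D = presented_groupoid D (pi_rels D)"

definition groupoid_alg_base :: "('v, 'a) groupoid \<Rightarrow> ('k::field, 'a \<Rightarrow>\<^sub>0 'k, 'v) algebroid" where
  "groupoid_alg_base G =
    \<lparr>carrier = {u. Poly_Mapping.keys u \<subseteq> arrows G},
     monoid.mult = (\<lambda>u v. pm_extend (\<lambda>e. pm_extend (\<lambda>e'.
       if asrc G e = atgt G e' then pm_basis (acomp G e e') else 0) v) u),
     one = (\<Sum>p\<in>objs G. pm_basis (aid G p)), zero = 0, add = (+), smult = pm_scale,
     src = (\<lambda>a. \<Sum>p\<in>objs G. pm_scale (a p) (pm_basis (aid G p))),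
     tgt = (\<lambda>a. \<Sum>p\<in>objs G. pm_scale (a p) (pm_basis (aid G p)))\<rparr>"

definition groupoid_algebra :: "('v, 'a) groupoid \<Rightarrow> ('k::field, 'a \<Rightarrow>\<^sub>0 'k, 'v) hopf_algebroid" where
  "groupoid_algebra G = algebroid.extend (groupoid_alg_base G) (hopf_algebroid.fields
     (\<lambda>u. tensor_class (objs G) (groupoid_alg_base G)
        (pm_extend (\<lambda>e. pm_basis (pm_basis e, pm_basis e)) u))
     (\<lambda>u p. \<Sum>e\<in>Poly_Mapping.keys u. Poly_Mapping.lookup u e * bas (atgt G e) p))"

end

theory Submission
  imports Defs
begin

text \<open>
  In the isotopy quotient the two copies of \<open>A\<close> are identified. For an arc from \<open>p\<close> to \<open>q\<close> the relations
  between functions and the vector \<open>e = e\<^bsub>q\<leftarrow>p\<^esub>\<close> become \<open>f\<^sub>q e = e\<close> and \<open>e f\<^sub>p = e - f\<^sub>q\<close>. Hence \<open>E = f\<^sub>q - e\<close>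
  satisfies \<open>f\<^sub>q E = E = E f\<^sub>p\<close>, as an arrow from \<open>p\<close> to \<open>q\<close> does in a groupoid algebra. In the same way
  the overlined vector \<open>e'\<close> gives an element \<open>E' = e' + f\<^sub>p\<close> that behaves like an arrow from \<open>q\<close> to \<open>p\<close>.
  In terms of these elements the relations with coevaluations say that \<open>E' E = f\<^sub>p\<close> and \<open>E E' = f\<^sub>q\<close>, and
  the curvature relation for a path \<open>p \<rightarrow> q \<rightarrow> r\<close> says that \<open>E\<^bsub>qr\<^esub> E\<^bsub>pq\<^esub>\<close> equals \<open>E\<^bsub>pr\<^esub>\<close> if there is an arc
  from \<open>p\<close> to \<open>r\<close>, and equals the product along the chosen path from \<open>p\<close> to \<open>r\<close> otherwise. These are
  the defining relations of the algebra of the fundamental groupoid, in which the other relations of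
  the isotopy quotient hold automatically.

  Accordingly, the proof starts from an algebra map \<open>Phi\<close> from the free algebra to the groupoid algebra
  that sends \<open>e\<close> to \<open>f\<^sub>q - E\<close> and \<open>e'\<close> to \<open>E' - f\<^sub>p\<close>. It annihilates all relations (\<open>Phi_hx_rels\<close>,
  \<open>Phi_dx_rels\<close>) and so descends to the three successive quotients (\<open>hopf_hom_quot\<close>). Modulo the
  relations, the free algebra is spanned by products \<open>Z z\<close> along zigzags (\<open>free_in_L\<close>), such a product
  depends only on the class of the zigzag in the fundamental groupoid (\<open>Z_eqv\<close>), and \<open>Phi\<close> maps it to
  that class, a basis element (\<open>Phi_Z\<close>). Therefore the induced map is bijective (\<open>Phi_kernel\<close>, \<open>Phi_surj\<close>).

  Comultiplication and counit of the quotients are computed from representatives in the free algebra.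
  Word by word, \<open>Phi\<close> intertwines them with those of the groupoid algebra (\<open>hopf_hom_Phi\<close>); for the
  comultiplication this rests on the fact that the arrows are grouplike and have a fixed source
  (\<open>same_target_gmul2_grouplike\<close>). So their values on representatives, seen in the groupoid algebra,
  depend only on the image under \<open>Phi\<close>. As the induced map is bijective, they are well defined on the
  isotopy quotient and correspond to those of the groupoid algebra (\<open>hopf_hom_bij_iso\<close>).
\<close>

section \<open>Linear maps between spaces of finitely supported functions\<close>

lemma lookup_pm_scale [simp]: "Poly_Mapping.lookup (pm_scale c u) i = c * Poly_Mapping.lookup u i"
  by (simp add: pm_scale_def Poly_Mapping.map.rep_eq when_def)

interpretation pm: Modules.module "pm_scale :: 'k::field \<Rightarrow> ('i \<Rightarrow>\<^sub>0 'k) \<Rightarrow> ('i \<Rightarrow>\<^sub>0 'k)"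
  by standard (auto intro!: poly_mapping_eqI simp: lookup_add algebra_simps)

lemma pm_scale_single: "pm_scale c (Poly_Mapping.single i d) = Poly_Mapping.single i (c * d)"
  by (auto intro!: poly_mapping_eqI simp: lookup_single when_def)

lemma keys_pm_scale: "Poly_Mapping.keys (pm_scale c u) \<subseteq> Poly_Mapping.keys u"
  by (auto simp: in_keys_iff)

lemma pm_extend_superset:
  assumes "finite S" "Poly_Mapping.keys u \<subseteq> S"
  shows "pm_extend f u = (\<Sum>i\<in>S. pm_scale (Poly_Mapping.lookup u i) (f i))"
  unfolding pm_extend_def using assms
  by (intro sum.mono_neutral_left) (auto simp: in_keys_iff)

lemma pm_extend_add: "pm_extend f (u + v) = pm_extend f u + pm_extend f v"
proof -
  let ?S = "Poly_Mapping.keys u \<union> Poly_Mapping.keys v"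
  have "pm_extend f (u + v) = (\<Sum>i\<in>?S. pm_scale (Poly_Mapping.lookup (u + v) i) (f i))"
    by (rule pm_extend_superset) (simp_all add: keys_add)
  also have "\<dots> = pm_extend f u + pm_extend f v"
    by (simp add: lookup_add pm.scale_left_distrib sum.distrib pm_extend_superset[of ?S u f]
        pm_extend_superset[of ?S v f])
  finally show ?thesis .
qed

lemma pm_extend_scale: "pm_extend f (pm_scale c u) = pm_scale c (pm_extend f u)"
  using keys_pm_scale[of c u]
  by (simp add: pm_extend_superset[of "Poly_Mapping.keys u" "pm_scale c u"]
      pm_extend_superset[of "Poly_Mapping.keys u" u] pm.scale_sum_right)

abbreviation pm_linear :: "(('i \<Rightarrow>\<^sub>0 'k::field) \<Rightarrow> ('j \<Rightarrow>\<^sub>0 'k)) \<Rightarrow> bool" where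
  "pm_linear \<equiv> Modules.module_hom pm_scale pm_scale"

lemma pm_linearI:
  assumes "\<And>u v. f (u + v) = f u + f v" and "\<And>c u. f (pm_scale c u) = pm_scale c (f u)"
  shows "pm_linear f"
  by (simp add: module_hom_iff pm.module_axioms assms)

lemma pm_linear_extend: "pm_linear (pm_extend f)"
  by (intro pm_linearI pm_extend_add pm_extend_scale)

lemmas pm_linearD = module_hom.add module_hom.scale module_hom.zero module_hom.diff
  module_hom.neg module_hom.sum

lemmas pm_extend_lin = pm_linearD[OF pm_linear_extend]

lemma pm_linear_comp: "pm_linear f \<Longrightarrow> pm_linear g \<Longrightarrow> pm_linear (\<lambda>x. g (f x))"
  using module_hom_compose[of pm_scale pm_scale f pm_scale g] by (simp add: o_def)

lemma pm_extend_single [simp]: "pm_extend f (Poly_Mapping.single i c) = pm_scale c (f i)"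
  by (cases "c = 0") (auto simp: pm_extend_def)

lemma pm_extend_pm_basis: "pm_extend pm_basis u = u"
proof (rule poly_mapping_eqI)
  fix k
  have *: "Poly_Mapping.lookup u i * Poly_Mapping.lookup (pm_basis i) k
      = (if i = k then Poly_Mapping.lookup u k else 0)" for i
    by (auto simp: lookup_single when_def)
  show "Poly_Mapping.lookup (pm_extend pm_basis u) k = Poly_Mapping.lookup u k"
    by (auto simp: pm_extend_def lookup_sum * in_keys_iff)
qed

lemma pm_expansion: "u = (\<Sum>i\<in>Poly_Mapping.keys u. pm_scale (Poly_Mapping.lookup u i) (pm_basis i))"
  using pm_extend_pm_basis[of u] by (simp add: pm_extend_def)

lemma pm_linear_expand:
  assumes "pm_linear f"
  shows "f u = pm_extend (\<lambda>i. f (pm_basis i)) u"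
proof -
  interpret f: Modules.module_hom pm_scale pm_scale f by fact
  have "f u = f (\<Sum>i\<in>Poly_Mapping.keys u. pm_scale (Poly_Mapping.lookup u i) (pm_basis i))"
    using pm_expansion[of u] by simp
  then show ?thesis by (simp only: f.sum f.scale pm_extend_def)
qed

lemma pm_linear_eq:
  assumes "pm_linear f" "pm_linear g"
    and "\<And>i. i \<in> Poly_Mapping.keys u \<Longrightarrow> f (pm_basis i) = g (pm_basis i)"
  shows "f u = g u"
proof -
  have "f u = pm_extend (\<lambda>i. f (pm_basis i)) u" by (rule pm_linear_expand[OF assms(1)])
  also have "\<dots> = pm_extend (\<lambda>i. g (pm_basis i)) u" by (simp add: pm_extend_def assms(3))
  also have "\<dots> = g u" by (rule pm_linear_expand[OF assms(2), symmetric])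
  finally show ?thesis .
qed

lemma pm_bilinear_eq:
  assumes "\<And>v. pm_linear (\<lambda>u. B u v)" "\<And>u. pm_linear (B u)"
    and "\<And>v. pm_linear (\<lambda>u. B' u v)" "\<And>u. pm_linear (B' u)"
    and basis: "\<And>i j. i \<in> Poly_Mapping.keys u \<Longrightarrow> j \<in> Poly_Mapping.keys v \<Longrightarrow>
      B (pm_basis i) (pm_basis j) = B' (pm_basis i) (pm_basis j)"
  shows "B u v = B' u v"
proof -
  have "B (pm_basis i) v = B' (pm_basis i) v" if "i \<in> Poly_Mapping.keys u" for i
    by (rule pm_linear_eq[OF assms(2,4)]) (rule basis[OF that])
  then show ?thesis by (rule pm_linear_eq[OF assms(1,3)])
qed

lemma pm_extend_cong:
  "(\<And>i. i \<in> Poly_Mapping.keys u \<Longrightarrow> f i = g i) \<Longrightarrow> pm_extend f u = pm_extend g u"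
  by (simp add: pm_extend_def)

lemma pm_extend_compose:
  assumes "pm_linear g"
  shows "g (pm_extend f u) = pm_extend (\<lambda>i. g (f i)) u"
proof -
  interpret g: Modules.module_hom pm_scale pm_scale g by fact
  show ?thesis by (simp only: pm_extend_def g.sum g.scale)
qed

lemma pm_extend_in_span:
  assumes "\<And>i. i \<in> Poly_Mapping.keys u \<Longrightarrow> f i \<in> S" "pm.subspace S"
  shows "pm_extend f u \<in> S"
  unfolding pm_extend_def using assms by (intro pm.subspace_sum pm.subspace_scale) auto

lemma pm_subspace_keys: "pm.subspace {u. Poly_Mapping.keys u \<subseteq> S}"
  unfolding pm.subspace_def by (auto simp: subset_iff in_keys_iff lookup_add) (metis add.right_neutral)

lemma keys_pm_extend:
  assumes "\<And>i. i \<in> Poly_Mapping.keys u \<Longrightarrow> Poly_Mapping.keys (f i) \<subseteq> S"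
  shows "Poly_Mapping.keys (pm_extend f u) \<subseteq> S"
  using pm_extend_in_span[of u f "{u. Poly_Mapping.keys u \<subseteq> S}", OF _ pm_subspace_keys] assms
  by auto

lemma pm_linear_id: "pm_linear (\<lambda>x. x)"
  by (rule pm.module_hom_ident)

lemma pm_linear_extend_fun:
  assumes "\<And>i. pm_linear (\<lambda>v. f v i)"
  shows "pm_linear (\<lambda>v. pm_extend (f v) u)"
  unfolding pm_extend_def
  by (intro pm_linearI)
    (simp_all add: module_hom.add[OF assms] module_hom.scale[OF assms] sum.distrib
      pm.scale_right_distrib pm.scale_sum_right mult.commute)

lemma pm_linear_tensor_left: "pm_linear (\<lambda>u. pm_tensor u v)"
  unfolding pm_tensor_def by (rule pm_linear_extend)

lemma pm_linear_tensor_right: "pm_linear (pm_tensor u)"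
  unfolding pm_tensor_def by (intro pm_linear_extend_fun pm_linear_extend)

lemmas pm_tensor_lin = pm_linearD[OF pm_linear_tensor_left] pm_linearD[OF pm_linear_tensor_right]

lemma pm_tensor_basis [simp]: "pm_tensor (pm_basis i) (pm_basis j) = pm_basis (i, j)"
  by (simp add: pm_tensor_def)

lemma keys_pm_tensor:
  "Poly_Mapping.keys u \<subseteq> S \<Longrightarrow> Poly_Mapping.keys v \<subseteq> T \<Longrightarrow> Poly_Mapping.keys (pm_tensor u v) \<subseteq> S \<times> T"
  unfolding pm_tensor_def by (intro keys_pm_extend) auto


section \<open>Quotients of Hopf algebroids\<close>

text \<open>What makes the quotient by an ideal an algebroid again. The compatibility
  \<open>c \<odot> h = (c \<odot> 1) \<otimes> h\<close> makes every ideal a subspace, so that scalar multiplication descends.\<close>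

definition algebroid_struct :: "'v set \<Rightarrow> ('k::field, 'h, 'v, 'm) algebroid_scheme \<Rightarrow> bool" where
  "algebroid_struct V H \<longleftrightarrow> ring H \<and>
     (\<forall>c. \<forall>h\<in>carrier H. c \<odot>\<^bsub>H\<^esub> h \<in> carrier H \<and> c \<odot>\<^bsub>H\<^esub> h = (c \<odot>\<^bsub>H\<^esub> \<one>\<^bsub>H\<^esub>) \<otimes>\<^bsub>H\<^esub> h) \<and>
     (\<forall>a\<in>fun_on V. src H a \<in> carrier H \<and> tgt H a \<in> carrier H)"

lemma algebroid_structD:
  assumes "algebroid_struct V H"
  shows "ring H" and "h \<in> carrier H \<Longrightarrow> c \<odot>\<^bsub>H\<^esub> h \<in> carrier H"
    and "h \<in> carrier H \<Longrightarrow> c \<odot>\<^bsub>H\<^esub> h = (c \<odot>\<^bsub>H\<^esub> \<one>\<^bsub>H\<^esub>) \<otimes>\<^bsub>H\<^esub> h"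
    and "a \<in> fun_on V \<Longrightarrow> src H a \<in> carrier H" and "a \<in> fun_on V \<Longrightarrow> tgt H a \<in> carrier H"
  using assms unfolding algebroid_struct_def by blast+

definition algebroid_hom :: "'v set \<Rightarrow> ('k::field, 'h, 'v, 'm) algebroid_scheme \<Rightarrow>
    ('k, 'g, 'v, 'n) algebroid_scheme \<Rightarrow> ('h \<Rightarrow> 'g) \<Rightarrow> bool" where
  "algebroid_hom V H K f \<longleftrightarrow> f \<in> ring_hom H K \<and>
     (\<forall>c. \<forall>h\<in>carrier H. f (c \<odot>\<^bsub>H\<^esub> h) = c \<odot>\<^bsub>K\<^esub> f h) \<and>
     (\<forall>a\<in>fun_on V. f (src H a) = src K a \<and> f (tgt H a) = tgt K a)"

definition tens :: "('h \<Rightarrow> 'g) \<Rightarrow> ('h \<times> 'h \<Rightarrow>\<^sub>0 'k::field) \<Rightarrow> ('g \<times> 'g \<Rightarrow>\<^sub>0 'k)" where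
  "tens f = pm_extend (\<lambda>(h, h'). pm_basis (f h, f h'))"

lemma tens_basis [simp]: "tens f (pm_basis (h, h')) = pm_basis (f h, f h')"
  by (simp add: tens_def)

lemma tensor_map_tens: "tensor_map V K f T = (\<Union>t\<in>T. tensor_class V K (tens f t))"
  by (simp add: tensor_map_def tens_def)

lemma pm_linear_tens: "pm_linear (tens f)"
  unfolding tens_def by (rule pm_linear_extend)

lemma tens_compose:
  assumes "\<And>h. h \<in> S \<Longrightarrow> g (f h) = k h" "Poly_Mapping.keys t \<subseteq> S \<times> S"
  shows "tens g (tens f t) = tens k t"
  by (rule pm_linear_eq[OF pm_linear_comp[OF pm_linear_tens pm_linear_tens] pm_linear_tens])
    (use assms in auto)

lemma tens_ident:
  assumes "\<And>h. h \<in> S \<Longrightarrow> f h = h" "Poly_Mapping.keys t \<subseteq> S \<times> S"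
  shows "tens f t = t"
  by (rule pm_linear_eq[OF pm_linear_tens pm_linear_id]) (use assms in auto)

lemma keys_tens:
  assumes "f ` S \<subseteq> T" "Poly_Mapping.keys t \<subseteq> S \<times> S"
  shows "Poly_Mapping.keys (tens f t) \<subseteq> T \<times> T"
  unfolding tens_def
proof (rule keys_pm_extend)
  fix i assume "i \<in> Poly_Mapping.keys t"
  then obtain h h' where "i = (h, h')" "h \<in> S" "h' \<in> S" using assms(2) by blast
  then show "Poly_Mapping.keys (case i of (h, h') \<Rightarrow> pm_basis (f h, f h')) \<subseteq> T \<times> T"
    using assms(1) by auto
qed

lemma keys_diff_subset:
  "Poly_Mapping.keys u \<subseteq> S \<Longrightarrow> Poly_Mapping.keys v \<subseteq> S \<Longrightarrow> Poly_Mapping.keys (u - v) \<subseteq> S"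
  for u v :: "'i \<Rightarrow>\<^sub>0 'k::field"
  using pm.subspace_diff[OF pm_subspace_keys, of u S v] by auto

lemma tensor_rels_keys:
  fixes H :: "('k::field, 'h, 'v, 'm) algebroid_scheme"
  assumes "algebroid_struct V H" "t \<in> tensor_rels V H"
  shows "Poly_Mapping.keys t \<subseteq> carrier H \<times> carrier H"
proof -
  interpret ring H using algebroid_structD(1)[OF assms(1)] .
  have keys: "Poly_Mapping.keys (pm_scale c (pm_basis (h, g))) \<subseteq> carrier H \<times> carrier H"
    if "h \<in> carrier H" "g \<in> carrier H" for c :: 'k and h g
    using that by (auto simp: pm_scale_single split: if_splits)
  have keys1: "Poly_Mapping.keys (pm_basis (h, g) :: _ \<Rightarrow>\<^sub>0 'k) \<subseteq> carrier H \<times> carrier H"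
    if "h \<in> carrier H" "g \<in> carrier H" for h g
    using that by auto
  have st: "c \<odot>\<^bsub>H\<^esub> h \<in> carrier H" "a \<in> fun_on V \<Longrightarrow> src H a \<in> carrier H"
    "a \<in> fun_on V \<Longrightarrow> tgt H a \<in> carrier H" if "h \<in> carrier H" for c h a
    using algebroid_structD[OF assms(1)] that by blast+
  show ?thesis
    using assms(2)
  proof cases
    case add_left
    then show ?thesis by (simp only:) (intro keys_diff_subset keys1 a_closed)
  next
    case add_right
    then show ?thesis by (simp only:) (intro keys_diff_subset keys1 a_closed)
  next
    case scale_left
    then show ?thesis by (simp only:) (intro keys_diff_subset keys keys1 st)
  next
    case scale_right
    then show ?thesis by (simp only:) (intro keys_diff_subset keys keys1 st)
  next
    case balanced
    then show ?thesis by (simp only:) (intro keys_diff_subset keys1 m_closed st; assumption)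
  qed
qed

lemma tensor_span_keys:
  assumes "algebroid_struct V H" "t \<in> pm.span (tensor_rels V H)"
  shows "Poly_Mapping.keys t \<subseteq> carrier H \<times> carrier H"
proof -
  have "pm.span (tensor_rels V H) \<subseteq> {u. Poly_Mapping.keys u \<subseteq> carrier H \<times> carrier H}"
    by (rule pm.span_minimal) (use tensor_rels_keys[OF assms(1)] pm_subspace_keys in auto)
  then show ?thesis using assms(2) by auto
qed

lemma tens_tensor_rels:
  assumes "algebroid_struct V H" "algebroid_hom V H K f" "t \<in> tensor_rels V H"
  shows "tens f t \<in> tensor_rels V K"
proof -
  interpret ring H using algebroid_structD(1)[OF assms(1)] .
  have hom: "f (h \<oplus>\<^bsub>H\<^esub> h') = f h \<oplus>\<^bsub>K\<^esub> f h'" "f (h \<otimes>\<^bsub>H\<^esub> h') = f h \<otimes>\<^bsub>K\<^esub> f h'"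
    "f h \<in> carrier K"
    if "h \<in> carrier H" "h' \<in> carrier H" for h h'
    using assms(2) that by (auto simp: algebroid_hom_def ring_hom_def)
  note lin = pm_linearD[OF pm_linear_tens]
  show ?thesis
    using assms(3)
  proof cases
    case (add_left h h' g)
    then show ?thesis using tensor_rels.add_left[of "f h" K "f h'" "f g"]
      by (auto simp: lin hom)
  next
    case (add_right g h h')
    then show ?thesis using tensor_rels.add_right[of "f g" K "f h" "f h'"]
      by (auto simp: lin hom)
  next
    case (scale_left h g c)
    then show ?thesis using tensor_rels.scale_left[of "f h" K "f g"] assms(2)
      by (auto simp: lin hom algebroid_hom_def)
  next
    case (scale_right g h c)
    then show ?thesis using tensor_rels.scale_right[of "f g" K "f h"] assms(2)
      by (auto simp: lin hom algebroid_hom_def)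
  next
    case (balanced h g a)
    then have "src H a \<in> carrier H" "tgt H a \<in> carrier H" "f (src H a) = src K a" "f (tgt H a) = tgt K a"
      using assms(2) algebroid_structD(4,5)[OF assms(1)] by (auto simp: algebroid_hom_def)
    then show ?thesis using balanced tensor_rels.balanced[of "f h" K "f g" a V]
      by (auto simp: lin hom)
  qed
qed

lemma tens_tensor_span:
  assumes "algebroid_struct V H" "algebroid_hom V H K f" "t \<in> pm.span (tensor_rels V H)"
  shows "tens f t \<in> pm.span (tensor_rels V K)"
proof -
  interpret m: Modules.module_hom pm_scale pm_scale "tens f" by (rule pm_linear_tens)
  have "tens f ` pm.span (tensor_rels V H) = pm.span (tens f ` tensor_rels V H)"
    by (simp add: m.span_image)
  also have "\<dots> \<subseteq> pm.span (tensor_rels V K)"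
    by (intro pm.span_mono) (use tens_tensor_rels[OF assms(1,2)] in auto)
  finally show ?thesis using assms(3) by auto
qed

lemma tensor_class_self: "t \<in> tensor_class V H t"
  by (simp add: tensor_class_def pm.span_zero)

lemma tensor_class_eqI: "t' \<in> tensor_class V H t \<Longrightarrow> tensor_class V H t' = tensor_class V H t"
proof -
  assume "t' \<in> tensor_class V H t"
  then have t': "t' - t \<in> pm.span (tensor_rels V H)" by (simp add: tensor_class_def)
  have "x - t' \<in> pm.span (tensor_rels V H) \<longleftrightarrow> x - t \<in> pm.span (tensor_rels V H)" for x
    using pm.span_add[OF _ t', of "x - t'"] pm.span_diff[OF _ t', of "x - t"] by auto
  then show ?thesis by (simp add: tensor_class_def)
qed

lemma tensor_class_eq_iff: "tensor_class V H t' = tensor_class V H t \<longleftrightarrow> t' - t \<in> pm.span (tensor_rels V H)"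
proof
  assume "tensor_class V H t' = tensor_class V H t"
  then have "t' \<in> tensor_class V H t" using tensor_class_self[of t' V H] by metis
  then show "t' - t \<in> pm.span (tensor_rels V H)" by (simp add: tensor_class_def)
next
  assume "t' - t \<in> pm.span (tensor_rels V H)"
  then show "tensor_class V H t' = tensor_class V H t"
    by (intro tensor_class_eqI) (simp add: tensor_class_def)
qed

text \<open>This notion survives passing to quotients: comultiplication and counit of \<open>H\<close> may be given on
  representatives, so that \<open>comul H h\<close> is merely a set of elements of \<open>H \<otimes>\<^sub>\<bbbK> H\<close>, each of which has
  to be mapped into the right coset.\<close>

definition hopf_hom :: "'v set \<Rightarrow> ('k::field, 'h, 'v) hopf_algebroid \<Rightarrow>
    ('k, 'g, 'v) hopf_algebroid \<Rightarrow> ('h \<Rightarrow> 'g) \<Rightarrow> bool" where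
  "hopf_hom V H K f \<longleftrightarrow> algebroid_hom V H K f \<and>
     (\<forall>h\<in>carrier H. comul H h \<noteq> {} \<and> counit H h = counit K (f h) \<and>
        (\<forall>t\<in>comul H h. Poly_Mapping.keys t \<subseteq> carrier H \<times> carrier H \<and> tens f t \<in> comul K (f h)))"

text \<open>Quotient rings and the records built from them have different types, but agree in the fields
  on which being a ring depends.\<close>

lemma ring_field_cong:
  assumes "ring R" "carrier S = carrier R" "monoid.mult S = monoid.mult R" "one S = one R"
    "zero S = zero R" "add S = add R"
  shows "ring S"
proof -
  interpret R: ring R by fact
  have "abelian_group S"
  proof (rule abelian_groupI)
    fix x assume "x \<in> carrier S"
    then show "\<exists>y\<in>carrier S. y \<oplus>\<^bsub>S\<^esub> x = \<zero>\<^bsub>S\<^esub>"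
      using assms R.l_neg[of x] R.a_inv_closed[of x] by auto
  qed (use assms in \<open>auto simp: R.a_ac\<close>)
  moreover have "Group.monoid S"
    by (rule monoidI) (use assms in \<open>simp_all add: R.m_assoc\<close>)
  ultimately show ?thesis
    by (rule ringI) (use assms in \<open>simp_all add: R.l_distr R.r_distr\<close>)
qed

lemma quot_hopf_simps:
  "carrier (quot_hopf V H R) = carrier (H Quot genideal H R)"
  "monoid.mult (quot_hopf V H R) = monoid.mult (H Quot genideal H R)"
  "one (quot_hopf V H R) = one (H Quot genideal H R)"
  "zero (quot_hopf V H R) = zero (H Quot genideal H R)"
  "add (quot_hopf V H R) = add (H Quot genideal H R)"
  "smult (quot_hopf V H R) = (\<lambda>c X. \<Union>h\<in>X. genideal H R +>\<^bsub>H\<^esub> (c \<odot>\<^bsub>H\<^esub> h))"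
  "src (quot_hopf V H R) = (\<lambda>a. genideal H R +>\<^bsub>H\<^esub> src H a)"
  "tgt (quot_hopf V H R) = (\<lambda>a. genideal H R +>\<^bsub>H\<^esub> tgt H a)"
  "counit (quot_hopf V H R) = (\<lambda>X. the_elem (counit H ` X))"
  by (simp_all add: quot_hopf_def quot_algebroid_def Let_def algebroid.defs hopf_algebroid.defs)

text \<open>Likewise for a quotient algebroid and its extension by a comultiplication and a counit.\<close>

lemma tensor_rels_cong:
  fixes H :: "('k::field, 'h, 'v, 'm) algebroid_scheme" and H' :: "('k, 'h, 'v, 'n) algebroid_scheme"
  assumes "carrier H = carrier H'" "monoid.mult H = monoid.mult H'" "add H = add H'"
    "smult H = smult H'" "src H = src H'" "tgt H = tgt H'"
  shows "tensor_rels V H = tensor_rels V H'"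
proof (intro equalityI subsetI)
  fix t assume "t \<in> tensor_rels V H"
  then show "t \<in> tensor_rels V H'"
    by cases (use assms tensor_rels.intros[where H = H'] in auto)
next
  fix t assume "t \<in> tensor_rels V H'"
  then show "t \<in> tensor_rels V H"
    by cases (use assms[symmetric] tensor_rels.intros[where H = H] in auto)
qed

lemma comul_quot_hopf:
  "comul (quot_hopf V H R) X = (\<Union>h\<in>X. \<Union>t\<in>comul H h. 
     tensor_class V (quot_hopf V H R) (tens (\<lambda>h. genideal H R +>\<^bsub>H\<^esub> h) t))"
proof -
  have eq: "tensor_class V (quot_algebroid H (genideal H R)) t = tensor_class V (quot_hopf V H R) t" for t
    unfolding tensor_class_def
    by (subst tensor_rels_cong[of _ "quot_hopf V H R"]) (simp_all add: quot_hopf_simps quot_algebroid_def)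
  have "comul (quot_hopf V H R) X = (\<Union>h\<in>X. \<Union>t\<in>comul H h.
      tensor_class V (quot_algebroid H (genideal H R)) (tens (\<lambda>h. genideal H R +>\<^bsub>H\<^esub> h) t))"
    by (simp add: quot_hopf_def Let_def algebroid.defs hopf_algebroid.defs tensor_map_tens)
  then show ?thesis unfolding eq .
qed

lemma quot_hopf_carrier:
  "carrier (quot_hopf V H R) = (\<lambda>h. genideal H R +>\<^bsub>H\<^esub> h) ` carrier H"
  by (auto simp: quot_hopf_simps FactRing_def A_RCOSETS_def' image_iff)

lemma quot_hopf_proj:
  fixes H :: "('k::field, 'h, 'v) hopf_algebroid"
  assumes H: "algebroid_struct V H" and R: "R \<subseteq> carrier H"
  shows "algebroid_struct V (quot_hopf V H R)"
    and "algebroid_hom V H (quot_hopf V H R) (\<lambda>h. genideal H R +>\<^bsub>H\<^esub> h)"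
    and "r \<in> R \<Longrightarrow> genideal H R +>\<^bsub>H\<^esub> r = \<zero>\<^bsub>quot_hopf V H R\<^esub>"
proof -
  interpret ring H using algebroid_structD(1)[OF H] .
  define I where "I = genideal H R"
  define p where "p h = I +>\<^bsub>H\<^esub> h" for h
  define Q where "Q = quot_hopf V H R"
  interpret ideal I H unfolding I_def by (rule genideal_ideal[OF R])
  have simps: "carrier Q = carrier (H Quot I)" "monoid.mult Q = monoid.mult (H Quot I)"
    "one Q = one (H Quot I)" "zero Q = zero (H Quot I)" "add Q = add (H Quot I)"
    "src Q a = p (src H a)" "tgt Q a = p (tgt H a)" for a
    by (simp_all add: Q_def I_def p_def quot_hopf_simps)
  have carr: "carrier Q = p ` carrier H"
    unfolding Q_def p_def I_def by (rule quot_hopf_carrier)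
  have ringQ: "ring Q"
    by (rule ring_field_cong[OF quotient_is_ring]) (simp_all add: simps)
  have hom: "p \<in> ring_hom H Q"
    using rcos_ring_hom by (simp add: ring_hom_def simps p_def[abs_def])
  have same: "p x = p h" if "x \<in> p h" "h \<in> carrier H" for x h
    using a_repr_independence'[of x h] that by (simp add: p_def)
  have c1: "c \<odot>\<^bsub>H\<^esub> \<one>\<^bsub>H\<^esub> \<in> carrier H" for c
    by (rule algebroid_structD(2)[OF H one_closed])
  have sub: "x \<in> carrier H" if "x \<in> p h" "h \<in> carrier H" for x h
    using that a_r_coset_subset_G[OF a_subset] by (auto simp: p_def)
  have smult1: "p (c \<odot>\<^bsub>H\<^esub> x) = p (c \<odot>\<^bsub>H\<^esub> \<one>\<^bsub>H\<^esub>) \<otimes>\<^bsub>Q\<^esub> p x" if "x \<in> carrier H" for c x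
    using ring_hom_mult[OF hom c1 that] algebroid_structD(3)[OF H that] by simp
  have smult: "c \<odot>\<^bsub>Q\<^esub> p h = p (c \<odot>\<^bsub>H\<^esub> h)" if h: "h \<in> carrier H" for c h
  proof -
    have "c \<odot>\<^bsub>Q\<^esub> p h = (\<Union>x\<in>p h. p (c \<odot>\<^bsub>H\<^esub> x))"
      by (simp add: Q_def p_def I_def quot_hopf_simps)
    also have "\<dots> = (\<Union>x\<in>p h. p (c \<odot>\<^bsub>H\<^esub> h))"
    proof (rule SUP_cong[OF HOL.refl])
      fix x assume x: "x \<in> p h"
      show "p (c \<odot>\<^bsub>H\<^esub> x) = p (c \<odot>\<^bsub>H\<^esub> h)"
        unfolding smult1[OF h] smult1[OF sub[OF x h]] same[OF x h] ..
    qed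
    also have "\<dots> = p (c \<odot>\<^bsub>H\<^esub> h)"
      using a_rcos_self[OF h] by (intro UN_constant_eq[of h]) (simp_all add: p_def)
    finally show ?thesis .
  qed
  have one: "\<one>\<^bsub>Q\<^esub> = p \<one>\<^bsub>H\<^esub>" using ring_hom_one[OF hom] by simp
  show "algebroid_struct V (quot_hopf V H R)"
    unfolding algebroid_struct_def Q_def[symmetric]
  proof (intro conjI ballI allI ringQ)
    fix c X assume "X \<in> carrier Q"
    then obtain h where h: "h \<in> carrier H" and X: "X = p h" using carr by auto
    show "c \<odot>\<^bsub>Q\<^esub> X \<in> carrier Q"
      unfolding X smult[OF h] carr by (intro imageI algebroid_structD(2)[OF H h])
    show "c \<odot>\<^bsub>Q\<^esub> X = (c \<odot>\<^bsub>Q\<^esub> \<one>\<^bsub>Q\<^esub>) \<otimes>\<^bsub>Q\<^esub> X"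
      unfolding X one smult[OF h] smult[OF one_closed] by (rule smult1[OF h])
  next
    fix a :: "'v \<Rightarrow> 'k" assume "a \<in> fun_on V"
    then show "src Q a \<in> carrier Q" "tgt Q a \<in> carrier Q"
      using algebroid_structD(4,5)[OF H, of a] by (auto simp: carr simps(6,7))
  qed
  have "algebroid_hom V H Q p"
    using hom smult by (simp add: algebroid_hom_def simps(6,7))
  then show "algebroid_hom V H (quot_hopf V H R) (\<lambda>h. genideal H R +>\<^bsub>H\<^esub> h)"
    by (simp add: Q_def p_def[abs_def] I_def)
  show "genideal H R +>\<^bsub>H\<^esub> r = \<zero>\<^bsub>quot_hopf V H R\<^esub>" if "r \<in> R"
  proof -
    have "r \<in> I" using genideal_self[OF R] that by (auto simp: I_def)
    then have "p r = \<zero>\<^bsub>Q\<^esub>" using a_rcos_const[of r] by (simp add: p_def simps FactRing_def)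
    then show ?thesis by (simp add: p_def I_def Q_def)
  qed
qed

text \<open>The universal property of the quotient. The comultiplication of a coset is the union of the
  contributions of all its representatives; as \<open>f\<close> is constant on the coset, all of them are mapped
  into the same coset of \<open>K \<otimes>\<^sub>A K\<close>. The same argument gives the counit.\<close>

lemma hopf_hom_quot:
  fixes H :: "('k::field, 'h, 'v) hopf_algebroid" and K :: "('k, 'g, 'v) hopf_algebroid"
  assumes H: "algebroid_struct V H" and R: "R \<subseteq> carrier H"
    and K: "algebroid_struct V K" and comul: "\<And>y. y \<in> carrier K \<Longrightarrow> \<exists>s. comul K y = tensor_class V K s"
    and f: "hopf_hom V H K f" and kill: "\<And>r. r \<in> R \<Longrightarrow> f r = \<zero>\<^bsub>K\<^esub>"
  obtains f' where "hopf_hom V (quot_hopf V H R) K f'"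
    and "\<And>h. h \<in> carrier H \<Longrightarrow> f' (genideal H R +>\<^bsub>H\<^esub> h) = f h"
proof -
  interpret ring H using algebroid_structD(1)[OF H] .
  define I where "I = genideal H R"
  define p where "p h = I +>\<^bsub>H\<^esub> h" for h
  define Q where "Q = quot_hopf V H R"
  interpret ideal I H unfolding I_def by (rule genideal_ideal[OF R])
  have carr: "carrier Q = p ` carrier H"
    unfolding Q_def p_def I_def by (rule quot_hopf_carrier)
  have p: "algebroid_hom V H Q p" and Q: "algebroid_struct V Q"
    using quot_hopf_proj(1,2)[OF H R] by (simp_all add: Q_def p_def[abs_def] I_def)
  have hom: "p \<in> ring_hom H Q" and fhom: "f \<in> ring_hom H K" and fa: "algebroid_hom V H K f"
    using p f by (auto simp: algebroid_hom_def hopf_hom_def)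
  interpret f: ring_hom_ring H K f
    by (rule ring_hom_ringI2[OF ring_axioms algebroid_structD(1)[OF K] fhom])
  have "I \<subseteq> a_kernel H K f"
    unfolding I_def
  proof (rule genideal_minimal[OF f.kernel_is_ideal], rule subsetI)
    fix r assume "r \<in> R"
    then have "r \<in> carrier H" "f r = \<zero>\<^bsub>K\<^esub>" using R kill by blast+
    then show "r \<in> a_kernel H K f" unfolding a_kernel_def' by blast
  qed
  then have I0: "f x = \<zero>\<^bsub>K\<^esub>" if "x \<in> I" for x
    using that unfolding a_kernel_def' by blast
  have sub: "x \<in> carrier H" if "x \<in> p h" "h \<in> carrier H" for x h
    using that a_r_coset_subset_G[OF a_subset] by (auto simp: p_def)
  have same: "f x = f h" if "x \<in> p h" "h \<in> carrier H" for x h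
  proof -
    obtain i where "i \<in> I" "x = i \<oplus>\<^bsub>H\<^esub> h"
      using \<open>x \<in> p h\<close> by (auto simp: p_def a_r_coset_def')
    then show ?thesis using I0[of i] Icarr[of i] that(2) by simp
  qed
  have self: "h \<in> p h" if "h \<in> carrier H" for h using a_rcos_self[OF that] by (simp add: p_def)
  define f' where "f' X = the_elem (f ` X)" for X
  have f': "f' (p h) = f h" if "h \<in> carrier H" for h
  proof -
    have "f ` p h = {f h}"
      using same[OF _ that] self[OF that] by (intro equalityI subsetI) (blast, blast)
    then show ?thesis by (simp add: f'_def)
  qed
  have p_mult: "p g \<otimes>\<^bsub>Q\<^esub> p h = p (g \<otimes>\<^bsub>H\<^esub> h)" "p g \<oplus>\<^bsub>Q\<^esub> p h = p (g \<oplus>\<^bsub>H\<^esub> h)"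
    if "g \<in> carrier H" "h \<in> carrier H" for g h
    using ring_hom_mult[OF hom that] ring_hom_add[OF hom that] by simp_all
  have f'hom: "f' \<in> ring_hom Q K"
  proof (rule ring_hom_memI)
    fix X Y assume "X \<in> carrier Q" "Y \<in> carrier Q"
    then obtain g h where gh: "g \<in> carrier H" "X = p g" "h \<in> carrier H" "Y = p h"
      unfolding carr by auto
    show "f' X \<in> carrier K" using gh f' by simp
    show "f' (X \<otimes>\<^bsub>Q\<^esub> Y) = f' X \<otimes>\<^bsub>K\<^esub> f' Y" using gh by (simp add: p_mult f')
    show "f' (X \<oplus>\<^bsub>Q\<^esub> Y) = f' X \<oplus>\<^bsub>K\<^esub> f' Y" using gh by (simp add: p_mult f')
  next
    show "f' \<one>\<^bsub>Q\<^esub> = \<one>\<^bsub>K\<^esub>" using ring_hom_one[OF hom] f'[OF one_closed] by simp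
  qed
  have f'a: "algebroid_hom V Q K f'"
    unfolding algebroid_hom_def
  proof (intro conjI f'hom allI ballI)
    fix c X assume "X \<in> carrier Q"
    then obtain h where h: "h \<in> carrier H" "X = p h" unfolding carr by auto
    then have "c \<odot>\<^bsub>Q\<^esub> X = p (c \<odot>\<^bsub>H\<^esub> h)" using p by (simp add: algebroid_hom_def)
    then show "f' (c \<odot>\<^bsub>Q\<^esub> X) = c \<odot>\<^bsub>K\<^esub> f' X"
      using h fa f' algebroid_structD(2)[OF H h(1)] by (simp add: algebroid_hom_def)
  next
    fix a :: "'v \<Rightarrow> 'k" assume a: "a \<in> fun_on V"
    then have "src Q a = p (src H a)" "tgt Q a = p (tgt H a)" using p by (simp_all add: algebroid_hom_def)
    then show "f' (src Q a) = src K a" "f' (tgt Q a) = tgt K a"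
      using a fa f' algebroid_structD(4,5)[OF H a] by (simp_all add: algebroid_hom_def)
  qed
  have "hopf_hom V Q K f'"
    unfolding hopf_hom_def
  proof (intro conjI f'a ballI)
    fix X assume "X \<in> carrier Q"
    then obtain h where h: "h \<in> carrier H" and X: "X = p h" unfolding carr by auto
    have comulQ: "comul Q X = (\<Union>x\<in>p h. \<Union>t\<in>comul H x. tensor_class V Q (tens p t))"
      by (simp add: Q_def X p_def[abs_def] I_def comul_quot_hopf)
    have "comul H h \<noteq> {}" using f h by (auto simp: hopf_hom_def)
    then show "comul Q X \<noteq> {}"
      unfolding comulQ using self[OF h] tensor_class_self by fast
    have "counit H x = counit K (f h)" if "x \<in> p h" for x
      using f sub[OF that h] same[OF that h] by (simp add: hopf_hom_def)
    then have "counit H ` p h = {counit K (f h)}" using self[OF h] by (auto simp: image_iff)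
    then show "counit Q X = counit K (f' X)"
      by (simp add: Q_def quot_hopf_simps X f' h)
    fix t assume "t \<in> comul Q X"
    then obtain x s where x: "x \<in> p h" and s: "s \<in> comul H x" and t: "t \<in> tensor_class V Q (tens p s)"
      unfolding comulQ by auto
    have ks: "Poly_Mapping.keys s \<subseteq> carrier H \<times> carrier H" and fs: "tens f s \<in> comul K (f h)"
      using f s sub[OF x h] same[OF x h] by (auto simp: hopf_hom_def)
    have d: "t - tens p s \<in> pm.span (tensor_rels V Q)" using t by (simp add: tensor_class_def)
    have kp: "Poly_Mapping.keys (tens p s) \<subseteq> carrier Q \<times> carrier Q"
      by (rule keys_tens[OF _ ks]) (simp add: carr)
    have "Poly_Mapping.keys (t - tens p s - - tens p s) \<subseteq> carrier Q \<times> carrier Q"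
      by (intro keys_diff_subset tensor_span_keys[OF Q d]) (use kp in \<open>simp add: keys_def\<close>)
    then show "Poly_Mapping.keys t \<subseteq> carrier Q \<times> carrier Q" by simp
    have "tens f' t - tens f' (tens p s) \<in> pm.span (tensor_rels V K)"
      using tens_tensor_span[OF Q f'a d] by (simp add: module_hom.diff[OF pm_linear_tens])
    moreover have "tens f' (tens p s) = tens f s"
      by (rule tens_compose[OF _ ks]) (simp add: f')
    ultimately have 1: "tens f' t \<in> tensor_class V K (tens f s)" by (simp add: tensor_class_def)
    obtain s' where s': "comul K (f h) = tensor_class V K s'" using comul[OF f.hom_closed[OF h]] by blast
    then have "tensor_class V K (tens f s) = comul K (f h)" using fs by (metis tensor_class_eqI)
    then show "tens f' t \<in> comul K (f' X)" using 1 by (simp add: X f' h)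
  qed
  then show ?thesis using that[of f'] f' by (simp add: Q_def p_def I_def)
qed

text \<open>Here the comultiplication of a quotient turns out to be well defined: the contributions of
  the representatives of an element have the same image in \<open>K \<otimes>\<^sub>A K\<close>, and the map of tensor squares
  induced by the inverse of \<open>f\<close> shows that they agree already in \<open>Q \<otimes>\<^sub>A Q\<close>.\<close>

lemma hopf_hom_bij_iso:
  fixes H :: "('k::field, 'h, 'v) hopf_algebroid" and K :: "('k, 'g, 'v) hopf_algebroid"
  assumes H: "algebroid_struct V H" and R: "R \<subseteq> carrier H" and Q: "Q = quot_hopf V H R"
    and K: "algebroid_struct V K" "hopf_data V K"
    and comul: "\<And>y. y \<in> carrier K \<Longrightarrow> \<exists>s. comul K y = tensor_class V K s"
    and f: "hopf_hom V Q K f" and bij: "bij_betw f (carrier Q) (carrier K)"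
  shows "hopf_algebroid_iso V Q K f"
proof -
  have Qs: "algebroid_struct V Q" unfolding Q by (rule quot_hopf_proj(1)[OF H R])
  interpret Q: ring Q using algebroid_structD(1)[OF Qs] .
  have fa: "algebroid_hom V Q K f" using f by (simp add: hopf_hom_def)
  have iso: "f \<in> ring_iso Q K"
    using fa bij by (simp add: ring_iso_def algebroid_hom_def)
  define g where "g = inv_into (carrier Q) f"
  have ghom: "g \<in> ring_hom K Q"
    using ring_iso_set_sym[OF Q.ring_axioms iso] by (simp add: g_def ring_iso_def)
  have gf: "g (f h) = h" if "h \<in> carrier Q" for h
    using bij that by (simp add: g_def bij_betw_def)
  have fg: "f (g y) = y" "g y \<in> carrier Q" if "y \<in> carrier K" for y
    using bij that by (auto simp: g_def bij_betw_def f_inv_into_f inv_into_into)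
  have ga: "algebroid_hom V K Q g"
    unfolding algebroid_hom_def
  proof (intro conjI ghom allI ballI)
    fix c y assume y: "y \<in> carrier K"
    have "f (c \<odot>\<^bsub>Q\<^esub> g y) = c \<odot>\<^bsub>K\<^esub> y" using fa fg[OF y] by (simp add: algebroid_hom_def)
    then show "g (c \<odot>\<^bsub>K\<^esub> y) = c \<odot>\<^bsub>Q\<^esub> g y"
      using gf[OF algebroid_structD(2)[OF Qs fg(2)[OF y]]] by metis
  next
    fix a :: "'v \<Rightarrow> 'k" assume a: "a \<in> fun_on V"
    show "g (src K a) = src Q a" "g (tgt K a) = tgt Q a"
      using fa a gf[OF algebroid_structD(4)[OF Qs a]] gf[OF algebroid_structD(5)[OF Qs a]]
      by (simp_all add: algebroid_hom_def)
  qed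
  have inj: "t - t' \<in> pm.span (tensor_rels V Q)"
    if k: "Poly_Mapping.keys t \<subseteq> carrier Q \<times> carrier Q" "Poly_Mapping.keys t' \<subseteq> carrier Q \<times> carrier Q"
      and d: "tens f t - tens f t' \<in> pm.span (tensor_rels V K)" for t t'
  proof -
    have gfs: "tens g (tens f s) = s" if "Poly_Mapping.keys s \<subseteq> carrier Q \<times> carrier Q" for s :: "'h set \<times> 'h set \<Rightarrow>\<^sub>0 'k"
      using tens_compose[where g = g and f = f and k = "\<lambda>h. h", OF _ that] gf
        tens_ident[where f = "\<lambda>h. h", OF _ that] by simp
    show ?thesis
      using tens_tensor_span[OF K(1) ga d] by (simp add: module_hom.diff[OF pm_linear_tens] gfs k)
  qed
  have cl: "\<exists>t. Poly_Mapping.keys t \<subseteq> carrier Q \<times> carrier Q \<and> comul Q X = tensor_class V Q t"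
    and mp: "comul K (f X) = tensor_map V K f (comul Q X)" if X: "X \<in> carrier Q" for X
  proof -
    have fX: "f X \<in> carrier K" using X bij by (auto simp: bij_betw_def)
    obtain s where s: "comul K (f X) = tensor_class V K s" using comul[OF fX] by auto
    have "comul Q X \<noteq> {}" using f X by (simp add: hopf_hom_def)
    then obtain t where t: "t \<in> comul Q X" by blast
    have kt: "Poly_Mapping.keys u \<subseteq> carrier Q \<times> carrier Q" "tens f u \<in> tensor_class V K s"
      if "u \<in> comul Q X" for u
      using f X that by (auto simp: hopf_hom_def s)
    have all: "tensor_class V Q u = tensor_class V Q t" if u: "u \<in> comul Q X" for u
    proof -
      have "(tens f u - s) - (tens f t - s) \<in> pm.span (tensor_rels V K)"
        by (rule pm.span_diff) (use kt(2)[OF u] kt(2)[OF t] in \<open>simp_all add: tensor_class_def\<close>)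
      then show ?thesis unfolding tensor_class_eq_iff
        by (intro inj kt(1) u t) simp
    qed
    have "\<exists>T. comul Q X = (\<Union>u\<in>T. tensor_class V Q u)"
      unfolding Q comul_quot_hopf by (intro exI[of _ "\<Union>h\<in>X. tens (\<lambda>h. genideal H R +>\<^bsub>H\<^esub> h) ` comul H h"]) auto
    then obtain T where T: "comul Q X = (\<Union>u\<in>T. tensor_class V Q u)" by blast
    then have TQ: "u \<in> comul Q X" if "u \<in> T" for u using that tensor_class_self by blast
    have "comul Q X = (\<Union>u\<in>T. tensor_class V Q t)"
      unfolding T by (rule SUP_cong[OF HOL.refl], rule all, rule TQ)
    also have "\<dots> = tensor_class V Q t" using T t by auto
    finally have eq: "comul Q X = tensor_class V Q t" .
    then show "\<exists>t. Poly_Mapping.keys t \<subseteq> carrier Q \<times> carrier Q \<and> comul Q X = tensor_class V Q t"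
      using kt(1)[OF t] by auto
    have "tensor_map V K f (comul Q X) = (\<Union>u\<in>comul Q X. tensor_class V K s)"
      unfolding tensor_map_tens by (rule SUP_cong[OF HOL.refl], rule tensor_class_eqI, rule kt(2))
    also have "\<dots> = comul K (f X)" using t by (auto simp: s)
    finally show "comul K (f X) = tensor_map V K f (comul Q X)" by simp
  qed
  have cu: "counit Q X = counit K (f X)" if "X \<in> carrier Q" for X
    using f that by (simp add: hopf_hom_def)
  have fK: "f X \<in> carrier K" if "X \<in> carrier Q" for X using that bij by (auto simp: bij_betw_def)
  have "hopf_data V Q"
    unfolding hopf_data_def
  proof (intro conjI ballI allI Q.ring_axioms)
    show "c \<odot>\<^bsub>Q\<^esub> h \<in> carrier Q" if "h \<in> carrier Q" for c h
      by (rule algebroid_structD(2)[OF Qs that])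
    show "src Q a \<in> carrier Q" "tgt Q a \<in> carrier Q" if "a \<in> fun_on V" for a
      using algebroid_structD(4,5)[OF Qs that] .
    show "comul Q X \<in> tensor_square V Q" if "X \<in> carrier Q" for X
      using cl[OF that] by (auto simp: tensor_square_def)
    show "counit Q X \<in> fun_on V" if "X \<in> carrier Q" for X
      using cu[OF that] K(2) fK[OF that] by (simp add: hopf_data_def)
  qed
  then show ?thesis
    unfolding hopf_algebroid_iso_def
    using K(2) iso fa mp cu by (simp add: algebroid_hom_def)
qed

section \<open>The groupoid algebra\<close>

lemma pm_induct [consumes 1, case_names zero add]:
  assumes "Poly_Mapping.keys u \<subseteq> S" and "P 0"
    and "\<And>c i u. i \<in> S \<Longrightarrow> Poly_Mapping.keys u \<subseteq> S \<Longrightarrow> P u \<Longrightarrow> P (pm_scale c (pm_basis i) + u)"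
  shows "P (u :: 'i \<Rightarrow>\<^sub>0 'k::field)"
proof -
  have "Poly_Mapping.keys (\<Sum>i\<in>T. pm_scale (c i) (pm_basis i)) \<subseteq> S \<and>
      P (\<Sum>i\<in>T. pm_scale (c i) (pm_basis i))"
    if "finite T" "T \<subseteq> S" for T and c :: "'i \<Rightarrow> 'k"
    using that
  proof (induction T)
    case (insert x T)
    have "Poly_Mapping.keys (pm_scale (c x) (pm_basis x)) \<subseteq> S"
      using insert keys_pm_scale[of "c x" "pm_basis x"] by auto
    then have "Poly_Mapping.keys (pm_scale (c x) (pm_basis x) + (\<Sum>i\<in>T. pm_scale (c i) (pm_basis i))) \<subseteq> S"
      by (intro order_trans[OF keys_add]) (use insert in auto)
    then show ?case using insert assms(3) by auto
  qed (use assms(2) in auto)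
  from this[OF finite_keys assms(1), of "Poly_Mapping.lookup u"] show ?thesis
    unfolding pm_expansion[of u, symmetric] by simp
qed

text \<open>The groupoid algebra is the category algebra of the underlying category.\<close>

locale category_data =
  fixes G :: "('v, 'a) groupoid"
  assumes finite_objs: "finite (objs G)"
    and ends: "e \<in> arrows G \<Longrightarrow> asrc G e \<in> objs G" "e \<in> arrows G \<Longrightarrow> atgt G e \<in> objs G"
    and ident: "p \<in> objs G \<Longrightarrow> aid G p \<in> arrows G" "p \<in> objs G \<Longrightarrow> asrc G (aid G p) = p"
      "p \<in> objs G \<Longrightarrow> atgt G (aid G p) = p"
    and comp: "\<lbrakk>e \<in> arrows G; f \<in> arrows G; asrc G e = atgt G f\<rbrakk> \<Longrightarrow> acomp G e f \<in> arrows G"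
      "\<lbrakk>e \<in> arrows G; f \<in> arrows G; asrc G e = atgt G f\<rbrakk> \<Longrightarrow> asrc G (acomp G e f) = asrc G f"
      "\<lbrakk>e \<in> arrows G; f \<in> arrows G; asrc G e = atgt G f\<rbrakk> \<Longrightarrow> atgt G (acomp G e f) = atgt G e"
    and assoc: "\<lbrakk>e \<in> arrows G; f \<in> arrows G; g \<in> arrows G; asrc G e = atgt G f; asrc G f = atgt G g\<rbrakk> \<Longrightarrow>
      acomp G (acomp G e f) g = acomp G e (acomp G f g)"
    and unit: "e \<in> arrows G \<Longrightarrow> acomp G (aid G (atgt G e)) e = e"
      "e \<in> arrows G \<Longrightarrow> acomp G e (aid G (asrc G e)) = e"
begin

abbreviation alg :: "('k::field, 'a \<Rightarrow>\<^sub>0 'k, 'v) hopf_algebroid" where "alg \<equiv> groupoid_algebra G"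

abbreviation on_arrows :: "('a \<Rightarrow>\<^sub>0 'k::field) \<Rightarrow> bool" where
  "on_arrows u \<equiv> Poly_Mapping.keys u \<subseteq> arrows G"

abbreviation on_pairs :: "('a \<times> 'a \<Rightarrow>\<^sub>0 'k::field) \<Rightarrow> bool" where
  "on_pairs t \<equiv> Poly_Mapping.keys t \<subseteq> arrows G \<times> arrows G"

definition gmul :: "('a \<Rightarrow>\<^sub>0 'k::field) \<Rightarrow> ('a \<Rightarrow>\<^sub>0 'k) \<Rightarrow> ('a \<Rightarrow>\<^sub>0 'k)" where
  "gmul u v = pm_extend (\<lambda>e. pm_extend (\<lambda>e'.
     if asrc G e = atgt G e' then pm_basis (acomp G e e') else 0) v) u"

definition gscal :: "('v \<Rightarrow> 'k::field) \<Rightarrow> ('a \<Rightarrow>\<^sub>0 'k)" where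
  "gscal a = (\<Sum>p\<in>objs G. pm_scale (a p) (pm_basis (aid G p)))"

definition gunit :: "'a \<Rightarrow>\<^sub>0 'k::field" where
  "gunit = (\<Sum>p\<in>objs G. pm_basis (aid G p))"

definition geps :: "('a \<Rightarrow>\<^sub>0 'k::field) \<Rightarrow> 'v \<Rightarrow> 'k" where
  "geps u p = (\<Sum>e\<in>Poly_Mapping.keys u. Poly_Mapping.lookup u e * bas (atgt G e) p)"

definition diag :: "('a \<Rightarrow>\<^sub>0 'k::field) \<Rightarrow> ('a \<times> 'a \<Rightarrow>\<^sub>0 'k)" where
  "diag = pm_extend (\<lambda>e. pm_basis (e, e))"

text \<open>The projection onto the span of the pairs of arrows with the same target, a model of the
  tensor square over the base algebra.\<close>

definition same_target :: "('a \<times> 'a \<Rightarrow>\<^sub>0 'k::field) \<Rightarrow> ('a \<times> 'a \<Rightarrow>\<^sub>0 'k)" where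
  "same_target = pm_extend (\<lambda>(e, e'). if atgt G e = atgt G e' then pm_basis (e, e') else 0)"

definition pair_incl :: "('a \<times> 'a \<Rightarrow>\<^sub>0 'k::field) \<Rightarrow> (('a \<Rightarrow>\<^sub>0 'k) \<times> ('a \<Rightarrow>\<^sub>0 'k) \<Rightarrow>\<^sub>0 'k)" where
  "pair_incl = pm_extend (\<lambda>(e, e'). pm_basis (pm_basis e, pm_basis e'))"

lemma pm_linear_gmul_left: "pm_linear (\<lambda>u. gmul u v)"
  unfolding gmul_def by (rule pm_linear_extend)

lemma pm_linear_gmul_right: "pm_linear (gmul u)"
  unfolding gmul_def by (intro pm_linear_extend_fun pm_linear_extend)

lemmas gmul_lin = pm_linearD[OF pm_linear_gmul_left] pm_linearD[OF pm_linear_gmul_right]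

lemma gmul_basis: "gmul (pm_basis e) (pm_basis f) = (if asrc G e = atgt G f then pm_basis (acomp G e f) else 0)"
  by (simp add: gmul_def)

lemma gmul_closed: "on_arrows u \<Longrightarrow> on_arrows v \<Longrightarrow> on_arrows (gmul u v)"
  unfolding gmul_def by (intro keys_pm_extend) (auto intro!: comp(1) split: if_splits)

lemma gmul_assoc:
  assumes "on_arrows u" "on_arrows v" "on_arrows w"
  shows "gmul (gmul u v) w = gmul u (gmul v w)"
proof -
  have "gmul (gmul (pm_basis e) (pm_basis f)) (pm_basis g) = gmul (pm_basis e) (gmul (pm_basis f) (pm_basis g))"
    if "e \<in> arrows G" "f \<in> arrows G" "g \<in> arrows G" for e f g
    using that by (auto simp: gmul_basis gmul_lin comp assoc)
  then have "gmul (gmul (pm_basis e) (pm_basis f)) w = gmul (pm_basis e) (gmul (pm_basis f) w)"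
    if "e \<in> arrows G" "f \<in> arrows G" for e f
    by (intro pm_linear_eq[where f = "gmul (gmul (pm_basis e) (pm_basis f))" and u = w
          and g = "\<lambda>w. gmul (pm_basis e) (gmul (pm_basis f) w)", OF pm_linear_gmul_right
          pm_linear_comp[OF pm_linear_gmul_right pm_linear_gmul_right]])
      (use assms(3) that in blast)
  then have "gmul (gmul (pm_basis e) v) w = gmul (pm_basis e) (gmul v w)" if "e \<in> arrows G" for e
    by (intro pm_linear_eq[where f = "\<lambda>v. gmul (gmul (pm_basis e) v) w" and u = v
          and g = "\<lambda>v. gmul (pm_basis e) (gmul v w)",
          OF pm_linear_comp[OF pm_linear_gmul_right pm_linear_gmul_left]
          pm_linear_comp[OF pm_linear_gmul_left pm_linear_gmul_right]])
      (use assms(2) that in blast)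
  then show ?thesis
    by (intro pm_linear_eq[where f = "\<lambda>u. gmul (gmul u v) w" and u = u and g = "\<lambda>u. gmul u (gmul v w)",
          OF pm_linear_comp[OF pm_linear_gmul_left pm_linear_gmul_left] pm_linear_gmul_left])
      (use assms(1) in blast)
qed

lemma gscal_basis:
  assumes "e \<in> arrows G"
  shows "gmul (gscal a) (pm_basis e) = pm_scale (a (atgt G e)) (pm_basis e)"
    and "gmul (pm_basis e) (gscal a) = pm_scale (a (asrc G e)) (pm_basis e)"
proof -
  have "gmul (gscal a) (pm_basis e) =
      (\<Sum>p\<in>objs G. if p = atgt G e then pm_scale (a (atgt G e)) (pm_basis e) else 0)"
    unfolding gscal_def gmul_lin
    by (rule sum.cong) (auto simp: gmul_basis ident unit assms)
  then show "gmul (gscal a) (pm_basis e) = pm_scale (a (atgt G e)) (pm_basis e)"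
    using finite_objs ends assms by simp
  have "gmul (pm_basis e) (gscal a) =
      (\<Sum>p\<in>objs G. if p = asrc G e then pm_scale (a (asrc G e)) (pm_basis e) else 0)"
    unfolding gscal_def gmul_lin
    by (rule sum.cong) (auto simp: gmul_basis ident unit assms)
  then show "gmul (pm_basis e) (gscal a) = pm_scale (a (asrc G e)) (pm_basis e)"
    using finite_objs ends assms by simp
qed

lemma gunit_gscal: "gunit = gscal (\<lambda>p. 1)"
  by (simp add: gunit_def gscal_def)

lemma gscal_closed: "on_arrows (gscal a)"
  unfolding gscal_def
  using keys_pm_scale ident(1) by (intro order_trans[OF keys_sum]) fastforce

lemma gmul_unit:
  assumes "on_arrows u"
  shows "gmul gunit u = u" and "gmul u gunit = u"
proof -
  show "gmul gunit u = u"
  proof (rule pm_linear_eq[OF pm_linear_gmul_right pm_linear_id])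
    fix e assume "e \<in> Poly_Mapping.keys u"
    then show "gmul gunit (pm_basis e) = pm_basis e"
      using assms by (simp add: gunit_gscal gscal_basis(1)[OF subsetD[OF assms]])
  qed
  show "gmul u gunit = u"
  proof (rule pm_linear_eq[OF pm_linear_gmul_left pm_linear_id])
    fix e assume "e \<in> Poly_Mapping.keys u"
    then show "gmul (pm_basis e) gunit = pm_basis e"
      using assms by (simp add: gunit_gscal gscal_basis(2)[OF subsetD[OF assms]])
  qed
qed

lemma alg_simps:
  "carrier alg = {u. on_arrows u}" "monoid.mult alg = gmul" "one alg = gunit"
  "zero alg = 0" "add alg = (+)" "smult alg = pm_scale" "src alg = gscal" "tgt alg = gscal"
  "counit alg u = geps u"
  by (auto simp: groupoid_algebra_def groupoid_alg_base_def algebroid.defs hopf_algebroid.defs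
    gmul_def gunit_def gscal_def geps_def fun_eq_iff)

lemma comul_alg:
  fixes u :: "'a \<Rightarrow>\<^sub>0 'k::field"
  shows "comul alg u = tensor_class (objs G) alg (pair_incl (diag u))"
proof -
  have eq: "tensor_class (objs G) (groupoid_alg_base G :: ('k::field, 'a \<Rightarrow>\<^sub>0 'k, 'v) algebroid) t =
      tensor_class (objs G) alg t" for t :: "('a \<Rightarrow>\<^sub>0 'k) \<times> ('a \<Rightarrow>\<^sub>0 'k) \<Rightarrow>\<^sub>0 'k"
    unfolding tensor_class_def
    by (subst tensor_rels_cong[of _ "alg"])
      (simp_all add: groupoid_algebra_def groupoid_alg_base_def algebroid.defs hopf_algebroid.defs)
  have "comul alg u = tensor_class (objs G) (groupoid_alg_base G)
      (pm_extend (\<lambda>e. pm_basis (pm_basis e, pm_basis e)) u)"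
    by (simp add: groupoid_algebra_def algebroid.defs hopf_algebroid.defs)
  also have "pm_extend (\<lambda>e. pm_basis (pm_basis e, pm_basis e)) u = pair_incl (diag u)"
    unfolding pair_incl_def diag_def by (simp add: pm_extend_compose[OF pm_linear_extend])
  finally show ?thesis unfolding eq .
qed

lemma on_arrows_add: "on_arrows u \<Longrightarrow> on_arrows v \<Longrightarrow> on_arrows (u + v)"
  by (rule order_trans[OF keys_add]) simp

lemma on_arrows_uminus: "on_arrows (- u)" if "on_arrows u" for u :: "'a \<Rightarrow>\<^sub>0 'k::field"
  using that by (auto simp: keys_def)

lemma ring_alg: "ring (alg :: ('k::field, 'a \<Rightarrow>\<^sub>0 'k, 'v) hopf_algebroid)"
proof (rule ringI)
  show "abelian_group (alg :: ('k, 'a \<Rightarrow>\<^sub>0 'k, 'v) hopf_algebroid)"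
  proof (rule abelian_groupI)
    fix u :: "'a \<Rightarrow>\<^sub>0 'k" assume "u \<in> carrier alg"
    then show "\<exists>v\<in>carrier alg. v \<oplus>\<^bsub>alg\<^esub> u = \<zero>\<^bsub>alg\<^esub>"
      by (intro bexI[of _ "- u"]) (auto simp: alg_simps on_arrows_uminus keys_def)
  qed (simp_all add: alg_simps ac_simps on_arrows_add)
  show "Group.monoid (alg :: ('k, 'a \<Rightarrow>\<^sub>0 'k, 'v) hopf_algebroid)"
    by (rule monoidI) (use gscal_closed[of "\<lambda>p. 1"] in
        \<open>auto simp: alg_simps gmul_assoc gmul_unit gunit_gscal[symmetric] dest: gmul_closed[THEN subsetD]\<close>)
qed (simp_all add: alg_simps gmul_lin)

lemma geps_superset:
  assumes "finite S" "Poly_Mapping.keys u \<subseteq> S"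
  shows "geps u p = (\<Sum>e\<in>S. Poly_Mapping.lookup u e * bas (atgt G e) p)"
  unfolding geps_def using assms
  by (intro sum.mono_neutral_left) (auto simp: in_keys_iff)

lemma geps_add: "geps (u + v) p = geps u p + geps v p"
proof -
  let ?S = "Poly_Mapping.keys u \<union> Poly_Mapping.keys v"
  have "geps (u + v) p = (\<Sum>i\<in>?S. Poly_Mapping.lookup (u + v) i * bas (atgt G i) p)"
    by (rule geps_superset) (simp_all add: keys_add)
  also have "\<dots> = geps u p + geps v p"
    by (simp add: lookup_add algebra_simps sum.distrib geps_superset[of ?S u] geps_superset[of ?S v])
  finally show ?thesis .
qed

lemma geps_scale: "geps (pm_scale c u) p = c * geps u p"
  by (subst geps_superset[OF finite_keys keys_pm_scale])
    (simp add: geps_def sum_distrib_left mult.assoc)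

lemma geps_zero: "geps 0 p = 0"
  by (simp add: geps_def)

lemma geps_basis: "geps (pm_basis e) p = bas (atgt G e) p"
  by (simp add: geps_def)

lemma geps_sum: "geps (sum f S) p = (\<Sum>i\<in>S. geps (f i) p)"
  by (induction S rule: infinite_finite_induct) (simp_all add: geps_zero geps_add)

lemma geps_diff: "geps (u - v) p = geps u p - geps v p" for u v :: "'a \<Rightarrow>\<^sub>0 'k::field"
  using geps_add[of "u - v" v p] by simp

lemma geps_gmul_basis:
  assumes "e \<in> arrows G" "on_arrows u"
  shows "geps (gmul (pm_basis e) u) p = geps u (asrc G e) * bas (atgt G e) p"
  using assms(2)
proof (induction u rule: pm_induct)
  case (add c i u)
  then show ?case
    using assms(1) by (auto simp: gmul_lin gmul_basis geps_add geps_scale geps_basis geps_zero comp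
        algebra_simps bas_def)
qed (simp add: gmul_lin geps_zero)

lemma geps_gscal_gmul:
  assumes "on_arrows u" "p \<in> objs G"
  shows "geps (gmul (gscal a) u) p = a p * geps u p"
  using assms(1)
proof (induction u rule: pm_induct)
  case (add c i u)
  then show ?case
    by (auto simp: gmul_lin gscal_basis geps_add geps_scale geps_basis algebra_simps bas_def)
qed (simp add: gmul_lin geps_zero)

lemma geps_fun_on: "on_arrows u \<Longrightarrow> geps u \<in> fun_on (objs G)"
  by (fastforce simp: fun_on_def geps_def bas_def ends intro!: sum.neutral)

lemma algebroid_struct_alg: "algebroid_struct (objs G) (alg :: ('k::field, 'a \<Rightarrow>\<^sub>0 'k, 'v) hopf_algebroid)"
  unfolding algebroid_struct_def
proof (intro conjI ballI allI ring_alg)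
  fix c and u :: "'a \<Rightarrow>\<^sub>0 'k" assume "u \<in> carrier alg"
  then show "c \<odot>\<^bsub>alg\<^esub> u \<in> carrier alg" "c \<odot>\<^bsub>alg\<^esub> u = (c \<odot>\<^bsub>alg\<^esub> \<one>\<^bsub>alg\<^esub>) \<otimes>\<^bsub>alg\<^esub> u"
    using keys_pm_scale[of c u] by (auto simp: alg_simps gmul_lin gmul_unit)
qed (simp_all add: alg_simps gscal_closed)

lemma pair_incl_diag_closed:
  "on_arrows u \<Longrightarrow> Poly_Mapping.keys (pair_incl (diag u)) \<subseteq> carrier alg \<times> carrier alg"
  unfolding pair_incl_def diag_def pm_extend_compose[OF pm_linear_extend]
  by (intro keys_pm_extend) (auto simp: alg_simps)

lemma hopf_data_alg: "hopf_data (objs G) (alg :: ('k::field, 'a \<Rightarrow>\<^sub>0 'k, 'v) hopf_algebroid)"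
  unfolding hopf_data_def
proof (intro conjI ballI allI ring_alg)
  fix u :: "'a \<Rightarrow>\<^sub>0 'k" assume u: "u \<in> carrier alg"
  then show "comul alg u \<in> tensor_square (objs G) alg"
    using pair_incl_diag_closed[of u] by (auto simp: tensor_square_def alg_simps(1) comul_alg)
  show "counit alg u \<in> fun_on (objs G)" using u geps_fun_on by (simp add: alg_simps)
qed (use algebroid_structD[OF algebroid_struct_alg] in auto)

end

section \<open>The tensor square of the groupoid algebra\<close>

context category_data
begin

abbreviation alg_span :: "(('a \<Rightarrow>\<^sub>0 'k::field) \<times> ('a \<Rightarrow>\<^sub>0 'k) \<Rightarrow>\<^sub>0 'k) set" where
  "alg_span \<equiv> pm.span (tensor_rels (objs G) alg)"

definition tensor_expand :: "(('a \<Rightarrow>\<^sub>0 'k::field) \<times> ('a \<Rightarrow>\<^sub>0 'k) \<Rightarrow>\<^sub>0 'k) \<Rightarrow> ('a \<times> 'a \<Rightarrow>\<^sub>0 'k)" where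
  "tensor_expand = pm_extend (\<lambda>(h, h'). pm_tensor h h')"

lemma pm_linear_maps: "pm_linear diag" "pm_linear same_target" "pm_linear pair_incl" "pm_linear tensor_expand"
  unfolding diag_def same_target_def pair_incl_def tensor_expand_def by (rule pm_linear_extend)+

lemmas maps_lin = pm_linearD[OF pm_linear_maps(1)] pm_linearD[OF pm_linear_maps(2)]
  pm_linearD[OF pm_linear_maps(3)] pm_linearD[OF pm_linear_maps(4)]

lemma maps_basis:
  "diag (pm_basis e) = pm_basis (e, e)"
  "same_target (pm_basis (e, e')) = (if atgt G e = atgt G e' then pm_basis (e, e') else 0)"
  "pair_incl (pm_basis (e, e')) = pm_basis (pm_basis e, pm_basis e')"
  "tensor_expand (pm_basis (h, h')) = pm_tensor h h'"
  by (simp_all add: diag_def same_target_def pair_incl_def tensor_expand_def)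

lemma basis_zero_in_span:
  fixes h :: "'a \<Rightarrow>\<^sub>0 'k::field"
  assumes "on_arrows h"
  shows "pm_basis (h, 0) \<in> alg_span" and "pm_basis (0, h) \<in> alg_span"
  using pm.span_base[OF tensor_rels.scale_right[of h alg 0 0 "objs G"]]
    pm.span_base[OF tensor_rels.scale_left[of 0 alg h 0 "objs G"]] assms
  by (simp_all add: alg_simps)

text \<open>By bilinearity every element of \<open>H \<otimes> H\<close> is a combination of pairs of arrows.\<close>

lemma basis_in_span_expand:
  fixes h h' :: "'a \<Rightarrow>\<^sub>0 'k::field"
  assumes h: "on_arrows h" and h': "on_arrows h'"
  shows "pm_basis (h, h') - pair_incl (pm_tensor h h') \<in> alg_span"
proof -
  have scaled: "on_arrows (pm_scale c (pm_basis i :: 'a \<Rightarrow>\<^sub>0 'k))" if "i \<in> arrows G" for c i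
    by (rule order_trans[OF keys_pm_scale]) (use that in simp)
  have right: "pm_basis (pm_basis e, h') - pair_incl (pm_tensor (pm_basis e) h') \<in> alg_span"
    if e: "e \<in> arrows G" for e
    using h'
  proof (induction h' rule: pm_induct)
    case zero
    then show ?case using basis_zero_in_span[of "pm_basis e"] e by (simp add: pm_tensor_lin maps_lin)
  next
    case (add c i u)
    have 1: "pm_basis (pm_basis e, pm_scale c (pm_basis i) + u) - pm_basis (pm_basis e, pm_scale c (pm_basis i))
        - pm_basis (pm_basis e, u) \<in> alg_span"
      using tensor_rels.add_right[of "pm_basis e" alg "pm_scale c (pm_basis i)" u "objs G"]
        e add.hyps scaled[of i c] by (intro pm.span_base) (simp add: alg_simps)
    have 2: "pm_basis (pm_basis e, pm_scale c (pm_basis i)) - pm_scale c (pm_basis (pm_basis e, pm_basis i)) \<in> alg_span"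
      using tensor_rels.scale_right[of "pm_basis e" alg "pm_basis i" c "objs G"]
        e add.hyps by (intro pm.span_base) (simp add: alg_simps)
    show ?case
      using pm.span_add[OF pm.span_add[OF 1 2] add.IH]
      by (simp add: pm_tensor_lin maps_lin maps_basis algebra_simps)
  qed
  show ?thesis
    using h
  proof (induction h rule: pm_induct)
    case zero
    then show ?case using basis_zero_in_span[of h'] h' by (simp add: pm_tensor_lin maps_lin)
  next
    case (add c i u)
    have 1: "pm_basis (pm_scale c (pm_basis i) + u, h') - pm_basis (pm_scale c (pm_basis i), h')
        - pm_basis (u, h') \<in> alg_span"
      using tensor_rels.add_left[of "pm_scale c (pm_basis i)" alg u h' "objs G"]
        h' add.hyps scaled[of i c] by (intro pm.span_base) (simp add: alg_simps)
    have 2: "pm_basis (pm_scale c (pm_basis i), h') - pm_scale c (pm_basis (pm_basis i, h')) \<in> alg_span"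
      using tensor_rels.scale_left[of "pm_basis i" alg h' c "objs G"]
        h' add.hyps by (intro pm.span_base) (simp add: alg_simps)
    have 3: "pm_scale c (pm_basis (pm_basis i, h') - pair_incl (pm_tensor (pm_basis i) h')) \<in> alg_span"
      by (intro pm.span_scale right add.hyps)
    show ?case
      using pm.span_add[OF pm.span_add[OF pm.span_add[OF 1 2] 3] add.IH]
      by (simp add: pm_tensor_lin maps_lin maps_basis pm.scale_right_diff_distrib algebra_simps)
  qed
qed

text \<open>Arrows \<open>e\<close> and \<open>e'\<close> with different targets \<open>p\<close> and \<open>q\<close> have \<open>e \<otimes> e' = f\<^sub>p e \<otimes> e' = e \<otimes> f\<^sub>p e' = 0\<close>.\<close>

lemma same_target_in_span:
  fixes x :: "'a \<times> 'a \<Rightarrow>\<^sub>0 'k::field"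
  assumes "on_pairs x"
  shows "pair_incl x - pair_incl (same_target x) \<in> alg_span"
  using assms
proof (induction x rule: pm_induct)
  case zero
  then show ?case by (simp add: maps_lin pm.span_zero)
next
  case (add c i x)
  obtain e e' where i: "i = (e, e')" "e \<in> arrows G" "e' \<in> arrows G" using add.hyps by auto
  have "pm_basis (pm_basis e, pm_basis e') \<in> (alg_span :: (_ \<Rightarrow>\<^sub>0 'k) set)" if ne: "atgt G e \<noteq> atgt G e'"
  proof -
    have "bas (atgt G e) \<in> fun_on (objs G)" using ends i by (auto simp: fun_on_def bas_def)
    then have "pm_basis (pm_basis e, pm_basis e') - pm_basis (pm_basis e, 0) \<in> (alg_span :: (_ \<Rightarrow>\<^sub>0 'k) set)"
      using tensor_rels.balanced[of "pm_basis e" alg "pm_basis e'" "bas (atgt G e)" "objs G"] i ne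
      by (intro pm.span_base) (simp add: alg_simps gscal_basis bas_def)
    then show ?thesis
      using pm.span_add[OF _ basis_zero_in_span(1)[of "pm_basis e"]] i by fastforce
  qed
  then have "pair_incl (pm_basis i) - pair_incl (same_target (pm_basis i)) \<in> (alg_span :: (_ \<Rightarrow>\<^sub>0 'k) set)"
    by (simp add: i maps_basis maps_lin pm.span_zero)
  from pm.span_add[OF pm.span_scale[OF this, of c] add.IH] show ?case
    by (simp add: maps_lin pm.scale_right_diff_distrib algebra_simps)
qed

text \<open>Hence the expansion into pairs of arrows with the same target is injective on
  \<open>H \<otimes>\<^sub>A H\<close>; equality of cosets can be decided in this model.\<close>

lemma tensor_class_eq_alg:
  fixes t t' :: "('a \<Rightarrow>\<^sub>0 'k::field) \<times> ('a \<Rightarrow>\<^sub>0 'k) \<Rightarrow>\<^sub>0 'k"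
  assumes t: "Poly_Mapping.keys t \<subseteq> carrier alg \<times> carrier alg"
    and t': "Poly_Mapping.keys t' \<subseteq> carrier alg \<times> carrier alg"
    and eq: "same_target (tensor_expand t) = same_target (tensor_expand t')"
  shows "t - t' \<in> alg_span"
proof -
  have *: "s - pair_incl (same_target (tensor_expand s)) \<in> alg_span"
    if "Poly_Mapping.keys s \<subseteq> carrier alg \<times> carrier alg"
    for s :: "('a \<Rightarrow>\<^sub>0 'k::field) \<times> ('a \<Rightarrow>\<^sub>0 'k) \<Rightarrow>\<^sub>0 'k"
    using that
  proof (induction s rule: pm_induct)
    case zero
    then show ?case by (simp add: maps_lin pm.span_zero)
  next
    case (add c i s)
    obtain h h' where i: "i = (h, h')" "on_arrows h" "on_arrows h'"
      using add.hyps by (auto simp: alg_simps)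
    have "pm_basis i - pair_incl (same_target (tensor_expand (pm_basis i))) \<in> alg_span"
      using pm.span_add[OF basis_in_span_expand[OF i(2,3)] same_target_in_span[of "pm_tensor h h'"]]
        keys_pm_tensor[OF i(2,3)] by (simp add: i maps_basis)
    from pm.span_add[OF pm.span_scale[OF this, of c] add.IH] show ?case
      by (simp add: maps_lin pm.scale_right_diff_distrib algebra_simps)
  qed
  from pm.span_diff[OF *[OF t] *[OF t']] show ?thesis by (simp add: eq)
qed

text \<open>The product of \<open>H \<otimes>\<^sub>\<bbbK> H\<close>, in the basis of pairs of arrows.\<close>

definition gmul2 :: "('a \<times> 'a \<Rightarrow>\<^sub>0 'k::field) \<Rightarrow> ('a \<times> 'a \<Rightarrow>\<^sub>0 'k) \<Rightarrow> ('a \<times> 'a \<Rightarrow>\<^sub>0 'k)" where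
  "gmul2 x y = pm_extend (\<lambda>(e, e'). pm_extend (\<lambda>(f, f').
     pm_tensor (gmul (pm_basis e) (pm_basis f)) (gmul (pm_basis e') (pm_basis f'))) y) x"

lemma pm_linear_gmul2: "pm_linear (\<lambda>x. gmul2 x y)" "pm_linear (gmul2 x)"
  unfolding gmul2_def case_prod_unfold by (intro pm_linear_extend_fun pm_linear_extend)+

lemmas gmul2_lin = pm_linearD[OF pm_linear_gmul2(1)] pm_linearD[OF pm_linear_gmul2(2)]

lemma gmul2_basis: "gmul2 (pm_basis (e, e')) (pm_basis (f, f')) =
    pm_tensor (gmul (pm_basis e) (pm_basis f)) (gmul (pm_basis e') (pm_basis f'))"
  by (simp add: gmul2_def)

lemma gmul2_tensor:
  "gmul2 (pm_tensor u u') (pm_tensor v v') = pm_tensor (gmul u v) (gmul u' v')"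
proof (rule pm_bilinear_eq[where B = "\<lambda>u u'. gmul2 (pm_tensor u u') (pm_tensor v v')"
      and B' = "\<lambda>u u'. pm_tensor (gmul u v) (gmul u' v')",
      OF pm_linear_comp[OF pm_linear_tensor_left pm_linear_gmul2(1)]
        pm_linear_comp[OF pm_linear_tensor_right pm_linear_gmul2(1)]
        pm_linear_comp[OF pm_linear_gmul_left pm_linear_tensor_left]
        pm_linear_comp[OF pm_linear_gmul_left pm_linear_tensor_right]])
  fix e e'
  show "gmul2 (pm_tensor (pm_basis e) (pm_basis e')) (pm_tensor v v') =
      pm_tensor (gmul (pm_basis e) v) (gmul (pm_basis e') v')"
    by (rule pm_bilinear_eq[where B = "\<lambda>v v'. gmul2 (pm_tensor (pm_basis e) (pm_basis e')) (pm_tensor v v')"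
          and B' = "\<lambda>v v'. pm_tensor (gmul (pm_basis e) v) (gmul (pm_basis e') v')",
          OF pm_linear_comp[OF pm_linear_tensor_left pm_linear_gmul2(2)]
            pm_linear_comp[OF pm_linear_tensor_right pm_linear_gmul2(2)]
            pm_linear_comp[OF pm_linear_gmul_right pm_linear_tensor_left]
            pm_linear_comp[OF pm_linear_gmul_right pm_linear_tensor_right]])
      (simp add: gmul2_basis)
qed

text \<open>A product of arrows has the target of its left factor, so discarding the pairs with
  different targets can be done before multiplying from the right.\<close>

lemma same_target_gmul2_left:
  assumes "on_pairs x" "on_pairs y"
  shows "same_target (gmul2 (same_target x) y) = same_target (gmul2 x y)"
proof (rule pm_bilinear_eq[where B = "\<lambda>x y. same_target (gmul2 (same_target x) y)"
      and B' = "\<lambda>x y. same_target (gmul2 x y)",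
      OF pm_linear_comp[OF pm_linear_maps(2) pm_linear_comp[OF pm_linear_gmul2(1) pm_linear_maps(2)]]
        pm_linear_comp[OF pm_linear_gmul2(2) pm_linear_maps(2)]
        pm_linear_comp[OF pm_linear_gmul2(1) pm_linear_maps(2)]
        pm_linear_comp[OF pm_linear_gmul2(2) pm_linear_maps(2)]])
  fix i j assume "i \<in> Poly_Mapping.keys x" "j \<in> Poly_Mapping.keys y"
  then obtain e e' f f' where "i = (e, e')" "e \<in> arrows G" "e' \<in> arrows G"
    "j = (f, f')" "f \<in> arrows G" "f' \<in> arrows G" using assms by fast
  then show "same_target (gmul2 (same_target (pm_basis i)) (pm_basis j)) =
      same_target (gmul2 (pm_basis i) (pm_basis j))"
    by (auto simp: gmul2_basis gmul_basis maps_basis comp pm_tensor_lin maps_lin gmul2_lin)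
qed

text \<open>A pair \<open>(f, f')\<close> can be composed with \<open>(e, e)\<close> only if both \<open>f\<close> and \<open>f'\<close> end at the source
  of \<open>e\<close>.\<close>

lemma gmul2_diag_same_target: "gmul2 (diag u) (same_target y) = gmul2 (diag u) y"
  by (rule pm_bilinear_eq[where B = "\<lambda>u y. gmul2 (diag u) (same_target y)" and B' = "\<lambda>u y. gmul2 (diag u) y",
        OF pm_linear_comp[OF pm_linear_maps(1) pm_linear_gmul2(1)]
          pm_linear_comp[OF pm_linear_maps(2) pm_linear_gmul2(2)]
          pm_linear_comp[OF pm_linear_maps(1) pm_linear_gmul2(1)] pm_linear_gmul2(2)])
    (auto simp: maps_basis gmul2_lin gmul2_basis gmul_basis pm_tensor_lin)

lemma gmul2_diag: "gmul2 (diag u) (diag v) = diag (gmul u v)"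
  by (rule pm_bilinear_eq[where B = "\<lambda>u v. gmul2 (diag u) (diag v)" and B' = "\<lambda>u v. diag (gmul u v)",
        OF pm_linear_comp[OF pm_linear_maps(1) pm_linear_gmul2(1)]
          pm_linear_comp[OF pm_linear_maps(1) pm_linear_gmul2(2)]
          pm_linear_comp[OF pm_linear_gmul_left pm_linear_maps(1)]
          pm_linear_comp[OF pm_linear_gmul_right pm_linear_maps(1)]])
    (auto simp: gmul2_basis gmul_basis maps_basis maps_lin pm_tensor_lin)

text \<open>The product of \<open>H \<otimes>\<^sub>\<bbbK> H\<close> does not descend to \<open>H \<otimes>\<^sub>A H\<close>. But \<open>e \<otimes> e\<close> satisfies Takeuchi's
  condition \<open>(e \<otimes> e) (a \<otimes> 1) = (e \<otimes> e) (1 \<otimes> a)\<close>, so that it does for combinations of the \<open>e \<otimes> e\<close>,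
  which are the values of the comultiplication.\<close>

lemma same_target_gmul2_grouplike:
  assumes "on_pairs x" "on_pairs y" "same_target x = diag u" "same_target y = diag v" "on_arrows u" "on_arrows v"
  shows "same_target (gmul2 x y) = diag (gmul u v)"
proof -
  have same_diag: "same_target (diag w) = diag w" for w :: "'a \<Rightarrow>\<^sub>0 'k::field"
    by (rule pm_linear_eq[OF pm_linear_comp[OF pm_linear_maps(1,2)] pm_linear_maps(1)])
      (simp add: maps_basis)
  have "same_target (gmul2 x y) = same_target (gmul2 (diag u) y)"
    using same_target_gmul2_left[OF assms(1,2)] assms(3) by simp
  also have "\<dots> = same_target (gmul2 (diag u) (diag v))"
    using gmul2_diag_same_target[of u y] assms(4) by simp
  also have "\<dots> = diag (gmul u v)"
    by (simp add: gmul2_diag same_diag)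
  finally show ?thesis .
qed

end


section \<open>The fundamental groupoid\<close>

type_synonym 'v zigzag_class = "('v \<times> 'v step list \<times> 'v) set"

locale finite_digraph =
  fixes D :: "'v pair_pre_digraph"
  assumes finite_verts: "finite (pverts D)" and finite_arcs: "finite (parcs D)"
    and arc_verts: "(a, b) \<in> parcs D \<Longrightarrow> a \<in> pverts D" "(a, b) \<in> parcs D \<Longrightarrow> b \<in> pverts D"
    and arc_neq: "(a, b) \<in> parcs D \<Longrightarrow> a \<noteq> b"
begin

lemma step_arc_verts:
  assumes "step_arc g \<in> parcs D"
  shows "step_src g \<in> pverts D" and "step_tgt g \<in> pverts D"
  using assms arc_verts by (cases g; auto)+

lemma step_inv_simps [simp]:
  "step_src (step_inv g) = step_tgt g" "step_tgt (step_inv g) = step_src g"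
  "step_arc (step_inv g) = step_arc g" "step_inv (step_inv g) = g"
  by (cases g; simp)+

lemma zigzag_verts: "zigzag D t w s \<Longrightarrow> t \<in> pverts D \<and> s \<in> pverts D"
  by (induction w arbitrary: t) (auto dest: step_arc_verts)

lemma zigzag_append: "zigzag D t (u @ v) s \<longleftrightarrow> (\<exists>m. zigzag D t u m \<and> zigzag D m v s)"
  by (induction u arbitrary: t) (auto dest: zigzag_verts)

text \<open>This makes source, target and composition of classes well defined. The surrounding words are
  quantified inside the conclusion for the induction over the congruence.\<close>

lemma zigzag_eq_context:
  assumes "(x, y) \<in> zigzag_eq D R"
  shows "x \<in> zigzags D \<and> y \<in> zigzags D \<and> fst x = fst y \<and> snd (snd x) = snd (snd y) \<and>
    (\<forall>t u v s. zigzag D t u (fst x) \<longrightarrow> zigzag D (snd (snd x)) v s \<longrightarrow>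
      ((t, u @ fst (snd x) @ v, s), (t, u @ fst (snd y) @ v, s)) \<in> zigzag_eq D R)"
  using assms
proof induction
  case (refl x)
  then obtain t w s where "x = (t, w, s)" "zigzag D t w s" by (auto simp: zigzags_def)
  then show ?case
    by (auto simp: zigzags_def intro!: zigzag_eq.refl) (meson zigzag_append)
next
  case (sym x y)
  then show ?case by (auto intro: zigzag_eq.sym)
next
  case (trans x y z)
  then show ?case by auto (meson zigzag_eq.trans)
next
  case (cancel t u g v s)
  have "zigzag D t (u @ v) s"
    using cancel by (auto simp: zigzags_def zigzag_append)
  moreover have "((t', u' @ (u @ [g, step_inv g] @ v) @ v', s'), (t', u' @ (u @ v) @ v', s')) \<in> zigzag_eq D R"
    if "zigzag D t' u' t" "zigzag D s v' s'" for t' u' v' s'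
  proof -
    have "zigzag D t' (u' @ (u @ [g, step_inv g] @ v) @ v') s'"
      using that cancel unfolding zigzag_append[of _ u'] zigzag_append[of _ "u @ [g, step_inv g] @ v"]
      by (auto simp: zigzags_def)
    then show ?thesis
      using zigzag_eq.cancel[of t' "u' @ u" g "v @ v'" s' D R] by (simp add: zigzags_def)
  qed
  ultimately show ?case using cancel by (auto simp: zigzags_def)
next
  case (rel l r t u v s)
  have "((t', u' @ (u @ l @ v) @ v', s'), (t', u' @ (u @ r @ v) @ v', s')) \<in> zigzag_eq D R"
    if "zigzag D t' u' t" "zigzag D s v' s'" for t' u' v' s'
  proof -
    have "zigzag D t' (u' @ (u @ l @ v) @ v') s'" "zigzag D t' (u' @ (u @ r @ v) @ v') s'"
      using that rel unfolding zigzag_append[of _ u'] zigzag_append[of _ "u @ l @ v"] zigzag_append[of _ "u @ r @ v"]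
      by (auto simp: zigzags_def)
    then show ?thesis
      using zigzag_eq.rel[OF rel(1), of t' "u' @ u" "v @ v'" s' D] by (simp add: zigzags_def)
  qed
  then show ?case using rel by (auto simp: zigzags_def)
qed

lemma zigzag_eq_appendD:
  assumes "((m, w, m'), (m, w', m')) \<in> zigzag_eq D R" "zigzag D t u m" "zigzag D m' v s"
  shows "((t, u @ w @ v, s), (t, u @ w' @ v, s)) \<in> zigzag_eq D R"
  using zigzag_eq_context[OF assms(1)] assms(2,3) by simp

lemma equiv_zigzag_eq: "equiv (zigzags D) (zigzag_eq D R)"
  by (rule equivI)
    (use zigzag_eq_context in \<open>auto intro!: refl_onI symI transI intro: zigzag_eq.refl zigzag_eq.sym zigzag_eq.trans\<close>)

definition zclass :: "'v \<Rightarrow> 'v step list \<Rightarrow> 'v \<Rightarrow> 'v zigzag_class" where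
  "zclass t w s = zigzag_eq D (pi_rels D) `` {(t, w, s)}"

abbreviation Pi :: "('v, 'v zigzag_class) groupoid" where
  "Pi \<equiv> fundamental_groupoid D"

lemma zclass_eq_iff:
  assumes "zigzag D t w s" "zigzag D t' w' s'"
  shows "zclass t w s = zclass t' w' s' \<longleftrightarrow> ((t, w, s), (t', w', s')) \<in> zigzag_eq D (pi_rels D)"
  unfolding zclass_def
  by (rule eq_equiv_class_iff[OF equiv_zigzag_eq]) (use assms in \<open>auto simp: zigzags_def\<close>)

lemma Pi_arrows: "arrows Pi = {zclass t w s | t w s. zigzag D t w s}"
  by (auto simp: fundamental_groupoid_def presented_groupoid_def quotient_def zclass_def zigzags_def)

lemma zclass_arrow: "zigzag D t w s \<Longrightarrow> zclass t w s \<in> arrows Pi"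
  by (auto simp: Pi_arrows)

lemma zclass_self: "zigzag D t w s \<Longrightarrow> (t, w, s) \<in> zclass t w s"
  by (auto simp: zclass_def zigzags_def intro: zigzag_eq.refl)

lemma zclass_memD: "(t', w', s') \<in> zclass t w s \<Longrightarrow> t' = t \<and> s' = s \<and> zigzag D t w' s
    \<and> ((t, w, s), (t, w', s)) \<in> zigzag_eq D (pi_rels D)"
  using zigzag_eq_context[of "(t, w, s)" "(t', w', s')" "pi_rels D"]
  by (auto simp: zclass_def zigzags_def)

lemma Pi_ends:
  assumes "zigzag D t w s"
  shows "asrc Pi (zclass t w s) = s" and "atgt Pi (zclass t w s) = t"
proof -
  have "(\<lambda>(t, w, s). s) ` zclass t w s = {s}" "(\<lambda>(t, w, s). t) ` zclass t w s = {t}"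
    using zclass_self[OF assms] zclass_memD by force+
  then show "asrc Pi (zclass t w s) = s" "atgt Pi (zclass t w s) = t"
    by (simp_all add: fundamental_groupoid_def presented_groupoid_def)
qed

lemma Pi_comp:
  assumes "zigzag D t u m" "zigzag D m v s"
  shows "acomp Pi (zclass t u m) (zclass m v s) = zclass t (u @ v) s"
proof -
  have E: "equiv (zigzags D) (zigzag_eq D (pi_rels D))" by (rule equiv_zigzag_eq)
  let ?Z = "{(t', u' @ v', s') | t' u' m' v' s'. (t', u', m') \<in> zclass t u m \<and> (m', v', s') \<in> zclass m v s}"
  have sub: "((t, u @ v, s), z) \<in> zigzag_eq D (pi_rels D)" if zin: "z \<in> ?Z" for z
  proof -
    obtain u' v' where z: "z = (t, u' @ v', s)"
      and u': "zigzag D t u' m" "((t, u, m), (t, u', m)) \<in> zigzag_eq D (pi_rels D)"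
      and v': "zigzag D m v' s" "((m, v, s), (m, v', s)) \<in> zigzag_eq D (pi_rels D)"
    proof -
      from zin obtain t' u' m' v' s' where z: "z = (t', u' @ v', s')"
        and u': "(t', u', m') \<in> zclass t u m" and v': "(m', v', s') \<in> zclass m v s"
        by blast
      then show thesis using zclass_memD[OF u'] zclass_memD[OF v'] by (intro that[of u' v']) auto
    qed
    have "((t, u @ v, s), (t, u' @ v, s)) \<in> zigzag_eq D (pi_rels D)"
      using zigzag_eq_appendD[OF u'(2), of t "[]"] assms(2) zigzag_verts[OF assms(1)] by simp
    moreover have "((t, u' @ v, s), (t, u' @ v', s)) \<in> zigzag_eq D (pi_rels D)"
    proof -
      have "zigzag D s [] s" using zigzag_verts[OF assms(2)] by simp
      then show ?thesis using zigzag_eq_appendD[OF v'(2) u'(1), of "[]" s] by simp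
    qed
    ultimately show ?thesis unfolding z by (rule zigzag_eq.trans)
  qed
  have self: "(t, u @ v, s) \<in> ?Z" using zclass_self[OF assms(1)] zclass_self[OF assms(2)] by blast
  have "zigzag_eq D (pi_rels D) `` ?Z = zclass t (u @ v) s"
  proof (intro equalityI subsetI)
    fix y assume "y \<in> zigzag_eq D (pi_rels D) `` ?Z"
    then obtain z where "z \<in> ?Z" "(z, y) \<in> zigzag_eq D (pi_rels D)" by (rule ImageE)
    then show "y \<in> zclass t (u @ v) s"
      using zigzag_eq.trans[OF sub] by (simp only: zclass_def Image_singleton_iff)
  next
    fix y assume "y \<in> zclass t (u @ v) s"
    then have "((t, u @ v, s), y) \<in> zigzag_eq D (pi_rels D)" by (simp add: zclass_def)
    then show "y \<in> zigzag_eq D (pi_rels D) `` ?Z" using self by (rule ImageI)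
  qed
  then show ?thesis by (simp add: fundamental_groupoid_def presented_groupoid_def)
qed

lemma Pi_id: "aid Pi p = zclass p [] p"
  by (simp add: fundamental_groupoid_def presented_groupoid_def zclass_def)

lemma Pi_objs: "objs Pi = pverts D"
  by (simp add: fundamental_groupoid_def presented_groupoid_def)

sublocale Pi: category_data Pi
proof
  show "finite (objs Pi)" using finite_verts by (simp add: Pi_objs)
next
  fix e assume "e \<in> arrows Pi"
  then obtain t w s where e: "e = zclass t w s" "zigzag D t w s" by (auto simp: Pi_arrows)
  show "asrc Pi e \<in> objs Pi" "atgt Pi e \<in> objs Pi"
    using e zigzag_verts by (auto simp: Pi_ends Pi_objs)
  have "zigzag D t [] t" "zigzag D s [] s" using zigzag_verts[OF e(2)] by auto
  then show "acomp Pi (aid Pi (atgt Pi e)) e = e" "acomp Pi e (aid Pi (asrc Pi e)) = e"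
    using e by (simp_all add: Pi_id Pi_ends Pi_comp)
next
  fix p assume "p \<in> objs Pi"
  then have "zigzag D p [] p" by (simp add: Pi_objs)
  then show "aid Pi p \<in> arrows Pi" "asrc Pi (aid Pi p) = p" "atgt Pi (aid Pi p) = p"
    by (simp_all add: Pi_id Pi_ends zclass_arrow)
next
  fix e f assume "e \<in> arrows Pi" "f \<in> arrows Pi" "asrc Pi e = atgt Pi f"
  then obtain t w s w' s' where e: "e = zclass t w s" "zigzag D t w s" "f = zclass s w' s'" "zigzag D s w' s'"
    by (auto simp: Pi_arrows Pi_ends)
  then have "zigzag D t (w @ w') s'" by (auto simp: zigzag_append)
  then show "acomp Pi e f \<in> arrows Pi" "asrc Pi (acomp Pi e f) = asrc Pi f" "atgt Pi (acomp Pi e f) = atgt Pi e"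
    using e by (simp_all add: Pi_comp Pi_ends zclass_arrow)
next
  fix e f g assume "e \<in> arrows Pi" "f \<in> arrows Pi" "g \<in> arrows Pi" "asrc Pi e = atgt Pi f" "asrc Pi f = atgt Pi g"
  then obtain t w s w' s' w'' s'' where e: "e = zclass t w s" "zigzag D t w s" "f = zclass s w' s'" "zigzag D s w' s'"
    "g = zclass s' w'' s''" "zigzag D s' w'' s''"
    by (auto simp: Pi_arrows Pi_ends)
  then have "zigzag D t (w @ w') s'" "zigzag D s (w' @ w'') s''" by (auto simp: zigzag_append)
  then show "acomp Pi (acomp Pi e f) g = acomp Pi e (acomp Pi f g)"
    using e by (simp add: Pi_comp)
qed

end

section \<open>The calculus of a digraph\<close>

lemma fun_sum_apply: "(\<Sum>i\<in>S. f i) x = (\<Sum>i\<in>S. f i x)"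
  for f :: "'i \<Rightarrow> 'x \<Rightarrow> 'y::comm_monoid_add"
  by (induction S rule: infinite_finite_induct) auto

interpretation fs: Modules.module "\<lambda>(c :: 'k::field) (f :: 'i \<Rightarrow> 'k) i. c * f i"
  by standard (auto simp: fun_eq_iff algebra_simps)

context finite_digraph
begin

lemma d0_bas_arc:
  assumes "(a, b) \<in> parcs D"
  shows "d0_bas D p (a, b) = (if p = b then 1 else 0) - (if p = a then 1 else 0 :: 'k::field)"
proof -
  have fin: "finite {x. (x, p) \<in> parcs D}" "finite {x. (p, x) \<in> parcs D}" for p
    by (rule finite_subset[OF _ finite_verts], auto dest: arc_verts)+
  have "(\<Sum>x\<in>{x. (x, p) \<in> parcs D}. bas (x, p) (a, b)) = (if p = b then 1 else 0 :: 'k)"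
  proof -
    have "(\<Sum>x\<in>{x. (x, p) \<in> parcs D}. bas (x, p) (a, b)) =
        (\<Sum>x\<in>{x. (x, p) \<in> parcs D}. if x = a then (if p = b then 1 else 0) else 0 :: 'k)"
      by (rule sum.cong) (auto simp: bas_def)
    then show ?thesis using fin assms by auto
  qed
  moreover have "(\<Sum>x\<in>{x. (p, x) \<in> parcs D}. bas (p, x) (a, b)) = (if p = a then 1 else 0 :: 'k)"
  proof -
    have "(\<Sum>x\<in>{x. (p, x) \<in> parcs D}. bas (p, x) (a, b)) =
        (\<Sum>x\<in>{x. (p, x) \<in> parcs D}. if x = b then (if p = a then 1 else 0) else 0 :: 'k)"
      by (rule sum.cong) (auto simp: bas_def)
    then show ?thesis using fin assms by auto
  qed
  ultimately show ?thesis by (simp add: d0_bas_def fun_sum_apply)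
qed

lemma d0_arc:
  assumes "i \<in> parcs D"
  shows "d0 D f i = f (snd i) - (f (fst i) :: 'k::field)"
proof -
  obtain a b where i: "i = (a, b)" by force
  have "d0 D f i = (\<Sum>p\<in>pverts D. (if p = b then f b else 0) - (if p = a then f a else 0))"
    unfolding d0_def by (rule sum.cong) (use assms in \<open>auto simp: i d0_bas_arc\<close>)
  then show ?thesis
    using arc_verts[of a b] assms finite_verts by (simp add: i sum_subtractf)
qed

lemma finite_paths2: "finite (paths2 D)"
  by (rule finite_subset[of _ "pverts D \<times> pverts D \<times> pverts D"])
    (auto simp: paths2_def finite_verts dest: arc_verts)

lemma finite_basis2: "finite (basis2 D ch)"
  using finite_paths2 by (simp add: basis2_def)

lemma finite_midpoints: "finite {b. (a, b, c) \<in> paths2 D}"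
  by (rule finite_subset[OF _ finite_verts]) (auto simp: paths2_def dest: arc_verts)

definition wedge_gen :: "'v \<Rightarrow> 'v \<Rightarrow> ('v \<times> 'v \<times> 'v \<Rightarrow> 'k::field)" where
  "wedge_gen a c = (\<Sum>b\<in>{b. (a, b, c) \<in> paths2 D}. Om_tensor (bas (a, b)) (bas (b, c)))"

lemma wedge_gen_apply:
  "wedge_gen a c (p, q, r) = (if p = a \<and> r = c \<and> (p, q, r) \<in> paths2 D then 1 else 0)"
proof -
  have "wedge_gen a c (p, q, r) =
      (\<Sum>b\<in>{b. (a, b, c) \<in> paths2 D}. if b = q then (if p = a \<and> r = c then 1 else 0) else 0)"
    unfolding wedge_gen_def fun_sum_apply by (rule sum.cong) (auto simp: Om_tensor_def bas_def)
  then show ?thesis by (auto simp: finite_midpoints)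
qed

text \<open>A defining relation of \<open>\<Omega>\<^sup>2\<^sub>t\<^sub>o\<^sub>p\<close> is the sum of all paths of length two between two vertices
  without an arc from the first to the second. These sums have disjoint supports, so that membership
  in their span can be read off from the coefficients.\<close>

lemma wedge_ker_iff:
  fixes \<tau> :: "'v \<times> 'v \<times> 'v \<Rightarrow> 'k::field"
  assumes ch: "path_choice D ch"
  shows "\<tau> \<in> wedge_ker D \<longleftrightarrow>
    (\<forall>p q r. (p, q, r) \<notin> paths2 D \<or> (p, r) \<in> parcs D \<longrightarrow> \<tau> (p, q, r) = 0) \<and>
    (\<forall>p q q' r. (p, q, r) \<in> paths2 D \<longrightarrow> (p, q', r) \<in> paths2 D \<longrightarrow> \<tau> (p, q, r) = \<tau> (p, q', r))"
    (is "_ \<longleftrightarrow> ?P \<tau>")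
proof
  let ?B = "{wedge_gen a c | a c. a \<in> pverts D \<and> c \<in> pverts D \<and> (a, c) \<notin> parcs D}"
  have ker: "wedge_ker D = fs.span (?B :: ('v \<times> 'v \<times> 'v \<Rightarrow> 'k) set)"
    by (simp add: wedge_ker_def fun_span_def wedge_gen_def)
  show "?P \<tau>" if "\<tau> \<in> wedge_ker D"
    using that unfolding ker
  proof (induction rule: fs.span_induct)
    case base
    show ?case
      unfolding fs.subspace_def
    proof (intro conjI ballI allI)
      show "0 \<in> Collect ?P" by simp
    next
      fix x y assume xy: "x \<in> Collect ?P" "y \<in> Collect ?P"
      show "x + y \<in> Collect ?P"
      proof (rule CollectI, intro conjI allI impI)
        fix p q r assume "(p, q, r) \<notin> paths2 D \<or> (p, r) \<in> parcs D"
        then have "x (p, q, r) = 0" "y (p, q, r) = 0" using xy by blast+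
        then show "(x + y) (p, q, r) = 0" by simp
      next
        fix p q q' r assume "(p, q, r) \<in> paths2 D" "(p, q', r) \<in> paths2 D"
        then have "x (p, q, r) = x (p, q', r)" "y (p, q, r) = y (p, q', r)" using xy by blast+
        then show "(x + y) (p, q, r) = (x + y) (p, q', r)" by simp
      qed
    next
      fix c x assume x: "x \<in> Collect ?P"
      show "(\<lambda>i. c * x i) \<in> Collect ?P"
      proof (rule CollectI, intro conjI allI impI)
        fix p q r assume "(p, q, r) \<notin> paths2 D \<or> (p, r) \<in> parcs D"
        then have "x (p, q, r) = 0" using x by blast
        then show "c * x (p, q, r) = 0" by simp
      next
        fix p q q' r assume "(p, q, r) \<in> paths2 D" "(p, q', r) \<in> paths2 D"
        then have "x (p, q, r) = x (p, q', r)" using x by blast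
        then show "c * x (p, q, r) = c * x (p, q', r)" by simp
      qed
    qed
  next
    case (step \<sigma>)
    then obtain a c where "\<sigma> = wedge_gen a c" "(a, c) \<notin> parcs D" by auto
    then show ?case by (auto simp: wedge_gen_apply)
  qed
  show "\<tau> \<in> wedge_ker D" if P: "?P \<tau>"
  proof -
    let ?N = "pverts D \<times> pverts D - parcs D"
    have "\<tau> = (\<Sum>(a, c)\<in>?N. (\<lambda>i. \<tau> (a, ch a c, c) * wedge_gen a c i))"
    proof (rule ext)
      fix x :: "'v \<times> 'v \<times> 'v"
      obtain p q r where x: "x = (p, q, r)" by (metis prod_cases3)
      have "(\<Sum>(a, c)\<in>?N. (\<lambda>i. \<tau> (a, ch a c, c) * wedge_gen a c i)) x =
          (\<Sum>(a, c)\<in>?N. \<tau> (a, ch a c, c) * wedge_gen a c x)"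
        by (simp add: fun_sum_apply case_prod_unfold)
      also have "\<dots> = (\<Sum>i\<in>?N. if i = (p, r) then
          (if (p, q, r) \<in> paths2 D then \<tau> (p, ch p r, r) else 0) else 0)"
        by (rule sum.cong) (auto simp: x wedge_gen_apply split: if_splits)
      also have "\<dots> = (if (p, r) \<in> ?N \<and> (p, q, r) \<in> paths2 D then \<tau> (p, ch p r, r) else 0)"
        using finite_verts by (simp add: sum.delta)
      also have "\<dots> = \<tau> x"
      proof (cases "(p, q, r) \<in> paths2 D \<and> (p, r) \<notin> parcs D")
        case True
        then have "(p, ch p r, r) \<in> paths2 D" using ch by (auto simp: path_choice_def)
        moreover have "p \<in> pverts D" "r \<in> pverts D" using True arc_verts by (auto simp: paths2_def)
        moreover have "\<tau> (p, ch p r, r) = \<tau> (p, q, r)" using P True calculation by blast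
        ultimately show ?thesis using True by (simp add: x)
      next
        case False
        then have "\<tau> (p, q, r) = 0" using P by blast
        then show ?thesis using False by (auto simp: x)
      qed
      finally show "\<tau> x = (\<Sum>(a, c)\<in>?N. (\<lambda>i. \<tau> (a, ch a c, c) * wedge_gen a c i)) x" by simp
    qed
    moreover have "(\<Sum>(a, c)\<in>?N. (\<lambda>i. \<tau> (a, ch a c, c) * wedge_gen a c i)) \<in> fs.span ?B"
    proof (intro fs.span_sum, clarify)
      fix a c assume "a \<in> pverts D" "c \<in> pverts D" "(a, c) \<notin> parcs D"
      then have "wedge_gen a c \<in> fs.span (?B :: ('v \<times> 'v \<times> 'v \<Rightarrow> 'k) set)"
        by (intro fs.span_base) auto
      then show "(\<lambda>i. \<tau> (a, ch a c, c) * wedge_gen a c i) \<in> fs.span ?B"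
        by (rule fs.span_scale)
    qed
    ultimately show ?thesis by (simp only: ker)
  qed
qed

text \<open>Subtracting the defining relation between \<open>p\<close> and \<open>r\<close>, multiplied by the coefficient at the
  chosen path, moves an element into the span of the basis. The result is unique: an element of the
  kernel supported on the basis vanishes at the chosen paths, hence everywhere.\<close>

lemma wedge_proj_eq:
  fixes \<tau> :: "'v \<times> 'v \<times> 'v \<Rightarrow> 'k::field"
  assumes ch: "path_choice D ch" and supp: "\<tau> \<in> fun_on (paths2 D)"
  shows "wedge_proj D ch \<tau> = (\<lambda>(p, q, r). if (p, q, r) \<in> basis2 D ch
    then \<tau> (p, q, r) - (if (p, r) \<in> parcs D then 0 else \<tau> (p, ch p r, r)) else 0)"
proof -
  let ?\<sigma> = "\<lambda>(p, q, r). if (p, q, r) \<in> basis2 D ch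
    then \<tau> (p, q, r) - (if (p, r) \<in> parcs D then 0 else \<tau> (p, ch p r, r)) else 0"
  have chosen: "(p, q, r) \<in> paths2 D \<Longrightarrow> (p, r) \<notin> parcs D \<Longrightarrow> (p, ch p r, r) \<in> paths2 D" for p q r
    using ch by (auto simp: path_choice_def)
  have 1: "?\<sigma> \<in> fun_on (basis2 D ch)" by (auto simp: fun_on_def)
  have diff: "(\<tau> - ?\<sigma>) (p, q, r) = (if (p, q, r) \<in> paths2 D \<and> (p, r) \<notin> parcs D then \<tau> (p, ch p r, r) else 0)"
    for p q r
    using supp by (auto simp: fun_on_def basis2_def)
  have 2: "\<tau> - ?\<sigma> \<in> wedge_ker D"
    unfolding wedge_ker_iff[OF ch] diff by auto
  have 3: "\<sigma> = ?\<sigma>" if \<sigma>: "\<sigma> \<in> fun_on (basis2 D ch)" "\<tau> - \<sigma> \<in> wedge_ker D" for \<sigma>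
  proof (rule ext)
    fix x :: "'v \<times> 'v \<times> 'v"
    obtain p q r where x: "x = (p, q, r)" by (metis prod_cases3)
    note ker = \<sigma>(2)[unfolded wedge_ker_iff[OF ch]]
    show "\<sigma> x = ?\<sigma> x"
    proof (cases "(p, q, r) \<in> basis2 D ch")
      case True
      then have path: "(p, q, r) \<in> paths2 D" by (simp add: basis2_def)
      show ?thesis
      proof (cases "(p, r) \<in> parcs D")
        case True
        then have "(\<tau> - \<sigma>) (p, q, r) = 0" using ker by blast
        then show ?thesis using True \<open>(p, q, r) \<in> basis2 D ch\<close> by (simp add: x)
      next
        case False
        have "(\<tau> - \<sigma>) (p, q, r) = (\<tau> - \<sigma>) (p, ch p r, r)"
          using ker path chosen[OF path False] by blast
        moreover have "\<sigma> (p, ch p r, r) = 0"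
          using \<sigma>(1) False by (auto simp: fun_on_def basis2_def)
        ultimately show ?thesis using False \<open>(p, q, r) \<in> basis2 D ch\<close>
          by (simp add: x algebra_simps)
      qed
    next
      case False
      then show ?thesis using \<sigma>(1) by (simp add: x fun_on_def)
    qed
  qed
  show ?thesis
    unfolding wedge_proj_def by (rule the_equality) (use 1 2 3 in blast)+
qed

lemma wedge_bas:
  assumes ch: "path_choice D ch" and i: "i \<in> parcs D" and j: "j \<in> parcs D" and b: "(p, q, r) \<in> basis2 D ch"
  shows "wedge D ch (bas i) (bas j) (p, q, r) =
    (if i = (p, q) \<and> j = (q, r) then 1 else 0) -
    (if (p, r) \<notin> parcs D \<and> i = (p, ch p r) \<and> j = (ch p r, r) then 1 else 0 :: 'k::field)"
proof -
  have "Om_tensor (bas i) (bas j :: _ \<Rightarrow> 'k) \<in> fun_on (paths2 D)"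
    using i j by (auto simp: fun_on_def Om_tensor_def bas_def paths2_def split: if_splits)
  from wedge_proj_eq[OF ch this] show ?thesis
    using b by (auto simp: wedge_def Om_tensor_def bas_def)
qed

text \<open>The arcs ending at \<open>r\<close> are those with \<open>f\<^sub>r x\<^sub>i \<noteq> 0\<close>. The three sums in \<open>d\<omega>\<^sub>i\<close> run over paths that
  begin with \<open>i\<close>, that end with \<open>i\<close> and that are bridged by \<open>i\<close>; no path \<open>p \<rightarrow> q \<rightarrow> r\<close> begins with an
  arc ending at \<open>r\<close>, as there are no loops.\<close>

lemma d1_bas_apply:
  assumes ch: "path_choice D ch" and i: "i \<in> parcs D" and b: "(p, q, r) \<in> basis2 D ch" and r: "snd i = r"
  shows "d1_bas D ch i (p, q, r) =
    (if i = (q, r) then 1 else 0) -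
    (if (p, r) \<notin> parcs D \<and> i = (ch p r, r) then 1 else 0) -
    (if i = (p, r) then 1 else 0 :: 'k::field)"
proof -
  obtain a where ia: "i = (a, r)" using r by (cases i) auto
  have path: "(p, q) \<in> parcs D" "(q, r) \<in> parcs D" using b by (auto simp: basis2_def paths2_def)
  have chosen: "(p, ch p r) \<in> parcs D" "(ch p r, r) \<in> parcs D" if "(p, r) \<notin> parcs D"
    using ch path that by (auto simp: path_choice_def paths2_def)
  have a: "(a, r) \<in> parcs D" using i ia by simp
  have fin1: "finite {s. (s, a) \<in> parcs D}"
    by (rule finite_subset[OF _ finite_verts]) (auto dest: arc_verts)
  have 1: "(\<Sum>t\<in>{t. (r, t) \<in> parcs D}. wedge D ch (bas (a, r)) (bas (r, t)) (p, q, r)) = (0 :: 'k)"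
    by (rule sum.neutral) (use a arc_neq in \<open>auto simp: wedge_bas[OF ch _ _ b]\<close>)
  have "(\<Sum>s\<in>{s. (s, a) \<in> parcs D}. wedge D ch (bas (s, a)) (bas (a, r)) (p, q, r)) =
     (\<Sum>s\<in>{s. (s, a) \<in> parcs D}. if s = p then (if a = q then 1 else 0) -
       (if (p, r) \<notin> parcs D \<and> a = ch p r then 1 else 0) else (0 :: 'k))"
    by (rule sum.cong) (use a in \<open>auto simp: wedge_bas[OF ch _ _ b]\<close>)
  also have "\<dots> = (if a = q then 1 else 0) - (if (p, r) \<notin> parcs D \<and> a = ch p r then 1 else 0)"
    using path chosen by (simp add: fin1)
  finally have 2: "(\<Sum>s\<in>{s. (s, a) \<in> parcs D}. wedge D ch (bas (s, a)) (bas (a, r)) (p, q, r)) =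
    (if a = q then 1 else 0) - (if (p, r) \<notin> parcs D \<and> a = ch p r then 1 else 0 :: 'k)" .
  have "(\<Sum>m\<in>{m. (a, m, r) \<in> paths2 D}. wedge D ch (bas (a, m)) (bas (m, r)) (p, q, r)) =
     (\<Sum>m\<in>{m. (a, m, r) \<in> paths2 D}. if m = q then (if a = p then 1 else 0) else (0 :: 'k))"
    by (rule sum.cong) (use a in \<open>auto simp: wedge_bas[OF ch _ _ b] paths2_def\<close>)
  also have "\<dots> = (if a = p then 1 else 0)"
    using b by (auto simp: finite_midpoints basis2_def)
  finally have 3: "(\<Sum>m\<in>{m. (a, m, r) \<in> paths2 D}. wedge D ch (bas (a, m)) (bas (m, r)) (p, q, r)) =
    (if a = p then 1 else 0 :: 'k)" .
  show ?thesis
    using 1 2 3 by (simp add: ia fun_sum_apply)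
qed

text \<open>The weights are the coefficients of commutators with \<open>b\<^sub>i\<close> and \<open>c\<^sub>i\<close>. The value of \<open>b\<^sub>i\<close> at the
  target of \<open>j\<close> is nonzero only if \<open>i\<close> begins there; if moreover \<open>i\<close> and \<open>j\<close> have the same target, then
  \<open>i\<close> would be a loop. What remains is the condition that \<open>i\<close> and \<open>j\<close> have the same source and the same
  target, that is, \<open>i = j\<close>. For \<open>c\<^sub>i\<close> sources and targets change roles.\<close>

lemma coev_b_sum:
  assumes j: "j \<in> parcs D" and G: "\<And>i. i \<in> parcs D \<Longrightarrow> snd i \<noteq> snd j \<Longrightarrow> G i = 0"
  shows "(\<Sum>i\<in>parcs D. pm_scale (coev_b i (snd j) - coev_b i (fst j)) (G i)) = (G j :: 'i \<Rightarrow>\<^sub>0 'k::field)"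
proof -
  have "pm_scale (coev_b i (snd j) - coev_b i (fst j)) (G i) = (if i = j then G j else 0)"
    if i: "i \<in> parcs D" for i
  proof (cases "snd i = snd j")
    case True
    then have "fst i \<noteq> snd j" "fst j \<noteq> snd j" using i j arc_neq by (metis prod.collapse)+
    then show ?thesis using True by (cases "i = j") (auto simp: coev_b_def bas_def dest: prod_eqI)
  qed (use G i in auto)
  then have "(\<Sum>i\<in>parcs D. pm_scale (coev_b i (snd j) - coev_b i (fst j)) (G i)) =
    (\<Sum>i\<in>parcs D. if i = j then G j else 0)" by (intro sum.cong) auto
  then show ?thesis using j finite_arcs by simp
qed

lemma coev_c_sum:
  assumes j: "j \<in> parcs D" and G: "\<And>i. i \<in> parcs D \<Longrightarrow> fst i \<noteq> fst j \<Longrightarrow> G i = 0"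
  shows "(\<Sum>i\<in>parcs D. pm_scale (coev_c i (snd j) - coev_c i (fst j)) (G i)) = (G j :: 'i \<Rightarrow>\<^sub>0 'k::field)"
proof -
  have "pm_scale (coev_c i (snd j) - coev_c i (fst j)) (G i) = (if i = j then G j else 0)"
    if i: "i \<in> parcs D" for i
  proof (cases "fst i = fst j")
    case True
    then have "snd i \<noteq> fst j" "fst j \<noteq> snd j" using i j arc_neq by (metis prod.collapse)+
    then show ?thesis using True by (cases "i = j") (auto simp: coev_c_def bas_def dest: prod_eqI)
  qed (use G i in auto)
  then have "(\<Sum>i\<in>parcs D. pm_scale (coev_c i (snd j) - coev_c i (fst j)) (G i)) =
    (\<Sum>i\<in>parcs D. if i = j then G j else 0)" by (intro sum.cong) auto
  then show ?thesis using j finite_arcs by simp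
qed

end

section \<open>The homomorphism from the free algebra to the groupoid algebra\<close>

lemma pm_scale_mult_left: "pm_scale c u * v = pm_scale c (u * v)"
  for u v :: "'w::monoid_add \<Rightarrow>\<^sub>0 'k::field"
  by (simp add: pm_scale_def mult_map_scale_conv_mult mult.assoc)

lemma pm_scale_mult_right: "u * pm_scale c v = pm_scale c (u * v)"
  for u v :: "'w::monoid_add \<Rightarrow>\<^sub>0 'k::field"
proof -
  have "u * Poly_Mapping.single 0 c = Poly_Mapping.single 0 c * u" if "Poly_Mapping.keys u \<subseteq> UNIV"
    using that
    by (induction u rule: pm_induct)
      (simp_all add: algebra_simps pm_scale_single mult_single)
  then show ?thesis
    by (simp add: pm_scale_def mult_map_scale_conv_mult mult.assoc[symmetric])
qed

lemma pm_linear_mult: "pm_linear (\<lambda>u. u * v)" "pm_linear ((*) u)"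
  for u v :: "'w::monoid_add \<Rightarrow>\<^sub>0 'k::field"
  by (rule pm_linearI, simp_all add: algebra_simps pm_scale_mult_left pm_scale_mult_right)+

context finite_digraph
begin

definition idb :: "'v \<Rightarrow> ('v zigzag_class \<Rightarrow>\<^sub>0 'k::field)" where
  "idb p = pm_basis (zclass p [] p)"

definition fwd :: "'v \<times> 'v \<Rightarrow> ('v zigzag_class \<Rightarrow>\<^sub>0 'k::field)" where
  "fwd i = pm_basis (zclass (snd i) [Fwd (fst i) (snd i)] (fst i))"

definition bwd :: "'v \<times> 'v \<Rightarrow> ('v zigzag_class \<Rightarrow>\<^sub>0 'k::field)" where
  "bwd i = pm_basis (zclass (fst i) [Bwd (fst i) (snd i)] (snd i))"

text \<open>For \<open>e = e\<^bsub>q\<leftarrow>p\<^esub>\<close> the relations give \<open>f\<^sub>q e = e\<close> and \<open>e f\<^sub>p = e - f\<^sub>q\<close>, so it is \<open>f\<^sub>q - e\<close> that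
  behaves like an arrow from \<open>p\<close> to \<open>q\<close>; for the overlined vector it is \<open>f\<^sub>p\<close> plus the vector that
  behaves like an arrow from \<open>q\<close> to \<open>p\<close>.\<close>

definition vec_image :: "'v \<times> 'v \<Rightarrow> ('v zigzag_class \<Rightarrow>\<^sub>0 'k::field)" where
  "vec_image i = idb (snd i) - fwd i"

definition cvec_image :: "'v \<times> 'v \<Rightarrow> ('v zigzag_class \<Rightarrow>\<^sub>0 'k::field)" where
  "cvec_image i = bwd i - idb (fst i)"

text \<open>The sums run over the arcs, so that the values lie in the groupoid algebra for arbitrary
  functions \<open>x\<close>, and \<open>Phi\<close> below is multiplicative without restriction on the generators.\<close>

fun Phi_gen :: "('v, 'k::field) generator \<Rightarrow> ('v zigzag_class \<Rightarrow>\<^sub>0 'k)" where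
  "Phi_gen (Src a) = Pi.gscal a"
| "Phi_gen (Tgt a) = Pi.gscal a"
| "Phi_gen (Vec x) = (\<Sum>i\<in>parcs D. pm_scale (x i) (vec_image i))"
| "Phi_gen (CVec x) = (\<Sum>i\<in>parcs D. pm_scale (x i) (cvec_image i))"

definition Phi_word :: "('v, 'k::field) generator fword \<Rightarrow> ('v zigzag_class \<Rightarrow>\<^sub>0 'k)" where
  "Phi_word w = foldr (\<lambda>g. Pi.gmul (Phi_gen g)) (letters w) Pi.gunit"

definition Phi :: "('v, 'k::field) free \<Rightarrow> ('v zigzag_class \<Rightarrow>\<^sub>0 'k)" where
  "Phi = pm_extend Phi_word"

lemma arc_zigzags:
  assumes "i \<in> parcs D"
  shows "zigzag D (snd i) [Fwd (fst i) (snd i)] (fst i)" "zigzag D (fst i) [Bwd (fst i) (snd i)] (snd i)"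
    "fst i \<in> pverts D" "snd i \<in> pverts D" "fst i \<noteq> snd i"
  using assms arc_verts[of "fst i" "snd i"] arc_neq[of "fst i" "snd i"] by auto

lemma gscal_table:
  "p \<in> pverts D \<Longrightarrow> Pi.gmul (Pi.gscal a) (idb p) = pm_scale (a p) (idb p)"
  "p \<in> pverts D \<Longrightarrow> Pi.gmul (idb p) (Pi.gscal a) = pm_scale (a p) (idb p)"
  "i \<in> parcs D \<Longrightarrow> Pi.gmul (Pi.gscal a) (fwd i) = pm_scale (a (snd i)) (fwd i)"
  "i \<in> parcs D \<Longrightarrow> Pi.gmul (fwd i) (Pi.gscal a) = pm_scale (a (fst i)) (fwd i)"
  "i \<in> parcs D \<Longrightarrow> Pi.gmul (Pi.gscal a) (bwd i) = pm_scale (a (fst i)) (bwd i)"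
  "i \<in> parcs D \<Longrightarrow> Pi.gmul (bwd i) (Pi.gscal a) = pm_scale (a (snd i)) (bwd i)"
  using arc_zigzags[of i]
  by (simp_all add: idb_def fwd_def bwd_def Pi.gscal_basis zclass_arrow Pi_ends)

lemma idb_gscal: "p \<in> pverts D \<Longrightarrow> idb p = Pi.gscal (bas p)"
  unfolding Pi.gscal_def Pi_objs Pi_id idb_def[symmetric]
  using finite_verts by (subst sum.remove[of _ p]) (auto simp: bas_def intro!: sum.neutral)

lemma Pi_comp': "zigzag D t u m \<Longrightarrow> zigzag D m' v s \<Longrightarrow>
    Pi.gmul (pm_basis (zclass t u m)) (pm_basis (zclass m' v s)) =
      (if m = m' then pm_basis (zclass t (u @ v) s) else 0)"
  by (cases "m = m'") (simp_all add: Pi.gmul_basis Pi_ends Pi_comp)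

lemma zclass_cancel:
  assumes "zigzag D t (u @ [g, step_inv g] @ v) s"
  shows "zclass t (u @ [g, step_inv g] @ v) s = zclass t (u @ v) s"
proof -
  have "zigzag D t (u @ v) s" using assms by (auto simp: zigzag_append)
  then show ?thesis
    using assms zigzag_eq.cancel[of t u g v s D "pi_rels D"] by (simp only: zclass_eq_iff) (simp add: zigzags_def)
qed

lemma fwd_bwd:
  assumes "i \<in> parcs D" "j \<in> parcs D"
  shows "fst i \<noteq> fst j \<Longrightarrow> Pi.gmul (fwd i) (bwd j) = 0" "Pi.gmul (fwd i) (bwd i) = idb (snd i)"
    and "snd i \<noteq> snd j \<Longrightarrow> Pi.gmul (bwd i) (fwd j) = 0" "Pi.gmul (bwd i) (fwd i) = idb (fst i)"
proof -
  note z = arc_zigzags[OF assms(1)] arc_zigzags[OF assms(2)]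
  show "fst i \<noteq> fst j \<Longrightarrow> Pi.gmul (fwd i) (bwd j) = 0" "snd i \<noteq> snd j \<Longrightarrow> Pi.gmul (bwd i) (fwd j) = 0"
    using z by (simp_all add: fwd_def bwd_def Pi_comp' del: zigzag.simps)
  have 1: "zclass (snd i) [Fwd (fst i) (snd i), Bwd (fst i) (snd i)] (snd i) = zclass (snd i) [] (snd i)"
    using zclass_cancel[of "snd i" "[]" "Fwd (fst i) (snd i)" "[]" "snd i"] z by simp
  have 2: "zclass (fst i) [Bwd (fst i) (snd i), Fwd (fst i) (snd i)] (fst i) = zclass (fst i) [] (fst i)"
    using zclass_cancel[of "fst i" "[]" "Bwd (fst i) (snd i)" "[]" "fst i"] z by simp
  show "Pi.gmul (fwd i) (bwd i) = idb (snd i)" "Pi.gmul (bwd i) (fwd i) = idb (fst i)"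
    using z 1 2 by (simp_all add: fwd_def bwd_def idb_def Pi_comp' del: zigzag.simps)
qed

lemma basis_on_arrows:
  "p \<in> pverts D \<Longrightarrow> Pi.on_arrows (idb p)" "i \<in> parcs D \<Longrightarrow> Pi.on_arrows (fwd i)"
  "i \<in> parcs D \<Longrightarrow> Pi.on_arrows (bwd i)"
  using arc_zigzags[of i] by (simp_all add: idb_def fwd_def bwd_def zclass_arrow)

lemma on_arrows_sum: "(\<And>i. i \<in> S \<Longrightarrow> Pi.on_arrows (f i)) \<Longrightarrow> Pi.on_arrows (sum f S)"
  by (rule order_trans[OF keys_sum]) blast

lemma on_arrows_scale: "Pi.on_arrows u \<Longrightarrow> Pi.on_arrows (pm_scale c u)"
  by (rule order_trans[OF keys_pm_scale])

lemma image_on_arrows: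
  assumes "i \<in> parcs D"
  shows "Pi.on_arrows (vec_image i)" "Pi.on_arrows (cvec_image i)"
  unfolding vec_image_def cvec_image_def
  by (intro keys_diff_subset basis_on_arrows arc_zigzags assms)+

lemma Phi_gen_closed: "Pi.on_arrows (Phi_gen g)"
proof (cases g)
  case (Vec x)
  then show ?thesis by (simp only: Phi_gen.simps) (intro on_arrows_sum on_arrows_scale image_on_arrows)
next
  case (CVec x)
  then show ?thesis by (simp only: Phi_gen.simps) (intro on_arrows_sum on_arrows_scale image_on_arrows)
qed (simp_all only: Phi_gen.simps Pi.gscal_closed)

lemma gunit_closed: "Pi.on_arrows Pi.gunit"
  using Pi.gscal_closed by (simp add: Pi.gunit_gscal)

lemma Phi_word_closed:
  fixes w :: "('v, 'k::field) generator fword"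
  shows "Pi.on_arrows (Phi_word w)"
proof -
  have "Pi.on_arrows (foldr (\<lambda>g. Pi.gmul (Phi_gen g)) gs Pi.gunit)" for gs :: "('v, 'k) generator list"
    by (induction gs) (simp_all add: gunit_closed Pi.gmul_closed Phi_gen_closed)
  then show ?thesis by (simp add: Phi_word_def)
qed

lemma Phi_closed: "Pi.on_arrows (Phi u)"
  unfolding Phi_def by (intro keys_pm_extend Phi_word_closed)

lemma Phi_word_plus: "Phi_word (w + w') = Pi.gmul (Phi_word w) (Phi_word w')"
proof -
  have "Phi_word (FWord gs + w') = Pi.gmul (Phi_word (FWord gs)) (Phi_word w')" for gs
  proof (induction gs)
    case Nil
    then show ?case using Pi.gmul_unit(1)[OF Phi_word_closed[of w']]
      by (simp add: Phi_word_def plus_fword_def)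
  next
    case (Cons g gs)
    then show ?case
      using Pi.gmul_assoc[OF Phi_gen_closed[of g] Phi_word_closed[of "FWord gs"] Phi_word_closed[of w']]
      by (simp add: Phi_word_def plus_fword_def)
  qed
  from this[of "letters w"] show ?thesis by simp
qed

lemma pm_linear_Phi: "pm_linear Phi"
  unfolding Phi_def by (rule pm_linear_extend)

lemmas Phi_lin = pm_linearD[OF pm_linear_Phi]

lemma Phi_basis: "Phi (pm_basis w) = Phi_word w"
  by (simp add: Phi_def)

lemma Phi_mult: "Phi (u * v) = Pi.gmul (Phi u) (Phi v)"
  by (rule pm_bilinear_eq[where B = "\<lambda>u v. Phi (u * v)" and B' = "\<lambda>u v. Pi.gmul (Phi u) (Phi v)",
        OF pm_linear_comp[OF pm_linear_mult(1) pm_linear_Phi] pm_linear_comp[OF pm_linear_mult(2) pm_linear_Phi]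
          pm_linear_comp[OF pm_linear_Phi Pi.pm_linear_gmul_left]
          pm_linear_comp[OF pm_linear_Phi Pi.pm_linear_gmul_right]])
    (simp add: mult_single Phi_basis Phi_word_plus)

lemma Phi_one: "Phi 1 = Pi.gunit"
  unfolding single_one[symmetric] Phi_basis by (simp add: Phi_word_def zero_fword_def)

lemma Phi_of_gen: "Phi (gen g) = Phi_gen g"
  using Pi.gmul_unit(2)[OF Phi_gen_closed] by (simp add: gen_def Phi_basis Phi_word_def)

lemma Phi_cmt: "Phi (cmt u v) = Pi.gmul (Phi u) (Phi v) - Pi.gmul (Phi v) (Phi u)"
  by (simp add: cmt_def Phi_lin Phi_mult)

lemma Phi_gen_bas:
  "i \<in> parcs D \<Longrightarrow> Phi_gen (Vec (bas i)) = vec_image i"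
  "i \<in> parcs D \<Longrightarrow> Phi_gen (CVec (bas i)) = cvec_image i"
  using finite_arcs by (auto simp: bas_def if_distrib[of "\<lambda>c. pm_scale c _"] sum.delta cong: if_cong)

lemma gscal_vec_image:
  assumes "i \<in> parcs D"
  shows "Pi.gmul (Pi.gscal a) (vec_image i) = pm_scale (a (snd i)) (vec_image i)"
    and "Pi.gmul (vec_image i) (Pi.gscal a) = pm_scale (a (snd i)) (idb (snd i)) - pm_scale (a (fst i)) (fwd i)"
    and "Pi.gmul (Pi.gscal a) (cvec_image i) = pm_scale (a (fst i)) (cvec_image i)"
    and "Pi.gmul (cvec_image i) (Pi.gscal a) = pm_scale (a (snd i)) (bwd i) - pm_scale (a (fst i)) (idb (fst i))"
  using assms
  by (simp_all add: vec_image_def cvec_image_def Pi.gmul_lin gscal_table arc_zigzags pm.scale_right_diff_distrib)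

text \<open>Identities commute with functions on the vertices, so that only the arrow in \<open>vec_image i\<close>
  contributes to the commutator.\<close>

lemma cmt_vec:
  "Phi (cmt (gvec x) (gtgt a)) = (\<Sum>i\<in>parcs D. pm_scale (x i * (a (snd i) - a (fst i))) (fwd i))"
  unfolding Phi_cmt Phi_of_gen Phi_gen.simps Pi.gmul_lin sum_subtractf[symmetric]
  by (rule sum.cong)
    (simp_all only: gscal_vec_image, simp_all add: vec_image_def algebra_simps
      pm.scale_left_diff_distrib pm.scale_right_diff_distrib)

lemma cmt_cvec:
  "Phi (cmt (gcvec x) (gsrc a)) = (\<Sum>i\<in>parcs D. pm_scale (x i * (a (snd i) - a (fst i))) (bwd i))"
  unfolding Phi_cmt Phi_of_gen Phi_gen.simps Pi.gmul_lin sum_subtractf[symmetric]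
  by (rule sum.cong)
    (simp_all only: gscal_vec_image, simp_all add: cvec_image_def algebra_simps
      pm.scale_left_diff_distrib pm.scale_right_diff_distrib)

lemma cmt_bas:
  assumes "i \<in> parcs D"
  shows "Phi (cmt (gvec (bas i)) (gtgt a)) = pm_scale (a (snd i) - a (fst i)) (fwd i)"
    and "Phi (cmt (gcvec (bas i)) (gsrc a)) = pm_scale (a (snd i) - a (fst i)) (bwd i)"
  unfolding cmt_vec cmt_cvec using finite_arcs assms
  by (subst sum.remove[of _ i]; auto simp: bas_def intro!: sum.neutral)+

lemma gscal_sum_bas:
  assumes "finite S" "f ` S \<subseteq> pverts D"
  shows "Pi.gscal (\<lambda>p. \<Sum>i\<in>S. c i * bas (f i) p) = (\<Sum>i\<in>S. pm_scale (c i) (idb (f i)))"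
proof -
  have "Pi.gscal (\<lambda>p. \<Sum>i\<in>S. c i * bas (f i) p) = (\<Sum>i\<in>S. pm_scale (c i) (Pi.gscal (bas (f i))))"
    by (simp add: Pi.gscal_def pm.scale_sum_left pm.scale_sum_right sum.swap[of _ S])
  also have "\<dots> = (\<Sum>i\<in>S. pm_scale (c i) (idb (f i)))"
    by (rule sum.cong) (use assms in \<open>auto simp: idb_gscal\<close>)
  finally show ?thesis .
qed

lemma gscal_ev1:
  "Pi.gscal (ev1 D x (d0 D a)) = (\<Sum>i\<in>parcs D. pm_scale (x i * (a (snd i) - a (fst i))) (idb (snd i)))"
  "Pi.gscal (uev1 D (d0 D a) x) = (\<Sum>i\<in>parcs D. pm_scale (x i * (a (snd i) - a (fst i))) (idb (fst i)))"
proof -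
  have "ev1 D x (d0 D a) = (\<lambda>p. \<Sum>i\<in>parcs D. (x i * (a (snd i) - a (fst i))) * bas (snd i) p)"
    unfolding ev1_def by (intro ext sum.cong) (auto simp: d0_arc)
  then show "Pi.gscal (ev1 D x (d0 D a)) = (\<Sum>i\<in>parcs D. pm_scale (x i * (a (snd i) - a (fst i))) (idb (snd i)))"
    using gscal_sum_bas[OF finite_arcs, of snd] arc_zigzags(4) by (simp add: image_subset_iff)
  have "uev1 D (d0 D a) x = (\<lambda>p. \<Sum>i\<in>parcs D. (x i * (a (snd i) - a (fst i))) * bas (fst i) p)"
    unfolding uev1_def by (intro ext sum.cong) (auto simp: d0_arc)
  then show "Pi.gscal (uev1 D (d0 D a) x) = (\<Sum>i\<in>parcs D. pm_scale (x i * (a (snd i) - a (fst i))) (idb (fst i)))"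
    using gscal_sum_bas[OF finite_arcs, of fst] arc_zigzags(3) by (simp add: image_subset_iff)
qed

lemma gscal_lin:
  fixes a b :: "'v \<Rightarrow> 'k::field"
  shows
  "Pi.gscal (a + b) = Pi.gscal a + Pi.gscal b"
  "Pi.gscal (\<lambda>p. c * a p) = pm_scale c (Pi.gscal a)"
  "Pi.gmul (Pi.gscal a) (Pi.gscal b) = Pi.gscal (a * b)"
  "Pi.gscal (unitA D) = (Pi.gunit :: _ \<Rightarrow>\<^sub>0 'k)"
proof -
  show "Pi.gscal (a + b) = Pi.gscal a + Pi.gscal b"
    by (simp add: Pi.gscal_def pm.scale_left_distrib sum.distrib)
  show "Pi.gscal (\<lambda>p. c * a p) = pm_scale c (Pi.gscal a)"
    by (simp add: Pi.gscal_def pm.scale_sum_right)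
  show "Pi.gmul (Pi.gscal a) (Pi.gscal b) = Pi.gscal (a * b)"
    unfolding Pi.gscal_def[of b] Pi.gscal_def[of "a * b"] Pi.gmul_lin Pi_objs Pi_id idb_def[symmetric]
    by (rule sum.cong) (simp_all add: gscal_table mult.commute)
  have "unitA D p = (1::'k)" if "p \<in> pverts D" for p
    unfolding unitA_def fun_sum_apply using finite_verts that
    by (simp add: bas_def)
  then show "Pi.gscal (unitA D) = (Pi.gunit :: _ \<Rightarrow>\<^sub>0 'k)"
    by (simp add: Pi.gscal_def Pi.gunit_def Pi_objs)
qed

text \<open>The four relations with coevaluations hold because \<open>fwd i\<close> and \<open>bwd i\<close> are inverse to each
  other: only arcs with a common end can be composed, so the double sums collapse to the diagonal by
  \<open>coev_b_sum\<close> and \<open>coev_c_sum\<close>.\<close>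

lemma Phi_cvec_coev:
  "(\<Sum>i\<in>parcs D. Pi.gmul (Phi (cmt (gcvec x) (gsrc (coev_b i)))) (vec_image i)) = Phi (gcvec x)"
proof -
  have "(\<Sum>i\<in>parcs D. Pi.gmul (Phi (cmt (gcvec x) (gsrc (coev_b i)))) (vec_image i)) =
    (\<Sum>j\<in>parcs D. pm_scale (x j) (\<Sum>i\<in>parcs D. pm_scale (coev_b i (snd j) - coev_b i (fst j)) (Pi.gmul (bwd j) (vec_image i))))"
    unfolding cmt_cvec Pi.gmul_lin pm.scale_sum_right
    by (subst sum.swap) simp
  also have "\<dots> = (\<Sum>j\<in>parcs D. pm_scale (x j) (Pi.gmul (bwd j) (vec_image j)))"
    by (intro sum.cong HOL.refl arg_cong[where f = "pm_scale _"] coev_b_sum)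
      (auto simp: vec_image_def Pi.gmul_lin fwd_bwd idb_gscal gscal_table arc_zigzags bas_def)
  also have "\<dots> = (\<Sum>j\<in>parcs D. pm_scale (x j) (cvec_image j))"
    by (rule sum.cong)
      (auto simp: vec_image_def cvec_image_def Pi.gmul_lin fwd_bwd idb_gscal[of "snd _"] gscal_table arc_zigzags bas_def)
  finally show ?thesis by (simp add: Phi_of_gen)
qed

lemma Phi_vec_coev:
  "(\<Sum>i\<in>parcs D. Pi.gmul (Phi (cmt (gvec x) (gtgt (coev_c i)))) (cvec_image i)) = Phi (gvec x)"
proof -
  have "(\<Sum>i\<in>parcs D. Pi.gmul (Phi (cmt (gvec x) (gtgt (coev_c i)))) (cvec_image i)) =
    (\<Sum>j\<in>parcs D. pm_scale (x j) (\<Sum>i\<in>parcs D. pm_scale (coev_c i (snd j) - coev_c i (fst j)) (Pi.gmul (fwd j) (cvec_image i))))"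
    unfolding cmt_vec Pi.gmul_lin pm.scale_sum_right
    by (subst sum.swap) simp
  also have "\<dots> = (\<Sum>j\<in>parcs D. pm_scale (x j) (Pi.gmul (fwd j) (cvec_image j)))"
    by (intro sum.cong HOL.refl arg_cong[where f = "pm_scale _"] coev_c_sum)
      (auto simp: cvec_image_def Pi.gmul_lin fwd_bwd idb_gscal gscal_table arc_zigzags bas_def)
  also have "\<dots> = (\<Sum>j\<in>parcs D. pm_scale (x j) (vec_image j))"
    by (rule sum.cong)
      (auto simp: vec_image_def cvec_image_def Pi.gmul_lin fwd_bwd idb_gscal[of "fst _"] gscal_table arc_zigzags bas_def)
  finally show ?thesis by (simp add: Phi_of_gen)
qed

lemma Phi_vec_cvec:
  "(\<Sum>i\<in>parcs D. Pi.gmul (Phi (cmt (gvec (bas i)) (gtgt a))) (Phi (cmt (gcvec x) (gsrc (coev_c i)))))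
    = Pi.gscal (ev1 D x (d0 D a))"
proof -
  have "(\<Sum>i\<in>parcs D. Pi.gmul (Phi (cmt (gvec (bas i)) (gtgt a))) (Phi (cmt (gcvec x) (gsrc (coev_c i))))) =
    (\<Sum>i\<in>parcs D. \<Sum>j\<in>parcs D. pm_scale (x j) (pm_scale (coev_c i (snd j) - coev_c i (fst j))
        (pm_scale (a (snd i) - a (fst i)) (Pi.gmul (fwd i) (bwd j)))))"
    by (rule sum.cong) (simp_all add: cmt_bas cmt_cvec Pi.gmul_lin pm.scale_sum_right mult_ac)
  also have "\<dots> = (\<Sum>j\<in>parcs D. pm_scale (x j) (\<Sum>i\<in>parcs D. pm_scale (coev_c i (snd j) - coev_c i (fst j))
        (pm_scale (a (snd i) - a (fst i)) (Pi.gmul (fwd i) (bwd j)))))"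
    unfolding pm.scale_sum_right by (rule sum.swap)
  also have "\<dots> = (\<Sum>j\<in>parcs D. pm_scale (x j) (pm_scale (a (snd j) - a (fst j)) (Pi.gmul (fwd j) (bwd j))))"
    by (intro sum.cong HOL.refl arg_cong[where f = "pm_scale _"] coev_c_sum) (simp_all add: fwd_bwd)
  also have "\<dots> = Pi.gscal (ev1 D x (d0 D a))"
    unfolding gscal_ev1 by (rule sum.cong) (simp_all add: fwd_bwd)
  finally show ?thesis .
qed

lemma Phi_cvec_vec:
  "(\<Sum>i\<in>parcs D. Pi.gmul (Phi (cmt (gcvec (bas i)) (gsrc a))) (Phi (cmt (gvec x) (gtgt (coev_b i)))))
    = Pi.gscal (uev1 D (d0 D a) x)"
proof -
  have "(\<Sum>i\<in>parcs D. Pi.gmul (Phi (cmt (gcvec (bas i)) (gsrc a))) (Phi (cmt (gvec x) (gtgt (coev_b i))))) =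
    (\<Sum>i\<in>parcs D. \<Sum>j\<in>parcs D. pm_scale (x j) (pm_scale (coev_b i (snd j) - coev_b i (fst j))
        (pm_scale (a (snd i) - a (fst i)) (Pi.gmul (bwd i) (fwd j)))))"
    by (rule sum.cong) (simp_all add: cmt_bas cmt_vec Pi.gmul_lin pm.scale_sum_right mult_ac)
  also have "\<dots> = (\<Sum>j\<in>parcs D. pm_scale (x j) (\<Sum>i\<in>parcs D. pm_scale (coev_b i (snd j) - coev_b i (fst j))
        (pm_scale (a (snd i) - a (fst i)) (Pi.gmul (bwd i) (fwd j)))))"
    unfolding pm.scale_sum_right by (rule sum.swap)
  also have "\<dots> = (\<Sum>j\<in>parcs D. pm_scale (x j) (pm_scale (a (snd j) - a (fst j)) (Pi.gmul (bwd j) (fwd j))))"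
    by (intro sum.cong HOL.refl arg_cong[where f = "pm_scale _"] coev_b_sum) (simp_all add: fwd_bwd)
  also have "\<dots> = Pi.gscal (uev1 D (d0 D a) x)"
    unfolding gscal_ev1 by (rule sum.cong) (simp_all add: fwd_bwd)
  finally show ?thesis .
qed

text \<open>Evaluated at an arc \<open>a \<rightarrow> b\<close>, the hypothesis \<open>\<Sum> r\<^sub>m s\<^sub>m = 0 = \<Sum> r\<^sub>m ds\<^sub>m\<close> says that both
  \<open>\<Sum> r\<^sub>m(p) s\<^sub>m(p)\<close> and \<open>\<Sum> r\<^sub>m(a) s\<^sub>m(b)\<close> vanish.\<close>

lemma bimodule_relation_coeffs:
  fixes r s :: "nat \<Rightarrow> 'v \<Rightarrow> 'k::field"
  assumes rs: "(\<Sum>m<n. r m * s m) = 0" and rds: "(\<Sum>m<n. Om_lact (r m) (d0 D (s m))) = 0"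
    and i: "i \<in> parcs D"
  shows "(\<Sum>m<n. r m p * s m p) = 0" and "(\<Sum>m<n. r m (fst i) * s m (snd i)) = 0"
proof -
  show 1: "(\<Sum>m<n. r m p * s m p) = 0" for p
    using fun_cong[OF rs, of p] by (simp add: fun_sum_apply)
  have "(\<Sum>m<n. r m (fst i) * (s m (snd i) - s m (fst i))) = 0"
    using fun_cong[OF rds, of i] by (simp add: fun_sum_apply Om_lact_def case_prod_unfold d0_arc[OF i])
  then show "(\<Sum>m<n. r m (fst i) * s m (snd i)) = 0"
    using 1[of "fst i"] by (simp add: algebra_simps sum_subtractf)
qed

lemma Phi_hx_rels: "u \<in> hx_rels D \<Longrightarrow> Phi u = 0"
proof (induction rule: hx_rels.induct)
  case (vec_add x y)
  then show ?case by (simp add: Phi_lin Phi_of_gen pm.scale_left_distrib sum.distrib)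
next
  case (vec_scale x c)
  then show ?case by (simp add: Phi_lin Phi_of_gen pm.scale_sum_right)
next
  case (cvec_add x y)
  then show ?case by (simp add: Phi_lin Phi_of_gen pm.scale_left_distrib sum.distrib)
next
  case (cvec_scale x c)
  then show ?case by (simp add: Phi_lin Phi_of_gen pm.scale_sum_right)
next
  case (src_vec a x)
  have "Pi.gmul (Pi.gscal a) (Phi_gen (Vec x)) = Phi_gen (Vec (X_lact a x))"
    unfolding Phi_gen.simps Pi.gmul_lin
    by (rule sum.cong) (simp_all add: gscal_vec_image X_lact_def case_prod_unfold mult_ac)
  then show ?case by (simp add: Phi_lin Phi_mult Phi_of_gen del: Phi_gen.simps(3))
next
  case (vec_src a x)
  have "Pi.gmul (Phi_gen (Vec x)) (Pi.gscal a) = Phi_gen (Vec (X_ract x a)) + Pi.gscal (ev1 D x (d0 D a))"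
    unfolding Phi_gen.simps Pi.gmul_lin gscal_ev1 sum.distrib[symmetric]
    by (rule sum.cong) (simp_all only: gscal_vec_image, simp_all add: X_ract_def case_prod_unfold vec_image_def
        pm.scale_right_diff_distrib pm.scale_left_diff_distrib algebra_simps)
  then show ?case by (simp add: Phi_lin Phi_mult Phi_of_gen del: Phi_gen.simps(3))
next
  case (tgt_cvec a x)
  have "Pi.gmul (Pi.gscal a) (Phi_gen (CVec x)) = Phi_gen (CVec (X_ract x a))"
    unfolding Phi_gen.simps Pi.gmul_lin
    by (rule sum.cong) (simp_all add: gscal_vec_image X_ract_def case_prod_unfold mult_ac)
  then show ?case by (simp add: Phi_lin Phi_mult Phi_of_gen del: Phi_gen.simps(4))
next
  case (cvec_tgt a x)
  have "Pi.gmul (Phi_gen (CVec x)) (Pi.gscal a) = Phi_gen (CVec (X_lact a x)) + Pi.gscal (uev1 D (d0 D a) x)"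
    unfolding Phi_gen.simps Pi.gmul_lin gscal_ev1 sum.distrib[symmetric]
    by (rule sum.cong) (simp_all only: gscal_vec_image, simp_all add: X_lact_def case_prod_unfold cvec_image_def
        pm.scale_right_diff_distrib pm.scale_left_diff_distrib algebra_simps)
  then show ?case by (simp add: Phi_lin Phi_mult Phi_of_gen del: Phi_gen.simps(4))
next
  case (tgt_vec_tgt n r s x)
  note z = bimodule_relation_coeffs[OF tgt_vec_tgt(3,4)]
  have "Phi (\<Sum>m<n. gtgt (s m) * gvec x * gtgt (r m)) =
    (\<Sum>m<n. \<Sum>i\<in>parcs D. pm_scale (x i * (r m (snd i) * s m (snd i))) (idb (snd i)) -
      pm_scale (x i * (r m (fst i) * s m (snd i))) (fwd i))"
    by (simp add: Phi_lin Phi_mult Phi_of_gen Pi.gmul_lin gscal_vec_image gscal_table arc_zigzags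
        pm.scale_right_diff_distrib mult_ac)
  also have "\<dots> = (\<Sum>i\<in>parcs D. pm_scale (x i * (\<Sum>m<n. r m (snd i) * s m (snd i))) (idb (snd i)) -
      pm_scale (x i * (\<Sum>m<n. r m (fst i) * s m (snd i))) (fwd i))"
    by (subst sum.swap) (simp add: sum_subtractf pm.scale_sum_left[symmetric] sum_distrib_left[symmetric])
  also have "\<dots> = 0" by (rule sum.neutral) (simp add: z)
  finally show ?case .
next
  case (src_cvec_src n r s x)
  note z = bimodule_relation_coeffs[OF src_cvec_src(3,4)]
  have "Phi (\<Sum>m<n. gsrc (r m) * gcvec x * gsrc (s m)) =
    (\<Sum>m<n. \<Sum>i\<in>parcs D. pm_scale (x i * (r m (fst i) * s m (snd i))) (bwd i) -
      pm_scale (x i * (r m (fst i) * s m (fst i))) (idb (fst i)))"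
    by (simp add: Phi_lin Phi_mult Phi_of_gen Pi.gmul_lin gscal_vec_image gscal_table arc_zigzags
        pm.scale_right_diff_distrib mult_ac)
  also have "\<dots> = (\<Sum>i\<in>parcs D. pm_scale (x i * (\<Sum>m<n. r m (fst i) * s m (snd i))) (bwd i) -
      pm_scale (x i * (\<Sum>m<n. r m (fst i) * s m (fst i))) (idb (fst i)))"
    by (subst sum.swap) (simp add: sum_subtractf pm.scale_sum_left[symmetric] sum_distrib_left[symmetric])
  also have "\<dots> = 0" by (rule sum.neutral) (simp add: z)
  finally show ?case .
next
  case (cvec_coev x)
  have "Phi (\<Sum>i\<in>parcs D. cmt (gcvec x) (gsrc (coev_b i)) * gvec (bas i)) = Phi (gcvec x)"
    unfolding Phi_cvec_coev[symmetric] Phi_lin Phi_mult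
    by (rule sum.cong) (simp_all add: Phi_of_gen Phi_gen_bas del: Phi_gen.simps)
  then show ?case by (simp add: Phi_lin)
next
  case (vec_coev x)
  have "Phi (\<Sum>i\<in>parcs D. cmt (gvec x) (gtgt (coev_c i)) * gcvec (bas i)) = Phi (gvec x)"
    unfolding Phi_vec_coev[symmetric] Phi_lin Phi_mult
    by (rule sum.cong) (simp_all add: Phi_of_gen Phi_gen_bas del: Phi_gen.simps)
  then show ?case by (simp add: Phi_lin)
next
  case (vec_cvec a x)
  then show ?case using Phi_vec_cvec[of a x] by (simp add: Phi_lin Phi_mult Phi_of_gen)
next
  case (cvec_vec a x)
  then show ?case using Phi_cvec_vec[of a x] by (simp add: Phi_lin Phi_mult Phi_of_gen)
qed (simp_all add: Phi_lin Phi_mult Phi_of_gen Phi_one gscal_lin mult.commute)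

end

lemma sum_swap_outer_inner:
  "(\<Sum>m\<in>M. \<Sum>i\<in>I. \<Sum>j\<in>J. \<Sum>t\<in>T. f m i j t) = (\<Sum>t\<in>T. \<Sum>i\<in>I. \<Sum>j\<in>J. \<Sum>m\<in>M. f m i j t)"
  for f :: "_ \<Rightarrow> _ \<Rightarrow> _ \<Rightarrow> _ \<Rightarrow> 'x::comm_monoid_add"
proof -
  have "(\<Sum>m\<in>M. \<Sum>i\<in>I. \<Sum>j\<in>J. \<Sum>t\<in>T. f m i j t) = (\<Sum>i\<in>I. \<Sum>m\<in>M. \<Sum>j\<in>J. \<Sum>t\<in>T. f m i j t)"
    by (rule sum.swap)
  also have "\<dots> = (\<Sum>i\<in>I. \<Sum>j\<in>J. \<Sum>m\<in>M. \<Sum>t\<in>T. f m i j t)"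
    by (rule sum.cong[OF HOL.refl], rule sum.swap)
  also have "\<dots> = (\<Sum>i\<in>I. \<Sum>j\<in>J. \<Sum>t\<in>T. \<Sum>m\<in>M. f m i j t)"
    by (rule sum.cong[OF HOL.refl], rule sum.cong[OF HOL.refl], rule sum.swap)
  also have "\<dots> = (\<Sum>i\<in>I. \<Sum>t\<in>T. \<Sum>j\<in>J. \<Sum>m\<in>M. f m i j t)"
    by (rule sum.cong[OF HOL.refl], rule sum.swap)
  also have "\<dots> = (\<Sum>t\<in>T. \<Sum>i\<in>I. \<Sum>j\<in>J. \<Sum>m\<in>M. f m i j t)"
    by (rule sum.swap)
  finally show ?thesis .
qed

section \<open>The relations of second order\<close>

context finite_digraph
begin

lemma sum_arc_indicator:
  "(\<Sum>i\<in>parcs D. pm_scale (if Q \<and> i = c then 1 else 0) (F i)) = (if Q \<and> c \<in> parcs D then F c else 0)"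
  for F :: "'v \<times> 'v \<Rightarrow> ('i \<Rightarrow>\<^sub>0 'k::field)"
proof -
  have "(\<Sum>i\<in>parcs D. pm_scale (if Q \<and> i = c then 1 else 0) (F i)) =
      (\<Sum>i\<in>parcs D. if i = c then (if Q then F c else 0) else 0)"
    by (rule sum.cong) auto
  then show ?thesis using finite_arcs by simp
qed

lemma basis2_arcs:
  assumes "path_choice D ch" "(p, q, r) \<in> basis2 D ch"
  shows "(p, q) \<in> parcs D" "(q, r) \<in> parcs D"
    and "(p, r) \<notin> parcs D \<Longrightarrow> (p, ch p r) \<in> parcs D" "(p, r) \<notin> parcs D \<Longrightarrow> (ch p r, r) \<in> parcs D"
  using assms by (auto simp: basis2_def paths2_def path_choice_def)

text \<open>The two sides of the curvature relation for the dual basis element of a path. They are stated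
  for an arbitrary family \<open>F\<close> because they are used both in the groupoid algebra and for the
  generators of the free algebra modulo the relations.\<close>

lemma d1_sum:
  fixes F :: "'v \<times> 'v \<Rightarrow> ('i \<Rightarrow>\<^sub>0 'k::field)"
  assumes ch: "path_choice D ch" and b: "(p, q, r) \<in> basis2 D ch"
    and F: "\<And>i. i \<in> parcs D \<Longrightarrow> snd i \<noteq> r \<Longrightarrow> F i = 0"
  shows "(\<Sum>i\<in>parcs D. pm_scale (d1_bas D ch i (p, q, r)) (F i)) =
    F (q, r) - (if (p, r) \<in> parcs D then F (p, r) else F (ch p r, r))"
proof -
  have "(\<Sum>i\<in>parcs D. pm_scale (d1_bas D ch i (p, q, r)) (F i)) =
    (\<Sum>i\<in>parcs D. pm_scale (if True \<and> i = (q, r) then 1 else 0) (F i) -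
      pm_scale (if (p, r) \<notin> parcs D \<and> i = (ch p r, r) then 1 else 0) (F i) -
      pm_scale (if True \<and> i = (p, r) then 1 else 0) (F i))"
  proof (rule sum.cong)
    fix i assume i: "i \<in> parcs D"
    show "pm_scale (d1_bas D ch i (p, q, r)) (F i) =
      pm_scale (if True \<and> i = (q, r) then 1 else 0) (F i) -
      pm_scale (if (p, r) \<notin> parcs D \<and> i = (ch p r, r) then 1 else 0) (F i) -
      pm_scale (if True \<and> i = (p, r) then 1 else 0) (F i)"
    proof (cases "snd i = r")
      case True
      show ?thesis
        unfolding d1_bas_apply[OF ch i b True] by (simp add: pm.scale_left_diff_distrib)
    qed (use F[OF i] in simp)
  qed simp
  also have "\<dots> = F (q, r) - (if (p, r) \<in> parcs D then F (p, r) else F (ch p r, r))"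
    unfolding sum_subtractf sum_arc_indicator using basis2_arcs[OF ch b] by auto
  finally show ?thesis .
qed

lemma wedge_sum:
  fixes F :: "'v \<times> 'v \<Rightarrow> 'v \<times> 'v \<Rightarrow> ('i \<Rightarrow>\<^sub>0 'k::field)"
  assumes ch: "path_choice D ch" and b: "(p, q, r) \<in> basis2 D ch"
  shows "(\<Sum>i\<in>parcs D. \<Sum>j\<in>parcs D. pm_scale (wedge D ch (bas i) (bas j) (p, q, r)) (F i j)) =
    F (p, q) (q, r) - (if (p, r) \<in> parcs D then 0 else F (p, ch p r) (ch p r, r))"
proof -
  have "(\<Sum>j\<in>parcs D. pm_scale (wedge D ch (bas i) (bas j) (p, q, r)) (F i j)) =
      pm_scale (if True \<and> i = (p, q) then 1 else 0) (F i (q, r)) -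
      pm_scale (if (p, r) \<notin> parcs D \<and> i = (p, ch p r) then 1 else 0) (F i (ch p r, r))"
    if i: "i \<in> parcs D" for i
  proof -
    have "(\<Sum>j\<in>parcs D. pm_scale (wedge D ch (bas i) (bas j) (p, q, r)) (F i j)) =
      (\<Sum>j\<in>parcs D. pm_scale (if i = (p, q) \<and> j = (q, r) then 1 else 0) (F i j) -
        pm_scale (if ((p, r) \<notin> parcs D \<and> i = (p, ch p r)) \<and> j = (ch p r, r) then 1 else 0) (F i j))"
      by (rule sum.cong) (auto simp: wedge_bas[OF ch i _ b] pm.scale_left_diff_distrib)
    also have "\<dots> = pm_scale (if True \<and> i = (p, q) then 1 else 0) (F i (q, r)) -
      pm_scale (if (p, r) \<notin> parcs D \<and> i = (p, ch p r) then 1 else 0) (F i (ch p r, r))"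
      unfolding sum_subtractf sum_arc_indicator using basis2_arcs[OF ch b] by auto
    finally show ?thesis .
  qed
  then have "(\<Sum>i\<in>parcs D. \<Sum>j\<in>parcs D. pm_scale (wedge D ch (bas i) (bas j) (p, q, r)) (F i j)) =
    (\<Sum>i\<in>parcs D. pm_scale (if True \<and> i = (p, q) then 1 else 0) (F i (q, r)) -
      pm_scale (if (p, r) \<notin> parcs D \<and> i = (p, ch p r) then 1 else 0) (F i (ch p r, r)))"
    by (intro sum.cong) auto
  then show ?thesis
    unfolding sum_subtractf sum_arc_indicator using basis2_arcs[OF ch b] by auto
qed

lemma gscal_ev2:
  assumes ch: "path_choice D ch"
  shows "Pi.gscal (ev2 D ch \<xi> \<sigma>) = (\<Sum>t\<in>basis2 D ch. pm_scale (\<xi> t) (pm_scale (\<sigma> t) (idb (snd (snd t)))))"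
    and "Pi.gscal (uev2 D ch \<sigma> \<xi>) = (\<Sum>t\<in>basis2 D ch. pm_scale (\<xi> t) (pm_scale (\<sigma> t) (idb (fst t))))"
proof -
  have v: "(\<lambda>t. snd (snd t)) ` basis2 D ch \<subseteq> pverts D" "fst ` basis2 D ch \<subseteq> pverts D"
    using arc_verts by (auto simp: basis2_def paths2_def)
  have "ev2 D ch \<xi> \<sigma> = (\<lambda>p. \<Sum>t\<in>basis2 D ch. (\<xi> t * \<sigma> t) * bas (snd (snd t)) p)"
    by (simp add: ev2_def case_prod_unfold)
  then show "Pi.gscal (ev2 D ch \<xi> \<sigma>) = (\<Sum>t\<in>basis2 D ch. pm_scale (\<xi> t) (pm_scale (\<sigma> t) (idb (snd (snd t)))))"
    using gscal_sum_bas[OF finite_basis2 v(1)] by simp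
  have "uev2 D ch \<sigma> \<xi> = (\<lambda>p. \<Sum>t\<in>basis2 D ch. (\<xi> t * \<sigma> t) * bas (fst t) p)"
    by (simp add: uev2_def case_prod_unfold mult_ac)
  then show "Pi.gscal (uev2 D ch \<sigma> \<xi>) = (\<Sum>t\<in>basis2 D ch. pm_scale (\<xi> t) (pm_scale (\<sigma> t) (idb (fst t))))"
    using gscal_sum_bas[OF finite_basis2 v(2)] by simp
qed

lemma zclass_rel:
  assumes "(l, l') \<in> pi_rels D" "zigzag D t l s" "zigzag D t l' s"
  shows "zclass t l s = zclass t l' s"
  using zigzag_eq.rel[OF assms(1), of t "[]" "[]" s D] assms by (simp add: zclass_eq_iff zigzags_def)

lemma fwd_fwd:
  assumes "(p, q) \<in> parcs D" "(q, r) \<in> parcs D"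
  shows "Pi.gmul (fwd (q, r)) (fwd (p, q)) = pm_basis (zclass r [Fwd q r, Fwd p q] p)"
  using arc_zigzags[OF assms(1)] arc_zigzags[OF assms(2)] by (simp add: fwd_def Pi_comp' del: zigzag.simps)

lemma fwd_triangle:
  assumes "(p, q) \<in> parcs D" "(q, r) \<in> parcs D" "(p, r) \<in> parcs D"
  shows "Pi.gmul (fwd (q, r)) (fwd (p, q)) = fwd (p, r)"
  unfolding fwd_fwd[OF assms(1,2)] using zclass_rel[OF pi_rels.triangle[OF assms]] assms arc_verts
  by (simp add: fwd_def)

lemma fwd_square:
  assumes "(p, q) \<in> parcs D" "(q, r) \<in> parcs D" "(p, q') \<in> parcs D" "(q', r) \<in> parcs D"
  shows "Pi.gmul (fwd (q, r)) (fwd (p, q)) = Pi.gmul (fwd (q', r)) (fwd (p, q'))"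
  unfolding fwd_fwd[OF assms(1,2)] fwd_fwd[OF assms(3,4)]
  using zclass_rel[OF pi_rels.square[OF assms]] assms arc_verts by simp

lemma idb_table:
  assumes "p \<in> pverts D"
  shows "q \<in> pverts D \<Longrightarrow> Pi.gmul (idb p) (idb q) = (if p = q then idb p else 0)"
    and "i \<in> parcs D \<Longrightarrow> Pi.gmul (idb p) (vec_image i) = (if snd i = p then vec_image i else 0)"
    and "i \<in> parcs D \<Longrightarrow> Pi.gmul (idb p) (fwd i) = (if snd i = p then fwd i else 0)"
    and "i \<in> parcs D \<Longrightarrow> Pi.gmul (idb p) (bwd i) = (if fst i = p then bwd i else 0)"
    and "i \<in> parcs D \<Longrightarrow> Pi.gmul (fwd i) (idb p) = (if fst i = p then fwd i else 0)"
    and "i \<in> parcs D \<Longrightarrow> Pi.gmul (bwd i) (idb p) = (if snd i = p then bwd i else 0)"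
  using assms by (simp_all add: idb_gscal[of p] gscal_vec_image gscal_table bas_def)

text \<open>Inverses of equal arrows are equal.\<close>

lemma bwd_square:
  assumes a: "(p, q) \<in> parcs D" "(q, r) \<in> parcs D" "(p, q') \<in> parcs D" "(q', r) \<in> parcs D"
  shows "Pi.gmul (bwd (p, q)) (bwd (q, r)) = (Pi.gmul (bwd (p, q')) (bwd (q', r)) :: _ \<Rightarrow>\<^sub>0 'k::field)"
proof -
  note c = basis_on_arrows Pi.gmul_closed
  note v = arc_verts[OF a(1)] arc_verts[OF a(2)] arc_verts[OF a(3)]
  let ?X = "Pi.gmul (bwd (p, q)) (bwd (q, r)) :: _ \<Rightarrow>\<^sub>0 'k"
    and ?X' = "Pi.gmul (bwd (p, q')) (bwd (q', r)) :: _ \<Rightarrow>\<^sub>0 'k"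
  let ?F = "Pi.gmul (fwd (q, r)) (fwd (p, q)) :: _ \<Rightarrow>\<^sub>0 'k"
    and ?F' = "Pi.gmul (fwd (q', r)) (fwd (p, q')) :: _ \<Rightarrow>\<^sub>0 'k"
  have "Pi.gmul ?X ?F = Pi.gmul (bwd (p, q)) (Pi.gmul (Pi.gmul (bwd (q, r)) (fwd (q, r))) (fwd (p, q)))"
    by (simp add: Pi.gmul_assoc c a)
  then have XF: "Pi.gmul ?X ?F = idb p"
    by (simp add: fwd_bwd(4)[OF a(2) a(2)] fwd_bwd(4)[OF a(1) a(1)] idb_table a v)
  have "Pi.gmul ?F' ?X' = Pi.gmul (fwd (q', r)) (Pi.gmul (Pi.gmul (fwd (p, q')) (bwd (p, q'))) (bwd (q', r)))"
    by (simp add: Pi.gmul_assoc c a)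
  then have FX: "Pi.gmul ?F' ?X' = idb r"
    by (simp add: fwd_bwd(2)[OF a(3) a(3)] fwd_bwd(2)[OF a(4) a(4)] idb_table a v)
  have "?X = Pi.gmul ?X (idb r)"
    by (simp add: Pi.gmul_assoc c a v idb_table)
  also have "\<dots> = Pi.gmul (Pi.gmul ?X ?F') ?X'"
    unfolding FX[symmetric] by (rule Pi.gmul_assoc[symmetric]; intro c a)
  also have "Pi.gmul ?X ?F' = idb p" using XF by (simp add: fwd_square[OF a])
  also have "Pi.gmul (idb p) ?X' = ?X'"
    by (simp add: Pi.gmul_assoc[symmetric] c a v idb_table)
  finally show ?thesis .
qed

lemma vec_image_comp:
  assumes "(p, q) \<in> parcs D" "(q, r) \<in> parcs D"
  shows "Pi.gmul (vec_image (q, r)) (vec_image (p, q)) = Pi.gmul (fwd (q, r)) (fwd (p, q)) - fwd (q, r)"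
  using assms arc_verts[OF assms(1)] arc_verts[OF assms(2)] arc_neq[OF assms(2)]
  by (simp add: vec_image_def Pi.gmul_lin idb_table)

text \<open>Write \<open>E\<^bsub>qr\<^esub>\<close> for \<open>fwd (q, r)\<close>. At a path \<open>p \<rightarrow> q \<rightarrow> r\<close> with a shortcut the relation reads
  \<open>E\<^bsub>pr\<^esub> - E\<^bsub>qr\<^esub> = E\<^bsub>qr\<^esub> E\<^bsub>pq\<^esub> - E\<^bsub>qr\<^esub>\<close>. Without a shortcut and with chosen midpoint \<open>c\<close> it reads
  \<open>E\<^bsub>cr\<^esub> - E\<^bsub>qr\<^esub> = (E\<^bsub>qr\<^esub> E\<^bsub>pq\<^esub> - E\<^bsub>qr\<^esub>) - (E\<^bsub>cr\<^esub> E\<^bsub>pc\<^esub> - E\<^bsub>cr\<^esub>)\<close>. These are the triangle and the square.\<close>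

lemma Phi_curvature:
  assumes ch: "path_choice D ch"
  shows "(\<Sum>i\<in>parcs D. Pi.gmul (Pi.gscal (ev2 D ch \<xi> (d1_bas D ch i))) (vec_image i)) =
    (\<Sum>j\<in>parcs D. \<Sum>k\<in>parcs D. Pi.gmul (Pi.gmul (Pi.gscal (ev2 D ch \<xi> (wedge D ch (bas j) (bas k)))) (vec_image k)) (vec_image j))"
    (is "?L = ?R")
proof -
  have "?L = (\<Sum>t\<in>basis2 D ch. pm_scale (\<xi> t)
      (\<Sum>i\<in>parcs D. pm_scale (d1_bas D ch i t) (Pi.gmul (idb (snd (snd t))) (vec_image i))))"
    unfolding gscal_ev2[OF ch] Pi.gmul_lin pm.scale_sum_right by (rule sum.swap)
  also have "\<dots> = (\<Sum>t\<in>basis2 D ch. pm_scale (\<xi> t)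
      (\<Sum>j\<in>parcs D. \<Sum>k\<in>parcs D. pm_scale (wedge D ch (bas j) (bas k) t)
        (Pi.gmul (Pi.gmul (idb (snd (snd t))) (vec_image k)) (vec_image j))))"
  proof (rule sum.cong[OF HOL.refl], rule arg_cong[where f = "pm_scale _"])
    fix t assume t: "t \<in> basis2 D ch"
    obtain p q r where tt: "t = (p, q, r)" by (metis prod_cases3)
    note b = t[unfolded tt] and arcs = basis2_arcs[OF ch t[unfolded tt]]
    have r: "r \<in> pverts D" using arc_verts arcs(2) by blast
    show "(\<Sum>i\<in>parcs D. pm_scale (d1_bas D ch i t) (Pi.gmul (idb (snd (snd t))) (vec_image i))) =
      (\<Sum>j\<in>parcs D. \<Sum>k\<in>parcs D. pm_scale (wedge D ch (bas j) (bas k) t)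
        (Pi.gmul (Pi.gmul (idb (snd (snd t))) (vec_image k)) (vec_image j)))"
    proof (cases "(p, r) \<in> parcs D")
      case True
      then show ?thesis
        unfolding tt wedge_sum[OF ch b]
        by (subst d1_sum[OF ch b])
          (simp_all add: idb_table r arcs vec_image_comp fwd_triangle, simp add: vec_image_def)
    next
      case False
      then show ?thesis
        unfolding tt wedge_sum[OF ch b]
        by (subst d1_sum[OF ch b])
          (simp_all add: idb_table r arcs vec_image_comp fwd_square[of p q r "ch p r"], simp add: vec_image_def)
    qed
  qed
  also have "\<dots> = ?R"
    unfolding gscal_ev2[OF ch] Pi.gmul_lin pm.scale_sum_right
    by (subst sum.swap, intro sum.cong HOL.refl, rule sum.swap)
  finally show ?thesis .
qed

text \<open>The shape in the groupoid algebra of both families of relations that involve the kernel of \<open>\<and>\<close>,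
  with \<open>X\<close> a product of two generating arrows or of their inverses. Along the paths with given ends
  and no shortcut, the coefficients \<open>\<Sum> r\<^sub>m da\<^sub>m \<otimes> da'\<^sub>m\<close> as well as \<open>X\<close> are constant, so that the sum is a
  multiple of the projection of a defining relation of \<open>\<Omega>\<^sup>2\<^sub>t\<^sub>o\<^sub>p\<close>; at paths with a shortcut the
  coefficients vanish.\<close>

lemma wedge_ker_sum:
  fixes X :: "'v \<times> 'v \<times> 'v \<Rightarrow> 'v \<times> 'v \<Rightarrow> 'v \<times> 'v \<Rightarrow> ('i \<Rightarrow>\<^sub>0 'k::field)"
    and r a a' :: "nat \<Rightarrow> 'v \<Rightarrow> 'k"
  assumes ch: "path_choice D ch"
    and ker: "(\<Sum>m<n. Om_tensor (Om_lact (r m) (d0 D (a m))) (d0 D (a' m))) \<in> wedge_ker D" (is "?\<tau> \<in> _")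
    and X: "\<And>t p q q' s. \<lbrakk>(p, q) \<in> parcs D; (q, s) \<in> parcs D; (p, q') \<in> parcs D; (q', s) \<in> parcs D\<rbrakk> \<Longrightarrow>
      X t (p, q) (q, s) = X t (p, q') (q', s)"
  shows "(\<Sum>m<n. \<Sum>i\<in>parcs D. \<Sum>j\<in>parcs D. \<Sum>t\<in>basis2 D ch. pm_scale (\<xi> t)
      (pm_scale (wedge D ch (bas i) (bas j) t)
      (pm_scale (r m (fst i) * (a m (snd i) - a m (fst i)) * (a' m (snd j) - a' m (fst j))) (X t i j)))) = 0"
proof -
  define c where "c m i j = r m (fst i) * (a m (snd i) - a m (fst i)) * (a' m (snd j) - a' m (fst j))" for m i j
  have c: "(\<Sum>m<n. c m (p, q) (q, s)) = ?\<tau> (p, q, s)" if "(p, q) \<in> parcs D" "(q, s) \<in> parcs D" for p q s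
    using that by (simp add: fun_sum_apply Om_tensor_def Om_lact_def d0_arc c_def)
  have "(\<Sum>m<n. \<Sum>i\<in>parcs D. \<Sum>j\<in>parcs D. \<Sum>t\<in>basis2 D ch. pm_scale (\<xi> t)
      (pm_scale (wedge D ch (bas i) (bas j) t) (pm_scale (c m i j) (X t i j)))) =
    (\<Sum>t\<in>basis2 D ch. \<Sum>i\<in>parcs D. \<Sum>j\<in>parcs D. \<Sum>m<n. pm_scale (\<xi> t)
      (pm_scale (wedge D ch (bas i) (bas j) t) (pm_scale (c m i j) (X t i j))))"
    by (rule sum_swap_outer_inner)
  also have "\<dots> = (\<Sum>t\<in>basis2 D ch. pm_scale (\<xi> t) (\<Sum>i\<in>parcs D. \<Sum>j\<in>parcs D.
      pm_scale (wedge D ch (bas i) (bas j) t) (pm_scale (\<Sum>m<n. c m i j) (X t i j))))"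
    by (simp only: pm.scale_sum_left pm.scale_sum_right)
  also have "\<dots> = 0"
  proof (rule sum.neutral, rule ballI)
    fix t assume t: "t \<in> basis2 D ch"
    obtain p q s where tt: "t = (p, q, s)" by (metis prod_cases3)
    note b = t[unfolded tt] and arcs = basis2_arcs[OF ch t[unfolded tt]]
    note ker' = ker[unfolded wedge_ker_iff[OF ch]]
    have "(\<Sum>i\<in>parcs D. \<Sum>j\<in>parcs D.
      pm_scale (wedge D ch (bas i) (bas j) t) (pm_scale (\<Sum>m<n. c m i j) (X t i j))) = 0"
    proof (cases "(p, s) \<in> parcs D")
      case True
      then have "?\<tau> (p, q, s) = 0" using ker' by blast
      then show ?thesis unfolding tt wedge_sum[OF ch b] using True by (simp add: c[OF arcs(1,2)])
    next
      case False
      have "(p, q, s) \<in> paths2 D" "(p, ch p s, s) \<in> paths2 D"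
        using arcs False by (simp_all add: paths2_def)
      then have "?\<tau> (p, q, s) = ?\<tau> (p, ch p s, s)" using ker' by blast
      moreover have "X t (p, q) (q, s) = X t (p, ch p s) (ch p s, s)"
        by (rule X) (use arcs False in simp_all)
      ultimately show ?thesis
        unfolding tt wedge_sum[OF ch b] using False
        by (simp add: c[OF arcs(1,2)] c[OF arcs(3)[OF False] arcs(4)[OF False]])
    qed
    then show "pm_scale (\<xi> t) (\<Sum>i\<in>parcs D. \<Sum>j\<in>parcs D.
      pm_scale (wedge D ch (bas i) (bas j) t) (pm_scale (\<Sum>m<n. c m i j) (X t i j))) = 0"
      by simp
  qed
  finally show ?thesis by (simp add: c_def)
qed

lemma Phi_dx_rels:
  assumes ch: "path_choice D ch" and u: "u \<in> dx_rels D ch"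
  shows "Phi u = (0 :: _ \<Rightarrow>\<^sub>0 'k::field)"
  using u
proof cases
  case (curvature \<xi>)
  have "Phi u = (\<Sum>i\<in>parcs D. Pi.gmul (Pi.gscal (ev2 D ch \<xi> (d1_bas D ch i))) (vec_image i)) -
    (\<Sum>j\<in>parcs D. \<Sum>k\<in>parcs D. Pi.gmul (Pi.gmul (Pi.gscal (ev2 D ch \<xi> (wedge D ch (bas j) (bas k)))) (vec_image k)) (vec_image j))"
    unfolding curvature Phi_lin Phi_mult Phi_of_gen Phi_gen.simps(1)
    by (intro arg_cong2[where f = "(-)"] sum.cong) (simp_all add: Phi_gen_bas del: Phi_gen.simps)
  then show ?thesis using Phi_curvature[OF ch] by simp
next
  case (vec_vec \<xi> n r a a')
  have 1: "Phi (gsrc (ev2 D ch \<xi> (wedge D ch (bas i) (bas j))) * cmt (gvec (bas j)) (gtgt (a' m)) *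
      cmt (gvec (bas i)) (gtgt (a m)) * gtgt (r m)) =
    (\<Sum>t\<in>basis2 D ch. pm_scale (\<xi> t) (pm_scale (wedge D ch (bas i) (bas j) t)
      (pm_scale (r m (fst i) * (a m (snd i) - a m (fst i)) * (a' m (snd j) - a' m (fst j)))
      (if snd (snd t) = snd j then Pi.gmul (fwd j) (fwd i) else 0))))"
    if i: "i \<in> parcs D" and j: "j \<in> parcs D" for i j m
  proof -
    have "Pi.gmul (Pi.gmul (Pi.gmul (idb (snd (snd t))) (fwd j)) (fwd i)) (Pi.gscal (r m)) =
      pm_scale (r m (fst i)) (if snd (snd t) = snd j then Pi.gmul (fwd j) (fwd i) else (0 :: _ \<Rightarrow>\<^sub>0 'k))"
      if "t \<in> basis2 D ch" for t
    proof -
      have "snd (snd t) \<in> pverts D" using that arc_verts by (auto simp: basis2_def paths2_def)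
      then show ?thesis
        using i j by (auto simp: idb_table Pi.gmul_lin Pi.gmul_assoc basis_on_arrows Pi.gscal_closed gscal_table)
    qed
    then show ?thesis
      unfolding Phi_mult Phi_of_gen Phi_gen.simps gscal_ev2[OF ch] cmt_bas[OF i] cmt_bas[OF j] Pi.gmul_lin
        pm.scale_sum_right
      by (intro sum.cong) (auto simp: mult_ac)
  qed
  have "Phi u = (\<Sum>m<n. \<Sum>i\<in>parcs D. \<Sum>j\<in>parcs D. \<Sum>t\<in>basis2 D ch. pm_scale (\<xi> t)
      (pm_scale (wedge D ch (bas i) (bas j) t)
      (pm_scale (r m (fst i) * (a m (snd i) - a m (fst i)) * (a' m (snd j) - a' m (fst j)))
      (if snd (snd t) = snd j then Pi.gmul (fwd j) (fwd i) else 0))))"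
    unfolding vec_vec Phi_lin by (intro sum.cong HOL.refl 1)
  also have "\<dots> = 0"
  proof (rule wedge_ker_sum[OF ch vec_vec(6)])
    fix t p q q' s
    assume arcs: "(p, q) \<in> parcs D" "(q, s) \<in> parcs D" "(p, q') \<in> parcs D" "(q', s) \<in> parcs D"
    show "(if snd (snd t) = snd (q, s) then Pi.gmul (fwd (q, s)) (fwd (p, q)) else 0) =
      (if snd (snd t) = snd (q', s) then Pi.gmul (fwd (q', s)) (fwd (p, q')) else (0 :: _ \<Rightarrow>\<^sub>0 'k))"
      by (simp add: fwd_square[OF arcs])
  qed
  finally show ?thesis .
next
  case (cvec_cvec \<xi> n r a a')
  have 1: "Phi (gtgt (uev2 D ch (wedge D ch (bas i) (bas j)) \<xi>) * gsrc (r m) *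
      cmt (gcvec (bas i)) (gsrc (a m)) * cmt (gcvec (bas j)) (gsrc (a' m))) =
    (\<Sum>t\<in>basis2 D ch. pm_scale (\<xi> t) (pm_scale (wedge D ch (bas i) (bas j) t)
      (pm_scale (r m (fst i) * (a m (snd i) - a m (fst i)) * (a' m (snd j) - a' m (fst j)))
      (if fst t = fst i then Pi.gmul (bwd i) (bwd j) else 0))))"
    if i: "i \<in> parcs D" and j: "j \<in> parcs D" for i j m
  proof -
    have "Pi.gmul (Pi.gmul (Pi.gmul (idb (fst t)) (Pi.gscal (r m))) (bwd i)) (bwd j) =
      pm_scale (r m (fst i)) (if fst t = fst i then Pi.gmul (bwd i) (bwd j) else (0 :: _ \<Rightarrow>\<^sub>0 'k))"
      if "t \<in> basis2 D ch" for t
    proof -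
      have "fst t \<in> pverts D" using that arc_verts by (auto simp: basis2_def paths2_def)
      then show ?thesis
        using i j by (auto simp: idb_table Pi.gmul_lin gscal_table)
    qed
    then show ?thesis
      unfolding Phi_mult Phi_of_gen Phi_gen.simps gscal_ev2[OF ch] cmt_bas[OF i] cmt_bas[OF j] Pi.gmul_lin
        pm.scale_sum_right
      by (intro sum.cong) (auto simp: mult_ac)
  qed
  have "Phi u = (\<Sum>m<n. \<Sum>i\<in>parcs D. \<Sum>j\<in>parcs D. \<Sum>t\<in>basis2 D ch. pm_scale (\<xi> t)
      (pm_scale (wedge D ch (bas i) (bas j) t)
      (pm_scale (r m (fst i) * (a m (snd i) - a m (fst i)) * (a' m (snd j) - a' m (fst j)))
      (if fst t = fst i then Pi.gmul (bwd i) (bwd j) else 0))))"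
    unfolding cvec_cvec Phi_lin by (intro sum.cong HOL.refl 1)
  also have "\<dots> = 0"
  proof (rule wedge_ker_sum[OF ch cvec_cvec(6)])
    fix t p q q' s
    assume arcs: "(p, q) \<in> parcs D" "(q, s) \<in> parcs D" "(p, q') \<in> parcs D" "(q', s) \<in> parcs D"
    show "(if fst t = fst (p, q) then Pi.gmul (bwd (p, q)) (bwd (q, s)) else 0) =
      (if fst t = fst (p, q') then Pi.gmul (bwd (p, q')) (bwd (q', s)) else (0 :: _ \<Rightarrow>\<^sub>0 'k))"
      by (simp add: bwd_square[OF arcs])
  qed
  finally show ?thesis .
qed

end

section \<open>Comultiplication and counit\<close>

context finite_digraph
begin

abbreviation free_carrier :: "('v, 'k::field) free set" where
  "free_carrier \<equiv> carrier (free_hopf D)"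

definition words :: "('v, 'k::field) generator fword set" where
  "words = {w. set (letters w) \<subseteq> generators D}"

lemma free_carrier_iff: "u \<in> free_carrier \<longleftrightarrow> Poly_Mapping.keys u \<subseteq> words"
  by (auto simp: free_hopf_def words_def)

lemma free_simps:
  "monoid.mult (free_hopf D) = (*)" "one (free_hopf D) = 1" "zero (free_hopf D) = 0"
  "add (free_hopf D) = (+)" "smult (free_hopf D) = pm_scale" "src (free_hopf D) = gsrc"
  "tgt (free_hopf D) = gtgt" "counit (free_hopf D) = eps_free D"
  "comul (free_hopf D) u =
    {pm_extend (\<lambda>(w, w'). pm_basis (pm_basis w, pm_basis w')) (delta_free D u)}"
  by (simp_all add: free_hopf_def)

lemma words_closed: "0 \<in> words" "w \<in> words \<Longrightarrow> w' \<in> words \<Longrightarrow> w + w' \<in> words"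
  by (auto simp: words_def zero_fword_def plus_fword_def)

lemma free_closed [simp]:
  fixes u v :: "('v, 'k::field) free"
  shows "0 \<in> free_carrier" "1 \<in> free_carrier"
    and "u \<in> free_carrier \<Longrightarrow> v \<in> free_carrier \<Longrightarrow> u + v \<in> free_carrier"
    and "u \<in> free_carrier \<Longrightarrow> v \<in> free_carrier \<Longrightarrow> u - v \<in> free_carrier"
    and "u \<in> free_carrier \<Longrightarrow> - u \<in> free_carrier"
    and "u \<in> free_carrier \<Longrightarrow> pm_scale c u \<in> free_carrier"
    and "u \<in> free_carrier \<Longrightarrow> v \<in> free_carrier \<Longrightarrow> u * v \<in> free_carrier"
proof -
  show "0 \<in> free_carrier" "1 \<in> free_carrier" using words_closed(1) by (auto simp: free_carrier_iff)
  assume u: "u \<in> free_carrier"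
  then show "- u \<in> free_carrier" by (auto simp: free_carrier_iff keys_def)
  show "pm_scale c u \<in> free_carrier"
    using u order_trans[OF keys_pm_scale[of c u]] by (simp only: free_carrier_iff)
  assume v: "v \<in> free_carrier"
  show "u + v \<in> free_carrier"
    using u v order_trans[OF keys_add[of u v]] by (simp only: free_carrier_iff Un_least)
  show "u - v \<in> free_carrier"
    using u v keys_diff_subset[of u words v] by (simp only: free_carrier_iff)
  have "Poly_Mapping.keys (u * v) \<subseteq> words"
  proof
    fix w assume "w \<in> Poly_Mapping.keys (u * v)"
    then obtain a b where "w = a + b" "a \<in> Poly_Mapping.keys u" "b \<in> Poly_Mapping.keys v"
      using keys_mult[of u v] by blast
    then show "w \<in> words" using u v words_closed(2) unfolding free_carrier_iff by blast
  qed
  then show "u * v \<in> free_carrier" by (simp add: free_carrier_iff)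
qed

lemma free_sum_closed [simp]:
  "(\<And>i. i \<in> S \<Longrightarrow> f i \<in> free_carrier) \<Longrightarrow> sum f S \<in> free_carrier"
  by (induction S rule: infinite_finite_induct) auto

lemma free_sum_lessThan_closed [simp]:
  "(\<And>i. i < n \<Longrightarrow> f i \<in> free_carrier) \<Longrightarrow> sum f {..<n::nat} \<in> free_carrier"
  by (rule free_sum_closed) simp

lemma gen_closed: "g \<in> generators D \<Longrightarrow> gen g \<in> free_carrier"
  by (simp add: gen_def free_carrier_iff words_def)

lemma gens_closed [simp]:
  "a \<in> algA D \<Longrightarrow> gsrc a \<in> free_carrier" "a \<in> algA D \<Longrightarrow> gtgt a \<in> free_carrier"
  "x \<in> X1 D \<Longrightarrow> gvec x \<in> free_carrier" "x \<in> X1 D \<Longrightarrow> gcvec x \<in> free_carrier"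
  by (auto intro!: gen_closed simp: generators_def)

lemma cmt_closed [simp]: "u \<in> free_carrier \<Longrightarrow> v \<in> free_carrier \<Longrightarrow> cmt u v \<in> free_carrier"
  for u v :: "('v, 'k::field) free"
  by (simp add: cmt_def)

lemma algA_closed [simp]:
  "p \<in> pverts D \<Longrightarrow> bas p \<in> algA D" "unitA D \<in> algA D"
  "i \<in> parcs D \<Longrightarrow> coev_b i \<in> algA D" "i \<in> parcs D \<Longrightarrow> coev_c i \<in> algA D"
  "i \<in> parcs D \<Longrightarrow> bas i \<in> X1 D"
  using arc_zigzags[of i]
  by (auto simp: algA_def X1_def fun_on_def bas_def coev_b_def coev_c_def unitA_def fun_sum_apply intro!: sum.neutral)

lemma algA_ops [simp]:
  "a \<in> algA D \<Longrightarrow> b \<in> algA D \<Longrightarrow> a + b \<in> algA D"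
  "a \<in> algA D \<Longrightarrow> a * b \<in> algA D" "a \<in> algA D \<Longrightarrow> (\<lambda>p. c * a p) \<in> algA D"
  "x \<in> X1 D \<Longrightarrow> y \<in> X1 D \<Longrightarrow> x + y \<in> X1 D" "x \<in> X1 D \<Longrightarrow> (\<lambda>e. c * x e) \<in> X1 D"
  "x \<in> X1 D \<Longrightarrow> X_lact a' x \<in> X1 D" "x \<in> X1 D \<Longrightarrow> X_ract x a' \<in> X1 D"
  for a b :: "'v \<Rightarrow> 'k::field"
  by (auto simp: algA_def X1_def fun_on_def X_lact_def X_ract_def)

lemma ev_closed [simp]:
  "ev1 D x \<omega> \<in> algA D" "uev1 D \<omega> x \<in> algA D" "ev2 D ch \<xi> \<sigma> \<in> algA D" "uev2 D ch \<sigma> \<xi> \<in> algA D"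
  using arc_verts by (auto simp: algA_def fun_on_def ev1_def uev1_def ev2_def uev2_def bas_def basis2_def paths2_def
      intro!: sum.neutral split: if_splits)

lemma hx_rels_closed: "hx_rels D \<subseteq> free_carrier"
proof
  fix u assume "u \<in> hx_rels D"
  then show "u \<in> free_carrier" by cases simp_all
qed

lemma dx_rels_closed: "dx_rels D ch \<subseteq> free_carrier"
proof
  fix u assume "u \<in> dx_rels D ch"
  then show "u \<in> free_carrier" by cases simp_all
qed

lemma ring_free: "ring (free_hopf D :: ('k::field, ('v, 'k) free, 'v) hopf_algebroid)"
proof (rule ringI)
  show "abelian_group (free_hopf D :: ('k::field, ('v, 'k) free, 'v) hopf_algebroid)"
  proof (rule abelian_groupI)
    fix u :: "('v, 'k) free" assume "u \<in> free_carrier"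
    then show "\<exists>v\<in>free_carrier. v \<oplus>\<^bsub>free_hopf D\<^esub> u = \<zero>\<^bsub>free_hopf D\<^esub>"
      by (intro bexI[of _ "- u"]) (simp_all add: free_simps)
  qed (simp_all add: free_simps ac_simps)
  show "Group.monoid (free_hopf D :: ('k::field, ('v, 'k) free, 'v) hopf_algebroid)"
    by (rule monoidI) (simp_all add: free_simps mult.assoc)
qed (simp_all add: free_simps algebra_simps)

lemma algebroid_struct_free:
  "algebroid_struct (pverts D) (free_hopf D :: ('k::field, ('v, 'k) free, 'v) hopf_algebroid)"
  unfolding algebroid_struct_def
proof (intro conjI ballI allI ring_free)
  fix c and u :: "('v, 'k) free" assume "u \<in> free_carrier"
  then show "c \<odot>\<^bsub>free_hopf D\<^esub> u \<in> free_carrier"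
    "c \<odot>\<^bsub>free_hopf D\<^esub> u = (c \<odot>\<^bsub>free_hopf D\<^esub> \<one>\<^bsub>free_hopf D\<^esub>) \<otimes>\<^bsub>free_hopf D\<^esub> u"
    by (simp_all add: free_simps pm_scale_mult_left)
next
  fix a :: "'v \<Rightarrow> 'k" assume "a \<in> fun_on (pverts D)"
  then show "src (free_hopf D) a \<in> free_carrier" "tgt (free_hopf D) a \<in> free_carrier"
    by (simp_all add: free_simps algA_def[symmetric])
qed

text \<open>The map \<open>\<Phi> \<otimes> \<Phi>\<close>, with values expanded into pairs of arrows.\<close>

definition Phi2 :: "(('v, 'k::field) generator fword \<times> ('v, 'k) generator fword \<Rightarrow>\<^sub>0 'k) \<Rightarrow>
    ('v zigzag_class \<times> 'v zigzag_class \<Rightarrow>\<^sub>0 'k)" where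
  "Phi2 = pm_extend (\<lambda>(w, w'). pm_tensor (Phi_word w) (Phi_word w'))"

lemma pm_linear_Phi2: "pm_linear Phi2"
  unfolding Phi2_def by (rule pm_linear_extend)

lemmas Phi2_lin = pm_linearD[OF pm_linear_Phi2]

lemma Phi2_closed: "Pi.on_pairs (Phi2 x)"
  unfolding Phi2_def by (intro keys_pm_extend) (auto dest: subsetD[OF keys_pm_tensor[OF Phi_word_closed Phi_word_closed]])

lemma Phi2_tensor: "Phi2 (pm_tensor u v) = pm_tensor (Phi u) (Phi v)"
  by (rule pm_bilinear_eq[where B = "\<lambda>u v. Phi2 (pm_tensor u v)" and B' = "\<lambda>u v. pm_tensor (Phi u) (Phi v)",
        OF pm_linear_comp[OF pm_linear_tensor_left pm_linear_Phi2] pm_linear_comp[OF pm_linear_tensor_right pm_linear_Phi2]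
          pm_linear_comp[OF pm_linear_Phi pm_linear_tensor_left] pm_linear_comp[OF pm_linear_Phi pm_linear_tensor_right]])
    (simp add: Phi2_def Phi_basis)

lemma Phi2_mult: "Phi2 (x * y) = Pi.gmul2 (Phi2 x) (Phi2 y)"
  by (rule pm_bilinear_eq[where B = "\<lambda>x y. Phi2 (x * y)" and B' = "\<lambda>x y. Pi.gmul2 (Phi2 x) (Phi2 y)",
        OF pm_linear_comp[OF pm_linear_mult(1) pm_linear_Phi2] pm_linear_comp[OF pm_linear_mult(2) pm_linear_Phi2]
          pm_linear_comp[OF pm_linear_Phi2 Pi.pm_linear_gmul2(1)]
          pm_linear_comp[OF pm_linear_Phi2 Pi.pm_linear_gmul2(2)]])
    (simp add: mult_single Phi2_def Phi_word_plus Pi.gmul2_tensor case_prod_unfold)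

lemma pm_linear_st_tensor: 
  "pm_linear (\<lambda>u. Pi.same_target (pm_tensor u v))" "pm_linear (\<lambda>v. Pi.same_target (pm_tensor u v))"
  by (rule pm_linear_comp[OF pm_linear_tensor_left Pi.pm_linear_maps(2)]
      pm_linear_comp[OF pm_linear_tensor_right Pi.pm_linear_maps(2)])+

lemmas st_lin = pm_linearD[OF pm_linear_st_tensor(1)] pm_linearD[OF pm_linear_st_tensor(2)]

lemma st_table:
  "p \<in> pverts D \<Longrightarrow> q \<in> pverts D \<Longrightarrow> Pi.same_target (pm_tensor (idb p) (idb q)) = (if p = q then Pi.diag (idb p) else 0)"
  "i \<in> parcs D \<Longrightarrow> q \<in> pverts D \<Longrightarrow> Pi.same_target (pm_tensor (fwd i) (idb q)) = (if snd i = q then pm_tensor (fwd i) (idb q) else 0)"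
  "i \<in> parcs D \<Longrightarrow> q \<in> pverts D \<Longrightarrow> Pi.same_target (pm_tensor (idb q) (bwd i)) = (if fst i = q then pm_tensor (idb q) (bwd i) else 0)"
  "i \<in> parcs D \<Longrightarrow> j \<in> parcs D \<Longrightarrow> Pi.same_target (pm_tensor (fwd i) (fwd j)) = (if snd i = snd j then pm_tensor (fwd i) (fwd j) else 0)"
  "i \<in> parcs D \<Longrightarrow> j \<in> parcs D \<Longrightarrow> Pi.same_target (pm_tensor (bwd i) (bwd j)) = (if fst i = fst j then pm_tensor (bwd i) (bwd j) else 0)"
  using arc_zigzags[of i] arc_zigzags[of j]
  by (auto simp: idb_def fwd_def bwd_def Pi.maps_basis Pi_ends simp del: zigzag.simps) 
     (auto simp: Pi_ends)

lemma diag_table: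
  "Pi.diag (fwd i) = pm_tensor (fwd i) (fwd i)" "Pi.diag (bwd i) = pm_tensor (bwd i) (bwd i)"
  by (simp_all add: fwd_def bwd_def Pi.maps_basis)

lemma gunit_idb: "Pi.gunit = (\<Sum>p\<in>pverts D. idb p)"
  by (simp add: Pi.gunit_def Pi_objs Pi_id idb_def)

lemma st_gunit:
  "i \<in> parcs D \<Longrightarrow> Pi.same_target (pm_tensor (fwd i) Pi.gunit) = pm_tensor (fwd i) (idb (snd i))"
  "i \<in> parcs D \<Longrightarrow> Pi.same_target (pm_tensor Pi.gunit (bwd i)) = pm_tensor (idb (fst i)) (bwd i)"
  "p \<in> pverts D \<Longrightarrow> Pi.same_target (pm_tensor (idb p) Pi.gunit) = Pi.diag (idb p)"
  "p \<in> pverts D \<Longrightarrow> Pi.same_target (pm_tensor Pi.gunit (idb p)) = Pi.diag (idb p)"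
  using arc_zigzags[of i] finite_verts
  by (simp_all add: gunit_idb st_lin st_table cong: sum.cong)

lemma st_gunit_gunit: "Pi.same_target (pm_tensor Pi.gunit Pi.gunit) = Pi.diag Pi.gunit"
  unfolding gunit_idb[symmetric] by (subst (2 3) gunit_idb) (simp add: st_lin Pi.maps_lin st_gunit)

lemma st_gscal:
  "Pi.same_target (pm_tensor (Pi.gscal a) Pi.gunit) = Pi.diag (Pi.gscal a)"
  "Pi.same_target (pm_tensor Pi.gunit (Pi.gscal a)) = Pi.diag (Pi.gscal a)"
  unfolding Pi.gscal_def Pi_objs Pi_id idb_def[symmetric]
  by (simp_all add: st_lin Pi.maps_lin st_gunit)

text \<open>For \<open>x = f\<^sub>q - E\<close> with an arrow \<open>E\<close> from \<open>p\<close> to \<open>q\<close> the sum in the comultiplication of \<open>x\<close> has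
  a single nonzero term, and \<open>(f\<^sub>q - E) \<otimes> 1 + E \<otimes> (f\<^sub>q - E) = f\<^sub>q \<otimes> f\<^sub>q - E \<otimes> E\<close>. The computation for
  overlined vectors is similar.\<close>

lemma st_delta_gen: "Pi.same_target (Phi2 (delta_gen D g)) = Pi.diag (Phi_gen g)"
proof (cases g)
  case (Src a)
  then show ?thesis by (simp add: Phi2_tensor Phi_of_gen Phi_one st_gscal)
next
  case (Tgt a)
  then show ?thesis by (simp add: Phi2_tensor Phi_of_gen Phi_one st_gscal)
next
  case (Vec x)
  have "(\<Sum>i\<in>parcs D. Pi.same_target (pm_tensor (Phi (cmt (gvec x) (gtgt (coev_b i)))) (vec_image i))) =
    (\<Sum>j\<in>parcs D. pm_scale (x j) (\<Sum>i\<in>parcs D. pm_scale (coev_b i (snd j) - coev_b i (fst j))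
      (Pi.same_target (pm_tensor (fwd j) (vec_image i)))))"
    unfolding cmt_vec st_lin pm.scale_sum_right by (subst sum.swap) simp
  also have "\<dots> = (\<Sum>j\<in>parcs D. pm_scale (x j) (Pi.same_target (pm_tensor (fwd j) (vec_image j))))"
    by (intro sum.cong HOL.refl arg_cong[where f = "pm_scale _"] coev_b_sum)
      (auto simp: vec_image_def st_lin st_table arc_zigzags)
  finally have "Pi.same_target (Phi2 (delta_gen D g)) =
     (\<Sum>j\<in>parcs D. pm_scale (x j) (Pi.same_target (pm_tensor (vec_image j) Pi.gunit))) +
     (\<Sum>j\<in>parcs D. pm_scale (x j) (Pi.same_target (pm_tensor (fwd j) (vec_image j))))"
    by (simp add: Vec Phi2_lin Phi2_tensor Pi.maps_lin Phi_of_gen Phi_gen_bas Phi_one st_lin del: Phi_gen.simps(3)) (simp add: st_lin)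
  also have "\<dots> = (\<Sum>j\<in>parcs D. pm_scale (x j) (Pi.diag (vec_image j)))"
    unfolding sum.distrib[symmetric] pm.scale_right_distrib[symmetric]
    by (intro sum.cong HOL.refl arg_cong[where f = "pm_scale _"])
      (simp add: vec_image_def st_lin st_gunit st_table arc_zigzags Pi.maps_lin diag_table)
  finally show ?thesis by (simp add: Vec Pi.maps_lin)
next
  case (CVec x)
  have "(\<Sum>i\<in>parcs D. Pi.same_target (pm_tensor (cvec_image i) (Phi (cmt (gcvec x) (gsrc (coev_c i)))))) =
    (\<Sum>j\<in>parcs D. pm_scale (x j) (\<Sum>i\<in>parcs D. pm_scale (coev_c i (snd j) - coev_c i (fst j))
      (Pi.same_target (pm_tensor (cvec_image i) (bwd j)))))"
    unfolding cmt_cvec st_lin pm.scale_sum_right by (subst sum.swap) simp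
  also have "\<dots> = (\<Sum>j\<in>parcs D. pm_scale (x j) (Pi.same_target (pm_tensor (cvec_image j) (bwd j))))"
    by (intro sum.cong HOL.refl arg_cong[where f = "pm_scale _"] coev_c_sum)
      (auto simp: cvec_image_def st_lin st_table arc_zigzags)
  finally have "Pi.same_target (Phi2 (delta_gen D g)) =
     (\<Sum>j\<in>parcs D. pm_scale (x j) (Pi.same_target (pm_tensor Pi.gunit (cvec_image j)))) +
     (\<Sum>j\<in>parcs D. pm_scale (x j) (Pi.same_target (pm_tensor (cvec_image j) (bwd j))))"
    by (simp add: CVec Phi2_lin Phi2_tensor Pi.maps_lin Phi_of_gen Phi_gen_bas Phi_one st_lin del: Phi_gen.simps(4)) (simp add: st_lin)
  also have "\<dots> = (\<Sum>j\<in>parcs D. pm_scale (x j) (Pi.diag (cvec_image j)))"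
    unfolding sum.distrib[symmetric] pm.scale_right_distrib[symmetric]
    by (intro sum.cong HOL.refl arg_cong[where f = "pm_scale _"])
      (simp add: cvec_image_def st_lin st_gunit st_table arc_zigzags Pi.maps_lin diag_table)
  finally show ?thesis by (simp add: CVec Pi.maps_lin)
qed

lemma st_delta_free: "Pi.same_target (Phi2 (delta_free D u)) = Pi.diag (Phi u)"
proof -
  have gs: "Pi.same_target (Phi2 (prod_list (map (delta_gen D) gs))) = Pi.diag (Phi_word (FWord gs))"
    for gs :: "('v, 'k::field) generator list"
  proof (induction gs)
    case Nil
    have "Phi2 1 = pm_tensor Pi.gunit (Pi.gunit :: _ \<Rightarrow>\<^sub>0 'k)"
      unfolding single_one[symmetric] zero_prod_def
      by (simp add: Phi2_def Phi_word_def zero_fword_def)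
    then show ?case by (simp add: st_gunit_gunit Phi_word_def)
  next
    case (Cons g gs)
    have "Pi.same_target (Phi2 (prod_list (map (delta_gen D) (g # gs)))) =
      Pi.same_target (Pi.gmul2 (Phi2 (delta_gen D g)) (Phi2 (prod_list (map (delta_gen D) gs))))"
      by (simp add: Phi2_mult)
    also have "\<dots> = Pi.diag (Pi.gmul (Phi_gen g) (Phi_word (FWord gs)))"
      by (intro Pi.same_target_gmul2_grouplike Phi2_closed st_delta_gen Cons.IH Phi_gen_closed Phi_word_closed)
    finally show ?case by (simp add: Phi_word_def)
  qed
  show ?thesis
    unfolding delta_free_def
    by (rule pm_linear_eq[OF pm_linear_comp[OF pm_linear_extend pm_linear_comp[OF pm_linear_Phi2 Pi.pm_linear_maps(2)]]
        pm_linear_comp[OF pm_linear_Phi Pi.pm_linear_maps(1)]])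
      (simp add: Phi_basis gs)
qed

lemma keys_delta_free:
  fixes u :: "('v, 'k::field) free"
  assumes "u \<in> free_carrier"
  shows "Poly_Mapping.keys (delta_free D u) \<subseteq> words \<times> words"
proof -
  let ?W = "words \<times> words :: (('v, 'k) generator fword \<times> ('v, 'k) generator fword) set"
  have sum: "Poly_Mapping.keys (sum f S) \<subseteq> ?W" if "\<And>i. i \<in> S \<Longrightarrow> Poly_Mapping.keys (f i) \<subseteq> ?W" for f and S :: "('v \<times> 'v) set"
    by (rule order_trans[OF keys_sum]) (use that in blast)
  have add: "Poly_Mapping.keys (x + y) \<subseteq> ?W" if "Poly_Mapping.keys x \<subseteq> ?W" "Poly_Mapping.keys y \<subseteq> ?W" for x y :: "_ \<Rightarrow>\<^sub>0 'k"
    by (rule order_trans[OF keys_add]) (use that in blast)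
  have tensor: "Poly_Mapping.keys (pm_tensor x y) \<subseteq> ?W" if "x \<in> free_carrier" "y \<in> free_carrier" for x y
    using keys_pm_tensor[of x words y words] that by (simp add: free_carrier_iff)
  have mult: "Poly_Mapping.keys (x * y) \<subseteq> ?W" if "Poly_Mapping.keys x \<subseteq> ?W" "Poly_Mapping.keys y \<subseteq> ?W" for x y :: "_ \<Rightarrow>\<^sub>0 'k"
  proof
    fix w assume "w \<in> Poly_Mapping.keys (x * y)"
    then obtain a b where ab: "w = a + b" "a \<in> Poly_Mapping.keys x" "b \<in> Poly_Mapping.keys y"
      using keys_mult[of x y] by blast
    then have "a \<in> ?W" "b \<in> ?W" using that by blast+
    then show "w \<in> ?W" using ab words_closed(2) by (auto simp: plus_prod_def)
  qed
  have g: "Poly_Mapping.keys (delta_gen D g) \<subseteq> ?W" if g: "g \<in> generators D" for g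
  proof (cases g)
    case (Vec x)
    then have "x \<in> X1 D" using g by (auto simp: generators_def)
    then show ?thesis unfolding Vec delta_gen.simps by (intro add sum tensor) simp_all
  next
    case (CVec x)
    then have "x \<in> X1 D" using g by (auto simp: generators_def)
    then show ?thesis unfolding CVec delta_gen.simps by (intro add sum tensor) simp_all
  next
    case (Src a)
    then have "a \<in> algA D" using g by (auto simp: generators_def)
    then show ?thesis unfolding Src delta_gen.simps by (intro tensor) simp_all
  next
    case (Tgt a)
    then have "a \<in> algA D" using g by (auto simp: generators_def)
    then show ?thesis unfolding Tgt delta_gen.simps by (intro tensor) simp_all
  qed
  have one: "Poly_Mapping.keys (1 :: _ \<Rightarrow>\<^sub>0 'k) \<subseteq> ?W"
    using words_closed(1) by (simp add: zero_prod_def)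
  have gs: "Poly_Mapping.keys (prod_list (map (delta_gen D) gs)) \<subseteq> ?W" if "set gs \<subseteq> generators D" for gs
    using that by (induction gs) (use one in \<open>simp_all add: mult g del: keys_one\<close>)
  show ?thesis
    unfolding delta_free_def
    by (rule keys_pm_extend, rule gs) (use assms in \<open>auto simp: free_carrier_iff words_def\<close>)
qed

text \<open>The rule \<open>\<epsilon>(g h) = \<epsilon>(g \<epsilon>(h))\<close> in the groupoid algebra; thus the recursion for the counit of a
  word computes the counit of its image.\<close>

lemma geps_Phi_gen:
  assumes y: "Pi.on_arrows y"
  shows "Pi.geps (Pi.gmul (Phi_gen g) y) = eps_gen D g (Pi.geps y)"
proof
  fix p
  have scal: "Pi.geps (Pi.gmul (Pi.gscal a) y) p = a p * Pi.geps y p" for a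
  proof (cases "p \<in> pverts D")
    case True
    then show ?thesis using Pi.geps_gscal_gmul[OF y] by (simp add: Pi_objs)
  next
    case False
    then show ?thesis
      using Pi.geps_fun_on[OF y] Pi.geps_fun_on[OF Pi.gmul_closed[OF Pi.gscal_closed[of a] y]]
      by (simp add: fun_on_def Pi_objs)
  qed
  have idb: "Pi.geps (Pi.gmul (idb q) y) p = Pi.geps y q * bas q p" if "q \<in> pverts D" for q
    using that Pi.geps_gmul_basis[OF _ y, of "zclass q [] q"] by (simp add: idb_def zclass_arrow Pi_ends)
  have arc: "Pi.geps (Pi.gmul (fwd i) y) p = Pi.geps y (fst i) * bas (snd i) p"
     "Pi.geps (Pi.gmul (bwd i) y) p = Pi.geps y (snd i) * bas (fst i) p" if i: "i \<in> parcs D" for i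
    using arc_zigzags[OF i] Pi.geps_gmul_basis[OF zclass_arrow y]
    by (simp_all add: fwd_def bwd_def Pi_ends del: zigzag.simps)
  show "Pi.geps (Pi.gmul (Phi_gen g) y) p = eps_gen D g (Pi.geps y) p"
  proof (cases g)
    case (Vec x)
    have "Pi.geps (Pi.gmul (Phi_gen g) y) p =
      (\<Sum>i\<in>parcs D. x i * (Pi.geps y (snd i) * bas (snd i) p - Pi.geps y (fst i) * bas (snd i) p))"
      by (simp add: Vec Pi.gmul_lin Pi.geps_sum Pi.geps_scale vec_image_def Pi.geps_diff idb arc arc_zigzags)
    also have "\<dots> = eps_gen D g (Pi.geps y) p"
      unfolding Vec eps_gen.simps ev1_def
      by (intro sum.cong) (auto simp: d0_arc algebra_simps)
    finally show ?thesis .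
  next
    case (CVec x)
    have "Pi.geps (Pi.gmul (Phi_gen g) y) p =
      (\<Sum>i\<in>parcs D. x i * (Pi.geps y (snd i) * bas (fst i) p - Pi.geps y (fst i) * bas (fst i) p))"
      by (simp add: CVec Pi.gmul_lin Pi.geps_sum Pi.geps_scale cvec_image_def Pi.geps_diff idb arc arc_zigzags)
    also have "\<dots> = eps_gen D g (Pi.geps y) p"
      unfolding CVec eps_gen.simps uev1_def
      by (intro sum.cong) (auto simp: d0_arc algebra_simps)
    finally show ?thesis .
  qed (simp_all add: scal)
qed

lemma geps_Phi:
  fixes u :: "('v, 'k::field) free"
  shows "Pi.geps (Phi u) = eps_free D u"
proof
  fix p
  have unit: "Pi.geps Pi.gunit = (unitA D :: 'v \<Rightarrow> 'k)"
  proof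
    fix p
    show "Pi.geps Pi.gunit p = (unitA D p :: 'k)"
      by (simp add: gunit_idb Pi.geps_sum idb_def Pi.geps_basis Pi_ends unitA_def fun_sum_apply)
  qed
  have gs: "Pi.geps (Phi_word (FWord gs)) = foldr (eps_gen D) gs (unitA D)" for gs :: "('v, 'k) generator list"
  proof (induction gs)
    case (Cons g gs)
    then show ?case
      using geps_Phi_gen[OF Phi_word_closed[of "FWord gs"], of g] by (simp add: Phi_word_def)
  qed (simp add: Phi_word_def unit)
  have "Pi.geps (Phi_word w) = foldr (eps_gen D) (letters w) (unitA D)" for w :: "('v, 'k) generator fword"
    using gs[of "letters w"] by simp
  then show "Pi.geps (Phi u) p = eps_free D u p"
    by (simp add: Phi_def pm_extend_def Pi.geps_sum Pi.geps_scale eps_free_def)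
qed

lemma hopf_hom_Phi:
  "hopf_hom (pverts D) (free_hopf D :: ('k::field, ('v, 'k) free, 'v) hopf_algebroid) Pi.alg Phi"
  unfolding hopf_hom_def algebroid_hom_def
proof (intro conjI allI ballI)
  show "Phi \<in> ring_hom (free_hopf D) Pi.alg"
    by (rule ring_hom_memI) (simp_all add: free_simps Pi.alg_simps Phi_closed Phi_mult Phi_one Phi_lin)
next
  fix u :: "('v, 'k) free" and t assume u: "u \<in> free_carrier" and t: "t \<in> comul (free_hopf D) u"
  then have t: "t = pm_extend (\<lambda>(w, w'). pm_basis (pm_basis w, pm_basis w')) (delta_free D u)"
    by (simp add: free_simps)
  show keys: "Poly_Mapping.keys t \<subseteq> free_carrier \<times> free_carrier"
    unfolding t
  proof (rule keys_pm_extend)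
    fix ww assume "ww \<in> Poly_Mapping.keys (delta_free D u)"
    then obtain w w' where "ww = (w, w')" "w \<in> words" "w' \<in> words" using keys_delta_free[OF u] by blast
    then show "Poly_Mapping.keys (case ww of (w, w') \<Rightarrow> pm_basis (pm_basis w, pm_basis w')) \<subseteq> free_carrier \<times> free_carrier"
      by (simp add: free_carrier_iff)
  qed
  have "Pi.tensor_expand (tens Phi t) = Phi2 (delta_free D u)"
    unfolding t Phi2_def tens_def pm_extend_compose[OF pm_linear_extend] pm_extend_compose[OF Pi.pm_linear_maps(4)]
    by (rule pm_extend_cong) (auto simp: Pi.maps_basis Phi_basis)
  moreover have "Pi.tensor_expand (Pi.pair_incl x) = x" for x :: "_ \<Rightarrow>\<^sub>0 'k"
    by (rule pm_linear_eq[OF pm_linear_comp[OF Pi.pm_linear_maps(3,4)] pm_linear_id])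
      (auto simp: Pi.maps_basis)
  moreover have "Pi.same_target (Pi.diag v) = Pi.diag v" for v :: "_ \<Rightarrow>\<^sub>0 'k"
    by (rule pm_linear_eq[OF pm_linear_comp[OF Pi.pm_linear_maps(1,2)] Pi.pm_linear_maps(1)])
      (simp add: Pi.maps_basis)
  ultimately have eq: "Pi.same_target (Pi.tensor_expand (tens Phi t)) =
      Pi.same_target (Pi.tensor_expand (Pi.pair_incl (Pi.diag (Phi u))))"
    by (simp add: st_delta_free)
  have "tens Phi t - Pi.pair_incl (Pi.diag (Phi u)) \<in> Pi.alg_span"
    by (rule Pi.tensor_class_eq_alg[OF keys_tens[OF _ keys] Pi.pair_incl_diag_closed[OF Phi_closed] eq])
      (auto simp: Pi.alg_simps Phi_closed dest: subsetD[OF Phi_closed])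
  then show "tens Phi t \<in> comul Pi.alg (Phi u)"
    by (simp add: Pi.comul_alg tensor_class_def Pi_objs)
qed (simp_all add: free_simps Pi.alg_simps Phi_lin Phi_of_gen geps_Phi)

end

section \<open>Injectivity\<close>

lemma bas_apply: "bas i j = (if j = i then 1 else 0)"
  by (simp add: bas_def)

text \<open>The ideal \<open>J\<close> stands for the kernel of the projection of the free algebra onto the isotopy
  quotient of \<open>DX D ch\<close>. Congruence modulo \<open>J\<close> is equality in that quotient, which is an iterated
  quotient whose elements are sets of sets of sets; computing with congruences instead takes place in
  the ring of the free algebra.\<close>

locale isotopy_ideal = finite_digraph D for D :: "'v pair_pre_digraph" +
  fixes ch :: "'v \<Rightarrow> 'v \<Rightarrow> 'v" and J :: "('v, 'k::field) free set"
  assumes choice: "path_choice D ch"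
    and J_zero: "0 \<in> J" and J_add: "u \<in> J \<Longrightarrow> v \<in> J \<Longrightarrow> u + v \<in> J"
    and J_mult_left: "u \<in> J \<Longrightarrow> w \<in> free_carrier \<Longrightarrow> w * u \<in> J"
    and J_mult_right: "u \<in> J \<Longrightarrow> w \<in> free_carrier \<Longrightarrow> u * w \<in> J"
    and hx_J: "hx_rels D \<subseteq> J" and dx_J: "dx_rels D ch \<subseteq> J"
    and iso_J: "a \<in> algA D \<Longrightarrow> gsrc a - gtgt a \<in> J"
    and J_Phi: "u \<in> J \<Longrightarrow> Phi u = 0"
begin

definition eqv :: "('v, 'k) free \<Rightarrow> ('v, 'k) free \<Rightarrow> bool" (infix "\<approx>" 50) where
  "u \<approx> v \<longleftrightarrow> u - v \<in> J"

lemma J_scale: "u \<in> J \<Longrightarrow> pm_scale c u \<in> J"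
  using J_mult_left[of u "pm_scale c 1"] by (simp add: pm_scale_mult_left)

lemma J_uminus: "u \<in> J \<Longrightarrow> - u \<in> J"
  using J_scale[of u "- 1"] by simp

lemma eqv_refl [simp, intro]: "u \<approx> u"
  by (simp add: eqv_def J_zero)

lemma eqv_sym: "u \<approx> v \<Longrightarrow> v \<approx> u"
  using J_uminus[of "u - v"] by (simp add: eqv_def)

lemma eqv_trans [trans]: "u \<approx> v \<Longrightarrow> v \<approx> w \<Longrightarrow> u \<approx> w"
  using J_add[of "u - v" "v - w"] by (simp add: eqv_def)

lemma eqv_add: "u \<approx> u' \<Longrightarrow> v \<approx> v' \<Longrightarrow> u + v \<approx> u' + v'"
  using J_add[of "u - u'" "v - v'"] by (simp add: eqv_def algebra_simps)

lemma eqv_uminus: "u \<approx> u' \<Longrightarrow> - u \<approx> - u'"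
  using J_uminus[of "u - u'"] by (simp add: eqv_def)

lemma eqv_diff: "u \<approx> u' \<Longrightarrow> v \<approx> v' \<Longrightarrow> u - v \<approx> u' - v'"
  using eqv_add[of u u' "- v" "- v'"] eqv_uminus by simp

lemma eqv_scale: "u \<approx> u' \<Longrightarrow> pm_scale c u \<approx> pm_scale c u'"
  using J_scale[of "u - u'" c] by (simp add: eqv_def pm.scale_right_diff_distrib)

lemma eqv_left: "u \<approx> u' \<Longrightarrow> w \<in> free_carrier \<Longrightarrow> w * u \<approx> w * u'"
  using J_mult_left[of "u - u'" w] by (simp add: eqv_def algebra_simps)

lemma eqv_right: "u \<approx> u' \<Longrightarrow> w \<in> free_carrier \<Longrightarrow> u * w \<approx> u' * w"
  using J_mult_right[of "u - u'" w] by (simp add: eqv_def algebra_simps)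

lemma eqv_sum: "(\<And>i. i \<in> S \<Longrightarrow> f i \<approx> g i) \<Longrightarrow> sum f S \<approx> sum g S"
  by (induction S rule: infinite_finite_induct) (auto intro: eqv_add)

lemma hx_eqv: "u - v \<in> hx_rels D \<Longrightarrow> u \<approx> v"
  using hx_J by (auto simp: eqv_def)

lemma tgt_eqv: "a \<in> algA D \<Longrightarrow> gtgt a \<approx> gsrc a"
  using eqv_sym[of "gsrc a" "gtgt a"] iso_J by (simp add: eqv_def)

abbreviation F :: "'v \<Rightarrow> ('v, 'k) free" where "F p \<equiv> gsrc (bas p)"
abbreviation e :: "'v \<times> 'v \<Rightarrow> ('v, 'k) free" where "e i \<equiv> gvec (bas i)"
abbreviation ce :: "'v \<times> 'v \<Rightarrow> ('v, 'k) free" where "ce i \<equiv> gcvec (bas i)"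

text \<open>The elements that \<open>\<Phi>\<close> maps to the generating arrows and their inverses.\<close>

fun X :: "'v step \<Rightarrow> ('v, 'k) free" where
  "X (Fwd a b) = F b - e (a, b)"
| "X (Bwd a b) = ce (a, b) + F a"

lemma X_closed [simp]: "step_arc g \<in> parcs D \<Longrightarrow> X g \<in> free_carrier"
  using step_arc_verts[of g] by (cases g) auto

lemma src_scaled: "a \<in> algA D \<Longrightarrow> b = (\<lambda>p. c * a p) \<Longrightarrow> gsrc b \<approx> pm_scale c (gsrc a)"
  by (simp add: hx_eqv hx_rels.src_scale)

lemma vec_scaled: "x \<in> X1 D \<Longrightarrow> y = (\<lambda>p. c * x p) \<Longrightarrow> gvec y \<approx> pm_scale c (gvec x)"
  by (simp add: hx_eqv hx_rels.vec_scale)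

lemma cvec_scaled: "x \<in> X1 D \<Longrightarrow> y = (\<lambda>p. c * x p) \<Longrightarrow> gcvec y \<approx> pm_scale c (gcvec x)"
  by (simp add: hx_eqv hx_rels.cvec_scale)

lemma src_F: 
  assumes "a \<in> algA D" "p \<in> pverts D"
  shows "gsrc a * F p \<approx> pm_scale (a p) (F p)"
proof -
  have "gsrc a * F p \<approx> gsrc (a * bas p)"
    by (rule hx_eqv, rule hx_rels.src_mult) (use assms in auto)
  also have "\<dots> \<approx> pm_scale (a p) (F p)"
    by (rule src_scaled) (use assms in \<open>auto simp: bas_apply fun_eq_iff\<close>)
  finally show ?thesis .
qed

lemma arc_facts:
  assumes "i \<in> parcs D"
  shows "fst i \<in> pverts D" "snd i \<in> pverts D" "fst i \<noteq> snd i"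
  using arc_zigzags[OF assms] by auto

lemma ev_bas:
  assumes i: "i \<in> parcs D"
  shows "ev1 D (bas i) (d0 D a) = (\<lambda>p. (a (snd i) - a (fst i)) * (bas (snd i) p :: 'k))"
    and "uev1 D (d0 D a) (bas i) = (\<lambda>p. (a (snd i) - a (fst i)) * (bas (fst i) p :: 'k))"
proof -
  have "ev1 D (bas i) (d0 D a) p = (\<Sum>j\<in>parcs D. if j = i then d0 D a i * bas (snd i) p else 0)" for p
    unfolding ev1_def by (rule sum.cong) (auto simp: bas_apply)
  then show "ev1 D (bas i) (d0 D a) = (\<lambda>p. (a (snd i) - a (fst i)) * (bas (snd i) p :: 'k))"
    using finite_arcs i by (simp add: d0_arc fun_eq_iff)
  have "uev1 D (d0 D a) (bas i) p = (\<Sum>j\<in>parcs D. if j = i then d0 D a i * bas (fst i) p else 0)" for p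
    unfolding uev1_def by (rule sum.cong) (auto simp: bas_apply)
  then show "uev1 D (d0 D a) (bas i) = (\<lambda>p. (a (snd i) - a (fst i)) * (bas (fst i) p :: 'k))"
    using finite_arcs i by (simp add: d0_arc fun_eq_iff)
qed

lemma src_e:
  assumes a: "a \<in> algA D" and i: "i \<in> parcs D"
  shows "gsrc a * e i \<approx> pm_scale (a (snd i)) (e i)"
    and "e i * gsrc a \<approx> pm_scale (a (fst i)) (e i) + pm_scale (a (snd i) - a (fst i)) (F (snd i))"
proof -
  have "gsrc a * e i \<approx> gvec (X_lact a (bas i))"
    by (rule hx_eqv, rule hx_rels.src_vec) (use assms in auto)
  also have "\<dots> \<approx> pm_scale (a (snd i)) (e i)"
    by (rule vec_scaled) (use i in \<open>auto simp: X_lact_def bas_apply fun_eq_iff\<close>)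
  finally show "gsrc a * e i \<approx> pm_scale (a (snd i)) (e i)" .
  have "e i * gsrc a \<approx> gvec (X_ract (bas i) a) + gsrc (ev1 D (bas i) (d0 D a))"
    by (rule hx_eqv, rule hx_rels.vec_src) (use assms in auto)
  also have "\<dots> \<approx> pm_scale (a (fst i)) (e i) + pm_scale (a (snd i) - a (fst i)) (F (snd i))"
    by (intro eqv_add vec_scaled src_scaled ev_bas)
      (use i arc_facts in \<open>auto simp: X_ract_def bas_apply fun_eq_iff\<close>)
  finally show "e i * gsrc a \<approx> pm_scale (a (fst i)) (e i) + pm_scale (a (snd i) - a (fst i)) (F (snd i))" .
qed

lemma src_ce:
  assumes a: "a \<in> algA D" and i: "i \<in> parcs D"
  shows "gsrc a * ce i \<approx> pm_scale (a (fst i)) (ce i)"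
    and "ce i * gsrc a \<approx> pm_scale (a (snd i)) (ce i) + pm_scale (a (snd i) - a (fst i)) (F (fst i))"
proof -
  have "gsrc a * ce i \<approx> gtgt a * ce i"
    by (rule eqv_right[OF eqv_sym[OF tgt_eqv[OF a]]]) (use i in simp)
  also have "\<dots> \<approx> gcvec (X_ract (bas i) a)"
    by (rule hx_eqv, rule hx_rels.tgt_cvec) (use assms in auto)
  also have "\<dots> \<approx> pm_scale (a (fst i)) (ce i)"
    by (rule cvec_scaled) (use i in \<open>auto simp: X_ract_def bas_apply fun_eq_iff\<close>)
  finally show "gsrc a * ce i \<approx> pm_scale (a (fst i)) (ce i)" .
  have "ce i * gsrc a \<approx> ce i * gtgt a"
    by (rule eqv_left[OF eqv_sym[OF tgt_eqv[OF a]]]) (use i in simp)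
  also have "\<dots> \<approx> gcvec (X_lact a (bas i)) + gtgt (uev1 D (d0 D a) (bas i))"
    by (rule hx_eqv, rule hx_rels.cvec_tgt) (use assms in auto)
  also have "\<dots> \<approx> gcvec (X_lact a (bas i)) + gsrc (uev1 D (d0 D a) (bas i))"
    by (intro eqv_add eqv_refl tgt_eqv) simp
  also have "\<dots> \<approx> pm_scale (a (snd i)) (ce i) + pm_scale (a (snd i) - a (fst i)) (F (fst i))"
    by (intro eqv_add cvec_scaled src_scaled ev_bas)
      (use i arc_facts in \<open>auto simp: X_lact_def bas_apply fun_eq_iff\<close>)
  finally show "ce i * gsrc a \<approx> pm_scale (a (snd i)) (ce i) + pm_scale (a (snd i) - a (fst i)) (F (fst i))" .
qed

text \<open>Functions act on \<open>X g\<close> as on an arrow from \<open>step_src g\<close> to \<open>step_tgt g\<close>.\<close>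

lemma src_X:
  assumes a: "a \<in> algA D" and g: "step_arc g \<in> parcs D"
  shows "gsrc a * X g \<approx> pm_scale (a (step_tgt g)) (X g)"
    and "X g * gsrc a \<approx> pm_scale (a (step_src g)) (X g)"
proof -
  have F_src: "F p * gsrc a \<approx> pm_scale (a p) (F p)" if p: "p \<in> pverts D" for p
  proof -
    have "F p * gsrc a \<approx> gsrc (bas p * a)"
      by (rule hx_eqv, rule hx_rels.src_mult) (use a p in auto)
    also have "\<dots> \<approx> pm_scale (a p) (F p)"
      by (rule src_scaled) (use a p in \<open>auto simp: bas_apply fun_eq_iff\<close>)
    finally show ?thesis .
  qed
  have "gsrc a * X g \<approx> pm_scale (a (step_tgt g)) (X g) \<and> X g * gsrc a \<approx> pm_scale (a (step_src g)) (X g)"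
  proof (cases g)
    case (Fwd p q)
    then have pq: "(p, q) \<in> parcs D" and q: "q \<in> pverts D" using g arc_verts by auto
    have "gsrc a * F q - gsrc a * e (p, q) \<approx> pm_scale (a q) (F q) - pm_scale (a q) (e (p, q))"
      using eqv_diff[OF src_F[OF a q] src_e(1)[OF a pq]] by simp
    moreover have "F q * gsrc a - e (p, q) * gsrc a \<approx> pm_scale (a q) (F q) -
        (pm_scale (a p) (e (p, q)) + pm_scale (a q - a p) (F q))"
      using eqv_diff[OF F_src[OF q] src_e(2)[OF a pq]] by simp
    ultimately show ?thesis
      by (simp add: Fwd algebra_simps pm.scale_right_diff_distrib pm.scale_left_diff_distrib)
  next
    case (Bwd p q)
    then have pq: "(p, q) \<in> parcs D" and p: "p \<in> pverts D" using g arc_verts by auto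
    have "gsrc a * ce (p, q) + gsrc a * F p \<approx> pm_scale (a p) (ce (p, q)) + pm_scale (a p) (F p)"
      using eqv_add[OF src_ce(1)[OF a pq] src_F[OF a p]] by simp
    moreover have "ce (p, q) * gsrc a + F p * gsrc a \<approx>
        pm_scale (a q) (ce (p, q)) + pm_scale (a q - a p) (F p) + pm_scale (a p) (F p)"
      using eqv_add[OF src_ce(2)[OF a pq] F_src[OF p]] by simp
    ultimately show ?thesis
      by (simp add: Bwd algebra_simps pm.scale_right_distrib pm.scale_left_diff_distrib)
  qed
  then show "gsrc a * X g \<approx> pm_scale (a (step_tgt g)) (X g)" "X g * gsrc a \<approx> pm_scale (a (step_src g)) (X g)"
    by auto
qed

lemma F_F: "p \<in> pverts D \<Longrightarrow> q \<in> pverts D \<Longrightarrow> F p * F q \<approx> (if p = q then F q else 0)"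
  using src_F[of "bas p" q] by (auto simp: bas_apply split: if_splits)

lemma F_X:
  assumes "p \<in> pverts D" "step_arc g \<in> parcs D"
  shows "F p * X g \<approx> (if p = step_tgt g then X g else 0)" "X g * F p \<approx> (if p = step_src g then X g else 0)"
  using src_X[of "bas p" g] assms by (auto simp: bas_apply split: if_splits)

lemma F_e:
  assumes "p \<in> pverts D" "i \<in> parcs D"
  shows "F p * e i \<approx> (if p = snd i then e i else 0)" "F p * ce i \<approx> (if p = fst i then ce i else 0)"
  using src_e(1)[of "bas p" i] src_ce(1)[of "bas p" i] assms by (auto simp: bas_apply split: if_splits)

abbreviation XF :: "'v \<times> 'v \<Rightarrow> ('v, 'k) free" where "XF i \<equiv> X (Fwd (fst i) (snd i))"
abbreviation XB :: "'v \<times> 'v \<Rightarrow> ('v, 'k) free" where "XB i \<equiv> X (Bwd (fst i) (snd i))"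

lemma cmt_e:
  assumes a: "a \<in> algA D" and i: "i \<in> parcs D"
  shows "cmt (e i) (gtgt a) \<approx> pm_scale (a (snd i) - a (fst i)) (XF i)"
    and "cmt (ce i) (gsrc a) \<approx> pm_scale (a (snd i) - a (fst i)) (XB i)"
proof -
  have "cmt (e i) (gtgt a) \<approx> e i * gsrc a - gsrc a * e i"
    unfolding cmt_def using i by (intro eqv_diff eqv_left eqv_right tgt_eqv a) simp_all
  also have "\<dots> \<approx> pm_scale (a (fst i)) (e i) + pm_scale (a (snd i) - a (fst i)) (F (snd i)) - pm_scale (a (snd i)) (e i)"
    by (intro eqv_diff src_e a i)
  also have "\<dots> = pm_scale (a (snd i) - a (fst i)) (XF i)"
    by (simp add: algebra_simps pm.scale_right_diff_distrib pm.scale_left_diff_distrib)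
  finally show "cmt (e i) (gtgt a) \<approx> pm_scale (a (snd i) - a (fst i)) (XF i)" .
  have "cmt (ce i) (gsrc a) \<approx> pm_scale (a (snd i)) (ce i) + pm_scale (a (snd i) - a (fst i)) (F (fst i)) - pm_scale (a (fst i)) (ce i)"
    unfolding cmt_def by (intro eqv_diff src_ce a i)
  also have "\<dots> = pm_scale (a (snd i) - a (fst i)) (XB i)"
    by (simp add: algebra_simps pm.scale_right_distrib pm.scale_left_diff_distrib)
  finally show "cmt (ce i) (gsrc a) \<approx> pm_scale (a (snd i) - a (fst i)) (XB i)" .
qed

lemma XB_e:
  assumes "i \<in> parcs D" "j \<in> parcs D"
  shows "snd i \<noteq> snd j \<Longrightarrow> XB j * e i \<approx> 0" "fst i \<noteq> fst j \<Longrightarrow> XF j * ce i \<approx> 0"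
proof -
  note v = arc_facts[OF assms(1)] arc_facts[OF assms(2)]
  assume ne: "snd i \<noteq> snd j"
  have "XB j * e i \<approx> XB j * F (snd j) * e i"
    by (rule eqv_right[OF eqv_sym]) (use F_X(2)[of "snd j" "Bwd (fst j) (snd j)"] v assms in auto)
  also have "\<dots> = XB j * (F (snd j) * e i)" by (simp add: mult.assoc)
  also have "\<dots> \<approx> XB j * 0"
    by (rule eqv_left) (use F_e(1)[of "snd j" i] ne v assms in \<open>auto split: if_splits\<close>)
  finally show "XB j * e i \<approx> 0" by simp
next
  note v = arc_facts[OF assms(1)] arc_facts[OF assms(2)]
  assume ne: "fst i \<noteq> fst j"
  have "XF j * ce i \<approx> XF j * F (fst j) * ce i"
    by (rule eqv_right[OF eqv_sym]) (use F_X(2)[of "fst j" "Fwd (fst j) (snd j)"] v assms in auto)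
  also have "\<dots> = XF j * (F (fst j) * ce i)" by (simp add: mult.assoc)
  also have "\<dots> \<approx> XF j * 0"
    by (rule eqv_left) (use F_e(2)[of "fst j" i] ne v assms in \<open>auto split: if_splits\<close>)
  finally show "XF j * ce i \<approx> 0" by simp
qed

text \<open>Let \<open>E\<close> and \<open>E'\<close> be \<open>XF j\<close> and \<open>XB j\<close>, for an arc \<open>j\<close> from \<open>p\<close> to \<open>q\<close>, and \<open>e = f\<^sub>q - E\<close> and
  \<open>e' = E' - f\<^sub>p\<close> the corresponding vectors. The relation that expresses \<open>e'\<close> by coevaluation collapses
  to \<open>e' = E' e\<close>, that is, \<open>E' - f\<^sub>p = E' - E' E\<close>. In the same way \<open>e = E e'\<close> gives \<open>E E' = f\<^sub>q\<close> below.\<close>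

lemma XB_XF:
  assumes j: "j \<in> parcs D"
  shows "XB j * XF j \<approx> F (fst j)"
proof -
  note v = arc_facts[OF j]
  \<comment> \<open>The products that vanish modulo \<open>J\<close> are set to \<open>0\<close>, because \<open>coev_b_sum\<close> is about equality.\<close>
  let ?G = "\<lambda>i. if snd i = snd j then XB j * e i else 0"
  have "ce j \<approx> (\<Sum>i\<in>parcs D. cmt (ce j) (gsrc (coev_b i)) * e i)"
    by (rule eqv_sym, rule hx_eqv, rule hx_rels.cvec_coev) (use j in simp)
  also have "\<dots> \<approx> (\<Sum>i\<in>parcs D. pm_scale (coev_b i (snd j) - coev_b i (fst j)) (?G i))"
  proof (rule eqv_sum)
    fix i assume i: "i \<in> parcs D"
    have "cmt (ce j) (gsrc (coev_b i)) * e i \<approx> pm_scale (coev_b i (snd j) - coev_b i (fst j)) (XB j) * e i"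
      using i j by (intro eqv_right cmt_e) simp_all
    also have "\<dots> \<approx> pm_scale (coev_b i (snd j) - coev_b i (fst j)) (?G i)"
      unfolding pm_scale_mult_left using XB_e(1)[OF i j] by (intro eqv_scale) auto
    finally show "cmt (ce j) (gsrc (coev_b i)) * e i \<approx> pm_scale (coev_b i (snd j) - coev_b i (fst j)) (?G i)" .
  qed
  also have "\<dots> = ?G j" by (rule coev_b_sum[OF j]) simp
  finally have 1: "ce j \<approx> XB j * e j" by simp
  have "XB j * XF j = XB j * F (snd j) - XB j * e j" by (simp add: algebra_simps)
  also have "\<dots> \<approx> XB j - ce j"
    using F_X(2)[of "snd j" "Bwd (fst j) (snd j)"] v j 1 by (intro eqv_diff eqv_sym[OF 1]) simp
  finally show ?thesis by simp
qed

lemma XF_XB: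
  assumes j: "j \<in> parcs D"
  shows "XF j * XB j \<approx> F (snd j)"
proof -
  note v = arc_facts[OF j]
  let ?G = "\<lambda>i. if fst i = fst j then XF j * ce i else 0"
  have "e j \<approx> (\<Sum>i\<in>parcs D. cmt (e j) (gtgt (coev_c i)) * ce i)"
    by (rule eqv_sym, rule hx_eqv, rule hx_rels.vec_coev) (use j in simp)
  also have "\<dots> \<approx> (\<Sum>i\<in>parcs D. pm_scale (coev_c i (snd j) - coev_c i (fst j)) (?G i))"
  proof (rule eqv_sum)
    fix i assume i: "i \<in> parcs D"
    have "cmt (e j) (gtgt (coev_c i)) * ce i \<approx> pm_scale (coev_c i (snd j) - coev_c i (fst j)) (XF j) * ce i"
      using i j by (intro eqv_right cmt_e) simp_all
    also have "\<dots> \<approx> pm_scale (coev_c i (snd j) - coev_c i (fst j)) (?G i)"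
      unfolding pm_scale_mult_left using XB_e(2)[OF i j] by (intro eqv_scale) auto
    finally show "cmt (e j) (gtgt (coev_c i)) * ce i \<approx> pm_scale (coev_c i (snd j) - coev_c i (fst j)) (?G i)" .
  qed
  also have "\<dots> = ?G j" by (rule coev_c_sum[OF j]) simp
  finally have 1: "e j \<approx> XF j * ce j" by simp
  have "XF j * XB j = XF j * ce j + XF j * F (fst j)" by (simp add: algebra_simps)
  also have "\<dots> \<approx> e j + XF j"
    using F_X(2)[of "fst j" "Fwd (fst j) (snd j)"] v j 1 by (intro eqv_add eqv_sym[OF 1]) simp
  finally show ?thesis by simp
qed

lemma X_inv:
  assumes "step_arc g \<in> parcs D"
  shows "X g * X (step_inv g) \<approx> F (step_tgt g)"
proof (cases g)
  case (Fwd a b)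
  then show ?thesis using assms XF_XB[of "(a, b)"] by simp
next
  case (Bwd a b)
  then show ?thesis using assms XB_XF[of "(a, b)"] by simp
qed

text \<open>The remaining terms \<open>f\<^sub>r f\<^sub>q\<close> and \<open>f\<^sub>r XF (p, q)\<close> of the product vanish, as \<open>q \<noteq> r\<close>.\<close>

lemma e_e:
  assumes "(p, q) \<in> parcs D" "(q, r) \<in> parcs D"
  shows "e (q, r) * e (p, q) \<approx> XF (q, r) * XF (p, q) - XF (q, r)"
proof -
  note v = arc_verts[OF assms(1)] arc_verts[OF assms(2)] arc_neq[OF assms(2)]
  have "e (q, r) * e (p, q) = (F r - XF (q, r)) * (F q - XF (p, q))" by simp
  also have "\<dots> = F r * F q - F r * XF (p, q) - XF (q, r) * F q + XF (q, r) * XF (p, q)"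
    by (simp add: algebra_simps)
  also have "\<dots> \<approx> 0 - 0 - XF (q, r) + XF (q, r) * XF (p, q)"
    using F_F[of r q] F_X(1)[of r "Fwd p q"] F_X(2)[of q "Fwd q r"] v assms
    by (intro eqv_add eqv_diff eqv_refl) auto
  finally show ?thesis by (simp add: algebra_simps)
qed

text \<open>The curvature relation for \<open>\<xi>\<close> dual to the path \<open>p \<rightarrow> q \<rightarrow> r\<close>.\<close>

lemma curvature_eqv:
  assumes b: "(p, q, r) \<in> basis2 D ch"
  shows "e (q, r) - (if (p, r) \<in> parcs D then e (p, r) else e (ch p r, r)) \<approx>
    e (q, r) * e (p, q) - (if (p, r) \<in> parcs D then 0 else e (ch p r, r) * e (p, ch p r))"
proof -
  note arcs = basis2_arcs[OF choice b]
  have r: "r \<in> pverts D" using arc_verts arcs(2) by blast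
  have bX: "bas (p, q, r) \<in> X2 D ch" using b by (auto simp: X2_def fun_on_def bas_apply)
  have ev: "gsrc (ev2 D ch (bas (p, q, r)) \<sigma>) \<approx> pm_scale (\<sigma> (p, q, r)) (F r)" for \<sigma> :: "_ \<Rightarrow> 'k"
  proof (rule src_scaled)
    have "ev2 D ch (bas (p, q, r)) \<sigma> v = (\<Sum>t\<in>basis2 D ch. if t = (p, q, r) then \<sigma> (p, q, r) * bas r v else 0)" for v
      unfolding ev2_def by (rule sum.cong) (auto simp: bas_apply split: if_splits)
    then show "ev2 D ch (bas (p, q, r)) \<sigma> = (\<lambda>v. \<sigma> (p, q, r) * bas r v)"
      using finite_basis2 b by (simp add: fun_eq_iff)
  qed (use r in simp)
  have ev_e: "gsrc (ev2 D ch (bas (p, q, r)) \<sigma>) * e i \<approx> pm_scale (\<sigma> (p, q, r)) (if snd i = r then e i else 0)"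
    if i: "i \<in> parcs D" for \<sigma> :: "_ \<Rightarrow> 'k" and i
  proof -
    have "gsrc (ev2 D ch (bas (p, q, r)) \<sigma>) * e i \<approx> pm_scale (\<sigma> (p, q, r)) (F r) * e i"
      using i by (intro eqv_right ev) simp
    also have "\<dots> \<approx> pm_scale (\<sigma> (p, q, r)) (if snd i = r then e i else 0)"
      unfolding pm_scale_mult_left using F_e(1)[OF r i] by (intro eqv_scale) auto
    finally show ?thesis .
  qed
  have "(\<Sum>i\<in>parcs D. gsrc (ev2 D ch (bas (p, q, r)) (d1_bas D ch i)) * e i) \<approx>
    (\<Sum>i\<in>parcs D. pm_scale (d1_bas D ch i (p, q, r)) (if snd i = r then e i else 0))"
    by (intro eqv_sum ev_e)
  also have "\<dots> = e (q, r) - (if (p, r) \<in> parcs D then e (p, r) else e (ch p r, r))"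
    by (subst d1_sum[OF choice b]) auto
  finally have 1: "(\<Sum>i\<in>parcs D. gsrc (ev2 D ch (bas (p, q, r)) (d1_bas D ch i)) * e i) \<approx>
     e (q, r) - (if (p, r) \<in> parcs D then e (p, r) else e (ch p r, r))" .
  have "(\<Sum>j\<in>parcs D. \<Sum>k\<in>parcs D. gsrc (ev2 D ch (bas (p, q, r)) (wedge D ch (bas j) (bas k))) * e k * e j) \<approx>
    (\<Sum>j\<in>parcs D. \<Sum>k\<in>parcs D. pm_scale (wedge D ch (bas j) (bas k) (p, q, r)) (if snd k = r then e k else 0) * e j)"
    by (intro eqv_sum eqv_right ev_e) simp_all
  also have "\<dots> = (\<Sum>j\<in>parcs D. \<Sum>k\<in>parcs D. pm_scale (wedge D ch (bas j) (bas k) (p, q, r)) ((if snd k = r then e k else 0) * e j))"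
    by (simp add: pm_scale_mult_left)
  also have "\<dots> = e (q, r) * e (p, q) - (if (p, r) \<in> parcs D then 0 else e (ch p r, r) * e (p, ch p r))"
    by (subst wedge_sum[OF choice b]) auto
  finally have 2: "(\<Sum>j\<in>parcs D. \<Sum>k\<in>parcs D. gsrc (ev2 D ch (bas (p, q, r)) (wedge D ch (bas j) (bas k))) * e k * e j) \<approx>
     e (q, r) * e (p, q) - (if (p, r) \<in> parcs D then 0 else e (ch p r, r) * e (p, ch p r))" .
  have 3: "(\<Sum>i\<in>parcs D. gsrc (ev2 D ch (bas (p, q, r)) (d1_bas D ch i)) * e i) \<approx>
    (\<Sum>j\<in>parcs D. \<Sum>k\<in>parcs D. gsrc (ev2 D ch (bas (p, q, r)) (wedge D ch (bas j) (bas k))) * e k * e j)"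
    unfolding eqv_def by (rule subsetD[OF dx_J], rule dx_rels.curvature[OF bX])
  show ?thesis by (rule eqv_trans[OF eqv_sym[OF 1] eqv_trans[OF 3 2]])
qed

lemma X_triangle:
  assumes "(p, q) \<in> parcs D" "(q, r) \<in> parcs D" "(p, r) \<in> parcs D"
  shows "XF (q, r) * XF (p, q) \<approx> XF (p, r)"
proof -
  have b: "(p, q, r) \<in> basis2 D ch" using assms by (auto simp: basis2_def paths2_def)
  have "e (q, r) - e (p, r) \<approx> XF (q, r) * XF (p, q) - XF (q, r)"
    using eqv_trans[OF curvature_eqv[OF b]] e_e[OF assms(1,2)] assms(3) by simp
  then have "XF (q, r) * XF (p, q) - XF (q, r) + XF (q, r) \<approx> e (q, r) - e (p, r) + XF (q, r)"
    by (rule eqv_add[OF eqv_sym eqv_refl])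
  then show ?thesis by (simp add: algebra_simps)
qed

lemma X_chosen:
  assumes "(p, q) \<in> parcs D" "(q, r) \<in> parcs D" "(p, r) \<notin> parcs D"
  shows "XF (q, r) * XF (p, q) \<approx> XF (ch p r, r) * XF (p, ch p r)"
proof (cases "q = ch p r")
  case False
  have b: "(p, q, r) \<in> basis2 D ch" using assms False by (auto simp: basis2_def paths2_def)
  note arcs = basis2_arcs[OF choice b]
  have "e (q, r) - e (ch p r, r) \<approx> e (q, r) * e (p, q) - e (ch p r, r) * e (p, ch p r)"
    using curvature_eqv[OF b] assms(3) by simp
  also have "\<dots> \<approx> (XF (q, r) * XF (p, q) - XF (q, r)) - (XF (ch p r, r) * XF (p, ch p r) - XF (ch p r, r))"
    by (intro eqv_diff e_e assms arcs)
  finally have "e (q, r) - e (ch p r, r) \<approx>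
    (XF (q, r) * XF (p, q) - XF (q, r)) - (XF (ch p r, r) * XF (p, ch p r) - XF (ch p r, r))" .
  then have "e (q, r) - e (ch p r, r) - ((XF (q, r) * XF (p, q) - XF (q, r)) - (XF (ch p r, r) * XF (p, ch p r) - XF (ch p r, r))) \<in> J"
    by (simp only: eqv_def)
  then have "XF (ch p r, r) * XF (p, ch p r) \<approx> XF (q, r) * XF (p, q)"
    unfolding eqv_def by (simp add: algebra_simps)
  then show ?thesis by (rule eqv_sym)
qed simp

lemma X_square:
  assumes "(p, q) \<in> parcs D" "(q, r) \<in> parcs D" "(p, q') \<in> parcs D" "(q', r) \<in> parcs D"
  shows "XF (q, r) * XF (p, q) \<approx> XF (q', r) * XF (p, q')"
proof (cases "(p, r) \<in> parcs D")
  case True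
  then show ?thesis using eqv_trans[OF X_triangle eqv_sym[OF X_triangle]] assms by blast
next
  case False
  then show ?thesis using eqv_trans[OF X_chosen eqv_sym[OF X_chosen]] assms by blast
qed

definition Xw :: "'v step list \<Rightarrow> ('v, 'k) free" where
  "Xw w = prod_list (map X w)"

lemma Xw_simps [simp]: "Xw [] = 1" "Xw (g # w) = X g * Xw w" "Xw (u @ v) = Xw u * Xw v"
  by (simp_all add: Xw_def)

text \<open>The element of the free algebra that represents a zigzag; the factor \<open>F t\<close> makes the empty
  zigzag at \<open>t\<close> represent \<open>f\<^sub>t\<close>.\<close>

definition Z :: "'v \<times> 'v step list \<times> 'v \<Rightarrow> ('v, 'k) free" where
  "Z z = F (fst z) * Xw (fst (snd z))"

lemma Xw_closed: "zigzag D t w s \<Longrightarrow> Xw w \<in> free_carrier"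
  by (induction w arbitrary: t) auto

lemma Z_closed: "z \<in> zigzags D \<Longrightarrow> Z z \<in> free_carrier"
  using Xw_closed zigzag_verts by (auto simp: Z_def zigzags_def) 

lemma F_Xw:
  assumes "zigzag D t w s"
  shows "F t * Xw w \<approx> Xw w * F s"
  using assms
proof (induction w arbitrary: t)
  case (Cons g w)
  then have g: "step_arc g \<in> parcs D" "step_tgt g = t" and w: "zigzag D (step_src g) w s" by auto
  note v = step_arc_verts[OF g(1)]
  note c = Xw_closed[OF w]
  have "F t * Xw (g # w) = F t * X g * Xw w" by (simp add: mult.assoc)
  also have "\<dots> \<approx> X g * Xw w"
    by (rule eqv_right[OF _ c]) (use F_X(1)[OF v(2) g(1)] g in simp)
  also have "\<dots> \<approx> X g * F (step_src g) * Xw w"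
    by (rule eqv_right[OF eqv_sym c]) (use F_X(2)[OF v(1) g(1)] in simp)
  also have "\<dots> = X g * (F (step_src g) * Xw w)" by (simp add: mult.assoc)
  also have "\<dots> \<approx> X g * (Xw w * F s)" by (rule eqv_left[OF Cons.IH[OF w]]) (use g in simp)
  also have "\<dots> = Xw (g # w) * F s" by (simp add: mult.assoc)
  finally show ?case .
qed auto

lemma Xw_rel: "(l, r) \<in> pi_rels D \<Longrightarrow> Xw l \<approx> Xw r"
  by (cases rule: pi_rels.cases) (use X_triangle X_square in auto)

lemma Z_eqv: "(x, y) \<in> zigzag_eq D (pi_rels D) \<Longrightarrow> Z x \<approx> Z y"
proof (induction rule: zigzag_eq.induct)
  case (sym x y)
  from sym.IH show ?case by (rule eqv_sym)
next
  case (trans x y z)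
  then show ?case using eqv_trans by blast
next
  case (cancel t u g v s)
  then have zz: "zigzag D t (u @ [g, step_inv g] @ v) s" by (simp add: zigzags_def)
  then have u: "zigzag D t u (step_tgt g)" and g: "step_arc g \<in> parcs D" and v: "zigzag D (step_tgt g) v s"
    by (auto simp: zigzag_append)
  note c = Xw_closed[OF u] Xw_closed[OF v]
  have t: "t \<in> pverts D" "step_tgt g \<in> pverts D" using zigzag_verts[OF u] by auto
  have "Z (t, u @ [g, step_inv g] @ v, s) = F t * Xw u * (X g * X (step_inv g)) * Xw v"
    by (simp add: Z_def mult.assoc)
  also have "\<dots> \<approx> F t * Xw u * F (step_tgt g) * Xw v"
    by (intro eqv_right eqv_left X_inv g c) (use t c in simp)
  also have "\<dots> = F t * (Xw u * F (step_tgt g)) * Xw v" by (simp add: mult.assoc)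
  also have "\<dots> \<approx> F t * (F t * Xw u) * Xw v"
    by (intro eqv_right eqv_left c eqv_sym[OF F_Xw[OF u]]) (use t in simp)
  also have "\<dots> = F t * F t * (Xw u * Xw v)" by (simp add: mult.assoc)
  also have "\<dots> \<approx> F t * (Xw u * Xw v)"
    by (rule eqv_right) (use F_F[OF t(1) t(1)] c in simp_all)
  also have "\<dots> = Z (t, u @ v, s)" by (simp add: Z_def)
  finally show ?case .
next
  case (rel l r t u v s)
  have zz: "zigzag D t (u @ l @ v) s" using rel by (simp add: zigzags_def)
  then obtain m m' where u: "zigzag D t u m" and v: "zigzag D m' v s" by (auto simp: zigzag_append)
  note c = Xw_closed[OF u] Xw_closed[OF v]
  have t: "t \<in> pverts D" using zigzag_verts[OF u] by auto
  have "Z (t, u @ l @ v, s) = F t * Xw u * Xw l * Xw v" by (simp add: Z_def mult.assoc)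
  also have "\<dots> \<approx> F t * Xw u * Xw r * Xw v"
    by (intro eqv_right eqv_left Xw_rel rel c) (use t c in simp)
  also have "\<dots> = Z (t, u @ r @ v, s)" by (simp add: Z_def mult.assoc)
  finally show ?case .
qed simp

text \<open>The span of the zigzags modulo \<open>J\<close>. It is shown to be everything by showing that it contains
  \<open>1\<close> and is stable under left multiplication by generators.\<close>

definition L :: "('v, 'k) free set" where
  "L = {u. \<exists>c. Poly_Mapping.keys c \<subseteq> zigzags D \<and> u \<approx> pm_extend Z c}"

lemma L_eqv: "u \<approx> v \<Longrightarrow> v \<in> L \<Longrightarrow> u \<in> L"
  unfolding L_def using eqv_trans by blast

lemma L_subspace: "pm.subspace L"
  unfolding pm.subspace_def
proof (intro conjI ballI allI)
  show "0 \<in> L" unfolding L_def by (auto intro!: exI[of _ 0] simp: pm_extend_lin)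
next
  fix u v assume "u \<in> L" "v \<in> L"
  then obtain c d where "Poly_Mapping.keys c \<subseteq> zigzags D" "u \<approx> pm_extend Z c"
    "Poly_Mapping.keys d \<subseteq> zigzags D" "v \<approx> pm_extend Z d" by (auto simp: L_def)
  then have "Poly_Mapping.keys (c + d) \<subseteq> zigzags D" "u + v \<approx> pm_extend Z (c + d)"
    using order_trans[OF keys_add[of c d]] by (auto simp: pm_extend_lin intro: eqv_add)
  then show "u + v \<in> L" by (auto simp: L_def)
next
  fix k u assume "u \<in> L"
  then obtain c where "Poly_Mapping.keys c \<subseteq> zigzags D" "u \<approx> pm_extend Z c" by (auto simp: L_def)
  then have "Poly_Mapping.keys (pm_scale k c) \<subseteq> zigzags D" "pm_scale k u \<approx> pm_extend Z (pm_scale k c)"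
    using order_trans[OF keys_pm_scale[of k c]] by (simp_all add: pm_extend_lin eqv_scale)
  then show "pm_scale k u \<in> L" by (auto simp: L_def)
qed

lemma L_Z: "z \<in> zigzags D \<Longrightarrow> Z z \<in> L"
  unfolding L_def by (auto intro!: exI[of _ "pm_basis z"])

lemma vec_expand:
  assumes x: "x \<in> X1 D"
  shows "gvec x \<approx> (\<Sum>i\<in>parcs D. pm_scale (x i) (e i))" "gcvec x \<approx> (\<Sum>i\<in>parcs D. pm_scale (x i) (ce i))"
proof -
  have fin: "(\<Sum>i\<in>S. (\<lambda>j. x i * bas i j)) \<in> X1 D \<and>
     gvec (\<Sum>i\<in>S. (\<lambda>j. x i * bas i j)) \<approx> (\<Sum>i\<in>S. pm_scale (x i) (e i)) \<and>
     gcvec (\<Sum>i\<in>S. (\<lambda>j. x i * bas i j)) \<approx> (\<Sum>i\<in>S. pm_scale (x i) (ce i))"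
    if "finite S" "S \<subseteq> parcs D" for S
    using that
  proof (induction S)
    case empty
    have z: "(0 :: 'v \<times> 'v \<Rightarrow> 'k) \<in> X1 D" by (simp add: X1_def fun_on_def)
    have "gvec 0 \<approx> pm_scale 0 (gvec (0 :: 'v \<times> 'v \<Rightarrow> 'k))" "gcvec 0 \<approx> pm_scale 0 (gcvec (0 :: 'v \<times> 'v \<Rightarrow> 'k))"
      by (rule vec_scaled[OF z] cvec_scaled[OF z], simp add: fun_eq_iff)+
    with z show ?case by (simp only: sum.empty pm.scale_zero_left simp_thms)
  next
    case (insert i S)
    then have i: "bas i \<in> X1 D" "(\<lambda>j. x i * bas i j) \<in> X1 D" by auto
    let ?y = "\<Sum>i\<in>S. (\<lambda>j. x i * bas i j)"
    have "gvec ((\<lambda>j. x i * bas i j) + ?y) \<approx> gvec (\<lambda>j. x i * bas i j) + gvec ?y"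
      by (rule hx_eqv, rule hx_rels.vec_add) (use i insert in auto)
    also have "\<dots> \<approx> pm_scale (x i) (e i) + (\<Sum>i\<in>S. pm_scale (x i) (e i))"
      using insert by (intro eqv_add vec_scaled i HOL.refl) auto
    finally have 1: "gvec ((\<lambda>j. x i * bas i j) + ?y) \<approx> pm_scale (x i) (e i) + (\<Sum>i\<in>S. pm_scale (x i) (e i))" .
    have "gcvec ((\<lambda>j. x i * bas i j) + ?y) \<approx> gcvec (\<lambda>j. x i * bas i j) + gcvec ?y"
      by (rule hx_eqv, rule hx_rels.cvec_add) (use i insert in auto)
    also have "\<dots> \<approx> pm_scale (x i) (ce i) + (\<Sum>i\<in>S. pm_scale (x i) (ce i))"
      using insert by (intro eqv_add cvec_scaled i HOL.refl) auto
    finally have 2: "gcvec ((\<lambda>j. x i * bas i j) + ?y) \<approx> pm_scale (x i) (ce i) + (\<Sum>i\<in>S. pm_scale (x i) (ce i))" .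
    have "?y \<in> X1 D" using insert by simp
    then show ?case
      unfolding sum.insert[OF insert.hyps] using 1 2 algA_ops(4)[OF i(2)] by blast
  qed
  have "x j = (\<Sum>i\<in>parcs D. (\<lambda>j. x i * bas i j)) j" for j
  proof -
    have "(\<Sum>i\<in>parcs D. (\<lambda>j. x i * bas i j)) j = (\<Sum>i\<in>parcs D. if i = j then x j else 0)"
      unfolding fun_sum_apply by (rule sum.cong) (auto simp: bas_apply)
    moreover have "j \<notin> parcs D \<Longrightarrow> x j = 0" using x unfolding X1_def fun_on_def by blast
    ultimately show ?thesis using finite_arcs by (cases "j \<in> parcs D") simp_all
  qed
  then have "x = (\<Sum>i\<in>parcs D. (\<lambda>j. x i * bas i j))" by (rule ext)
  then show "gvec x \<approx> (\<Sum>i\<in>parcs D. pm_scale (x i) (e i))" "gcvec x \<approx> (\<Sum>i\<in>parcs D. pm_scale (x i) (ce i))"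
    using fin[OF finite_arcs] by auto
qed

lemma one_L: "1 \<in> L"
proof -
  have fin: "(\<Sum>p\<in>S. bas p :: 'v \<Rightarrow> 'k) \<in> algA D \<and> gsrc (\<Sum>p\<in>S. bas p) \<approx> (\<Sum>p\<in>S. F p)" if "finite S" "S \<subseteq> pverts D" for S
    using that
  proof (induction S)
    case empty
    have z: "(0 :: 'v \<Rightarrow> 'k) \<in> algA D" by (simp add: algA_def fun_on_def)
    have "gsrc 0 \<approx> pm_scale 0 (gsrc (0 :: 'v \<Rightarrow> 'k))"
      by (rule src_scaled[OF z]) (simp add: fun_eq_iff)
    with z show ?case by (simp only: sum.empty pm.scale_zero_left simp_thms)
  next
    case (insert p S)
    have "gsrc (bas p + (\<Sum>p\<in>S. bas p)) \<approx> F p + gsrc (\<Sum>p\<in>S. bas p)"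
      by (rule hx_eqv, rule hx_rels.src_add) (use insert in auto)
    also have "\<dots> \<approx> F p + (\<Sum>p\<in>S. F p)" using insert by (intro eqv_add eqv_refl) auto
    finally have 1: "gsrc (bas p + (\<Sum>p\<in>S. bas p)) \<approx> F p + (\<Sum>p\<in>S. F p)" .
    have "bas p + (\<Sum>p\<in>S. bas p :: 'v \<Rightarrow> 'k) \<in> algA D" using insert by (intro algA_ops) auto
    then show ?case unfolding sum.insert[OF insert.hyps] using 1 by blast
  qed
  have "1 \<approx> gsrc (unitA D)"
    by (rule eqv_sym, rule hx_eqv, rule hx_rels.src_one)
  also have "\<dots> \<approx> (\<Sum>p\<in>pverts D. F p)"
    using fin[OF finite_verts] by (simp add: unitA_def)
  also have "\<dots> = (\<Sum>p\<in>pverts D. Z (p, [], p))" by (simp add: Z_def)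
  finally have "1 \<approx> (\<Sum>p\<in>pverts D. Z (p, [], p))" .
  moreover have "(\<Sum>p\<in>pverts D. Z (p, [], p)) \<in> L"
    by (intro pm.subspace_sum[OF L_subspace] L_Z) (simp add: zigzags_def)
  ultimately show ?thesis by (rule L_eqv)
qed

lemma F_Z:
  assumes "p \<in> pverts D" "z \<in> zigzags D"
  shows "F p * Z z \<in> L"
proof -
  obtain t w s where z: "z = (t, w, s)" "zigzag D t w s" using assms by (auto simp: zigzags_def)
  have "F p * Z z = F p * F t * Xw w" by (simp add: z Z_def mult.assoc)
  also have "\<dots> \<approx> (if p = t then F t else 0) * Xw w"
    using assms zigzag_verts[OF z(2)] by (intro eqv_right F_F Xw_closed[OF z(2)]) auto
  finally have "F p * Z z \<approx> (if p = t then Z z else 0)" by (simp add: z Z_def split: if_splits)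
  moreover have "(if p = t then Z z else 0) \<in> L"
    using L_Z[OF assms(2)] pm.subspace_0[OF L_subspace] by auto
  ultimately show ?thesis by (rule L_eqv)
qed

lemma X_Z:
  assumes g: "step_arc g \<in> parcs D" and zz: "z \<in> zigzags D"
  shows "X g * Z z \<in> L"
proof -
  obtain t w s where z: "z = (t, w, s)" "zigzag D t w s" using zz by (auto simp: zigzags_def)
  note c = Xw_closed[OF z(2)]
  have "X g * Z z = X g * F t * Xw w" by (simp add: z Z_def mult.assoc)
  also have "\<dots> \<approx> (if t = step_src g then X g else 0) * Xw w"
    using zigzag_verts[OF z(2)] by (intro eqv_right F_X(2) g c) auto
  also have "\<dots> \<approx> (if t = step_src g then F (step_tgt g) * X g else 0) * Xw w"
    using F_X(1)[OF step_arc_verts(2)[OF g] g] by (intro eqv_right c) (auto intro: eqv_sym)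
  finally have "X g * Z z \<approx> (if t = step_src g then Z (step_tgt g, g # w, s) else 0)"
    by (simp add: Z_def mult.assoc split: if_splits)
  moreover have "(if t = step_src g then Z (step_tgt g, g # w, s) else 0) \<in> L"
    using L_Z[of "(step_tgt g, g # w, s)"] pm.subspace_0[OF L_subspace] z g by (auto simp: zigzags_def)
  ultimately show ?thesis by (rule L_eqv)
qed

lemma gen_Z:
  assumes g: "g \<in> generators D" and z: "z \<in> zigzags D"
  shows "gen g * Z z \<in> L"
proof -
  have src: "gsrc a * Z z \<in> L" if a: "a \<in> algA D" for a
  proof -
    obtain t w s where zz: "z = (t, w, s)" "zigzag D t w s" using z by (auto simp: zigzags_def)
    have "gsrc a * Z z = gsrc a * F t * Xw w" by (simp add: zz Z_def mult.assoc)
    also have "\<dots> \<approx> pm_scale (a t) (F t) * Xw w"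
      using zigzag_verts[OF zz(2)] by (intro eqv_right src_F a Xw_closed[OF zz(2)]) auto
    finally have "gsrc a * Z z \<approx> pm_scale (a t) (Z z)" by (simp add: zz Z_def pm_scale_mult_left)
    then show ?thesis by (rule L_eqv) (intro pm.subspace_scale[OF L_subspace] L_Z z)
  qed
  note Zc = Z_closed[OF z]
  note sub = pm.subspace_sum[OF L_subspace] pm.subspace_scale[OF L_subspace]
    pm.subspace_diff[OF L_subspace] pm.subspace_add[OF L_subspace]
  consider (Src) a where "g = Src a" "a \<in> algA D" | (Tgt) a where "g = Tgt a" "a \<in> algA D"
    | (Vec) x where "g = Vec x" "x \<in> X1 D" | (CVec) x where "g = CVec x" "x \<in> X1 D"
    using g by (auto simp: generators_def)
  then show ?thesis
  proof cases
    case Src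
    then show ?thesis using src by simp
  next
    case Tgt
    then show ?thesis using L_eqv[OF eqv_right[OF tgt_eqv Zc] src] by simp
  next
    case Vec
    have "e i * Z z \<in> L" if i: "i \<in> parcs D" for i
    proof -
      have "e i * Z z = F (snd i) * Z z - XF i * Z z" by (simp add: algebra_simps)
      also have "\<dots> \<in> L" using i arc_facts[OF i] by (intro sub F_Z X_Z z) auto
      finally show ?thesis .
    qed
    then have "(\<Sum>i\<in>parcs D. pm_scale (x i) (e i)) * Z z \<in> L"
      unfolding sum_distrib_right pm_scale_mult_left by (intro sub)
    then show ?thesis using L_eqv[OF eqv_right[OF vec_expand(1)[OF Vec(2)] Zc]] Vec(1) by simp
  next
    case CVec
    have "ce i * Z z \<in> L" if i: "i \<in> parcs D" for i
    proof -
      have "ce i * Z z = XB i * Z z - F (fst i) * Z z" by (simp add: algebra_simps)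
      also have "\<dots> \<in> L" using i arc_facts[OF i] by (intro sub F_Z X_Z z) auto
      finally show ?thesis .
    qed
    then have "(\<Sum>i\<in>parcs D. pm_scale (x i) (ce i)) * Z z \<in> L"
      unfolding sum_distrib_right pm_scale_mult_left by (intro sub)
    then show ?thesis using L_eqv[OF eqv_right[OF vec_expand(2)[OF CVec(2)] Zc]] CVec(1) by simp
  qed
qed

lemma free_in_L:
  assumes "u \<in> free_carrier"
  shows "u \<in> L"
proof -
  have step: "gen g * u \<in> L" if g: "g \<in> generators D" and u: "u \<in> L" for g u
  proof -
    obtain c where c: "Poly_Mapping.keys c \<subseteq> zigzags D" "u \<approx> pm_extend Z c" using u by (auto simp: L_def)
    have "gen g * u \<approx> gen g * pm_extend Z c"
      by (rule eqv_left[OF c(2) gen_closed[OF g]])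
    moreover have "gen g * pm_extend Z c \<in> L"
      unfolding pm_extend_def sum_distrib_left pm_scale_mult_right
      using c(1) by (intro pm.subspace_sum[OF L_subspace] pm.subspace_scale[OF L_subspace] gen_Z g) auto
    ultimately show ?thesis by (rule L_eqv)
  qed
  have gs: "pm_basis (FWord gs) \<in> L" if "set gs \<subseteq> generators D" for gs
    using that
  proof (induction gs)
    case Nil
    show ?case using one_L unfolding single_one[symmetric] zero_fword_def .
  next
    case (Cons g gs)
    have "pm_basis (FWord (g # gs)) = (gen g * pm_basis (FWord gs) :: ('v, 'k) free)"
      by (simp add: gen_def mult_single plus_fword_def)
    then show ?case using step[of g "pm_basis (FWord gs)"] Cons by simp
  qed
  have "pm_basis w \<in> L" if "w \<in> words" for w
    using gs[of "letters w"] that by (simp add: words_def)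
  then have "pm_extend pm_basis u \<in> L"
    using assms by (intro pm_extend_in_span L_subspace) (auto simp: free_carrier_iff)
  then show ?thesis by (simp add: pm_extend_pm_basis)
qed

lemma Phi_X:
  assumes "step_arc g \<in> parcs D"
  shows "Phi (X g) = pm_basis (zclass (step_tgt g) [g] (step_src g))"
proof (cases g)
  case (Fwd a b)
  then have ab: "(a, b) \<in> parcs D" "b \<in> pverts D" using assms arc_verts by auto
  then show ?thesis
    by (simp add: Fwd Phi_gen_bas[OF ab(1)] Phi_lin Phi_of_gen idb_gscal[symmetric] vec_image_def fwd_def del: Phi_gen.simps(3))
next
  case (Bwd a b)
  then have ab: "(a, b) \<in> parcs D" "a \<in> pverts D" using assms arc_verts by auto
  then show ?thesis
    by (simp add: Bwd Phi_gen_bas[OF ab(1)] Phi_lin Phi_of_gen idb_gscal[symmetric] cvec_image_def bwd_def del: Phi_gen.simps(4))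
qed

lemma Phi_Z:
  assumes "zigzag D t w s"
  shows "Phi (Z (t, w, s)) = pm_basis (zclass t w s)"
proof -
  have "Pi.gmul (idb t) (Phi (Xw w)) = pm_basis (zclass t w s)"
    using assms
  proof (induction w arbitrary: t)
    case Nil
    then have "t = s" "t \<in> pverts D" by auto
    then show ?case using Pi.gmul_unit(2)[OF basis_on_arrows(1)] by (simp add: Phi_one idb_def)
  next
    case (Cons g w)
    then have g: "step_arc g \<in> parcs D" "step_tgt g = t" and w: "zigzag D (step_src g) w s" by auto
    have z: "zigzag D t [g] (step_src g)" "zigzag D (step_src g) [] (step_src g)" "zigzag D t [] t"
      using g step_arc_verts[OF g(1)] by auto
    let ?b = "pm_basis (zclass t [g] (step_src g)) :: _ \<Rightarrow>\<^sub>0 'k"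
    have b: "Pi.on_arrows ?b" "Pi.on_arrows (idb t :: _ \<Rightarrow>\<^sub>0 'k)" "Pi.on_arrows (idb (step_src g) :: _ \<Rightarrow>\<^sub>0 'k)"
      using zclass_arrow[OF z(1)] zclass_arrow[OF z(2)] zclass_arrow[OF z(3)] by (auto simp: idb_def)
    have bb: "Pi.gmul (idb t) ?b = Pi.gmul ?b (idb (step_src g))"
      using z by (simp add: idb_def Pi_comp' del: zigzag.simps)
    have "Pi.gmul (idb t) (Phi (Xw (g # w))) = Pi.gmul (Pi.gmul (idb t) ?b) (Phi (Xw w))"
      using Phi_X[OF g(1)] g(2) by (simp add: Phi_mult Pi.gmul_assoc[OF b(2) b(1) Phi_closed])
    also have "\<dots> = Pi.gmul ?b (Pi.gmul (idb (step_src g)) (Phi (Xw w)))"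
      unfolding bb by (rule Pi.gmul_assoc[OF b(1) b(3) Phi_closed])
    also have "\<dots> = pm_basis (zclass t (g # w) s)"
      using z w by (simp add: Cons.IH[OF w] Pi_comp' del: zigzag.simps)
    finally show ?case .
  qed
  then show ?thesis
    using zigzag_verts[OF assms] by (simp add: Z_def Phi_mult Phi_of_gen idb_gscal[symmetric])
qed

definition rep :: "'v zigzag_class \<Rightarrow> 'v \<times> 'v step list \<times> 'v" where
  "rep A = (SOME z. z \<in> A)"

lemma rep:
  assumes "zigzag D t w s"
  obtains w' where "rep (zclass t w s) = (t, w', s)" "zigzag D t w' s" "zclass t w' s = zclass t w s"
    "((t, w, s), (t, w', s)) \<in> zigzag_eq D (pi_rels D)"
proof -
  have "rep (zclass t w s) \<in> zclass t w s"
    unfolding rep_def by (rule someI[of "\<lambda>z. z \<in> zclass t w s", OF zclass_self[OF assms]])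
  moreover obtain t' w' s' where r: "rep (zclass t w s) = (t', w', s')" by (metis prod_cases3)
  ultimately have "t' = t" "s' = s" "zigzag D t w' s" "((t, w, s), (t, w', s)) \<in> zigzag_eq D (pi_rels D)"
    using zclass_memD by metis+
  then show ?thesis using r zclass_eq_iff[OF assms] that by metis
qed

text \<open>Modulo \<open>J\<close> an element is a combination \<open>\<Sum> c\<^sub>z Z z\<close>, and \<open>Z z\<close> may be replaced by the zigzag
  that represents the class of \<open>z\<close>. Then the combination depends only on the sums of the \<open>c\<^sub>z\<close> over the
  classes, which are the coefficients of its image under \<open>\<Phi>\<close>.\<close>

lemma Phi_kernel:
  assumes u: "u \<in> free_carrier" and 0: "Phi u = 0"
  shows "u \<in> J"
proof -
  obtain c where c: "Poly_Mapping.keys c \<subseteq> zigzags D" "u \<approx> pm_extend Z c"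
    using free_in_L[OF u] by (auto simp: L_def)
  have "Phi (u - pm_extend Z c) = 0" using c(2) J_Phi by (simp add: eqv_def)
  then have "Phi (pm_extend Z c) = 0" using 0 by (simp add: Phi_lin)
  also have "Phi (pm_extend Z c) = pm_extend (\<lambda>z. pm_basis (zclass (fst z) (fst (snd z)) (snd (snd z)))) c"
    unfolding pm_extend_compose[OF pm_linear_Phi]
    by (rule pm_extend_cong) (use c(1) in \<open>auto simp: zigzags_def Phi_Z\<close>)
  finally have "pm_extend (\<lambda>A. Z (rep A)) (pm_extend (\<lambda>z. pm_basis (zclass (fst z) (fst (snd z)) (snd (snd z)))) c) = 0"
    by (simp add: pm_extend_lin)
  then have 1: "pm_extend (\<lambda>z. Z (rep (zclass (fst z) (fst (snd z)) (snd (snd z))))) c = 0"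
    by (simp add: pm_extend_compose[OF pm_linear_extend])
  have "pm_extend Z c \<approx> pm_extend (\<lambda>z. Z (rep (zclass (fst z) (fst (snd z)) (snd (snd z))))) c"
    unfolding pm_extend_def
  proof (intro eqv_sum eqv_scale)
    fix z assume "z \<in> Poly_Mapping.keys c"
    then obtain t w s where z: "z = (t, w, s)" "zigzag D t w s" using c(1) by (auto simp: zigzags_def)
    obtain w' where "rep (zclass t w s) = (t, w', s)" "((t, w, s), (t, w', s)) \<in> zigzag_eq D (pi_rels D)"
      using rep[OF z(2)] by blast
    then show "Z z \<approx> Z (rep (zclass (fst z) (fst (snd z)) (snd (snd z))))" using Z_eqv z by simp
  qed
  then have "u \<approx> 0" using eqv_trans[OF c(2)] 1 by simp
  then show ?thesis by (simp add: eqv_def)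
qed

lemma Phi_surj:
  assumes "Pi.on_arrows y"
  shows "\<exists>u\<in>free_carrier. Phi u = (y :: _ \<Rightarrow>\<^sub>0 'k)"
proof (intro bexI)
  have A: "Z (rep A) \<in> free_carrier \<and> Phi (Z (rep A)) = pm_basis A" if Ay: "A \<in> Poly_Mapping.keys y" for A
  proof -
    obtain t w s where z: "A = zclass t w s" "zigzag D t w s" using Ay assms by (auto simp: Pi_arrows)
    obtain w' where "rep A = (t, w', s)" "zigzag D t w' s" "zclass t w' s = A"
      using rep[OF z(2)] z(1) by blast
    then show ?thesis using Phi_Z Z_closed[of "(t, w', s)"] by (simp add: zigzags_def)
  qed
  show "Phi (pm_extend (\<lambda>A. Z (rep A)) y) = y"
    unfolding pm_extend_compose[OF pm_linear_Phi]
    by (rule HOL.trans[OF pm_extend_cong pm_extend_pm_basis]) (use A in blast)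
  show "pm_extend (\<lambda>A. Z (rep A)) y \<in> free_carrier"
    unfolding pm_extend_def using A by (intro free_sum_closed) simp
qed

end

section \<open>The isomorphism\<close>

lemma ideal_kernel_props:
  assumes "ring_hom_ring R S f"
  shows "\<zero>\<^bsub>R\<^esub> \<in> a_kernel R S f"
    and "u \<in> a_kernel R S f \<Longrightarrow> v \<in> a_kernel R S f \<Longrightarrow> u \<oplus>\<^bsub>R\<^esub> v \<in> a_kernel R S f"
    and "u \<in> a_kernel R S f \<Longrightarrow> w \<in> carrier R \<Longrightarrow> w \<otimes>\<^bsub>R\<^esub> u \<in> a_kernel R S f"
    and "u \<in> a_kernel R S f \<Longrightarrow> w \<in> carrier R \<Longrightarrow> u \<otimes>\<^bsub>R\<^esub> w \<in> a_kernel R S f"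
proof -
  interpret ring_hom_ring R S f by fact
  interpret ideal "a_kernel R S f" R by (rule kernel_is_ideal)
  show "\<zero>\<^bsub>R\<^esub> \<in> a_kernel R S f"
    and "u \<in> a_kernel R S f \<Longrightarrow> v \<in> a_kernel R S f \<Longrightarrow> u \<oplus>\<^bsub>R\<^esub> v \<in> a_kernel R S f"
    and "u \<in> a_kernel R S f \<Longrightarrow> w \<in> carrier R \<Longrightarrow> w \<otimes>\<^bsub>R\<^esub> u \<in> a_kernel R S f"
    and "u \<in> a_kernel R S f \<Longrightarrow> w \<in> carrier R \<Longrightarrow> u \<otimes>\<^bsub>R\<^esub> w \<in> a_kernel R S f"
    by (rule zero_closed a_closed I_l_closed I_r_closed; assumption)+
qed

context finite_digraph
begin

text \<open>The homomorphism \<open>Phi\<close> descends to \<open>H1\<close>, to \<open>H2\<close> and to \<open>H3\<close>, which are \<open>HX D\<close>, \<open>DX D ch\<close> and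
  its isotopy quotient. Bijectivity is checked on the free algebra, with the kernel of the composite
  projection \<open>\<pi>\<close> as the ideal \<open>J\<close>.\<close>

lemma isotopy_quotient_iso:
  assumes ch: "path_choice D ch"
  shows "\<exists>\<phi>. hopf_algebroid_iso (pverts D)
    (isotopy_quotient (pverts D) (DX D ch :: ('k::field, ('v, 'k) free set set, 'v) hopf_algebroid))
    Pi.alg \<phi>"
proof -
  define V where "V = pverts D"
  let ?K = "Pi.alg :: ('k, 'v zigzag_class \<Rightarrow>\<^sub>0 'k, 'v) hopf_algebroid"
  define H0 where "H0 = (free_hopf D :: ('k, ('v, 'k) free, 'v) hopf_algebroid)"
  define R0 where "R0 = (hx_rels D :: ('v, 'k) free set)"
  define H1 where "H1 = quot_hopf V H0 R0"
  define p1 where "p1 = (\<lambda>u. genideal H0 R0 +>\<^bsub>H0\<^esub> u)"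
  define R1 where "R1 = p1 ` dx_rels D ch"
  define H2 where "H2 = quot_hopf V H1 R1"
  define p2 where "p2 = (\<lambda>u. genideal H1 R1 +>\<^bsub>H1\<^esub> u)"
  define R2 where "R2 = {src H2 a \<ominus>\<^bsub>H2\<^esub> tgt H2 a | a. a \<in> fun_on V}"
  define H3 where "H3 = quot_hopf V H2 R2"
  define p3 where "p3 = (\<lambda>u. genideal H2 R2 +>\<^bsub>H2\<^esub> u)"
  have H3: "isotopy_quotient (pverts D) (DX D ch) = H3"
    by (simp add: isotopy_quotient_def DX_def HX_def H3_def H2_def H1_def H0_def R2_def R1_def R0_def p1_def V_def)
  have K: "algebroid_struct V ?K" "hopf_data V ?K"
    using Pi.algebroid_struct_alg Pi.hopf_data_alg by (simp_all add: Pi_objs V_def)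
  have comul: "\<exists>s. comul ?K y = tensor_class V ?K s" for y
    using Pi.comul_alg[of y] by (auto simp: Pi_objs V_def)

  have S0: "algebroid_struct V H0" unfolding V_def H0_def by (rule algebroid_struct_free)
  have f0: "hopf_hom V H0 ?K Phi" unfolding V_def H0_def by (rule hopf_hom_Phi)
  have R0: "R0 \<subseteq> carrier H0" unfolding H0_def R0_def by (rule hx_rels_closed)
  have S1: "algebroid_struct V H1" and a1: "algebroid_hom V H0 H1 p1"
    and z1: "r \<in> R0 \<Longrightarrow> p1 r = \<zero>\<^bsub>H1\<^esub>" for r
    unfolding H1_def p1_def by (rule quot_hopf_proj[OF S0 R0]; assumption?)+
  obtain f1 where f1: "hopf_hom V H1 ?K f1" and fp1: "\<And>u. u \<in> carrier H0 \<Longrightarrow> f1 (p1 u) = Phi u"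
    unfolding H1_def p1_def
    by (rule hopf_hom_quot[OF S0 R0 K(1) comul f0]) (auto simp: R0_def Phi_hx_rels Pi.alg_simps)
  have p1: "p1 \<in> ring_hom H0 H1" using a1 by (simp add: algebroid_hom_def)
  have dx: "dx_rels D ch \<subseteq> carrier H0" unfolding H0_def by (rule dx_rels_closed)
  have R1: "R1 \<subseteq> carrier H1" using ring_hom_closed[OF p1] dx by (auto simp: R1_def)
  have S2: "algebroid_struct V H2" and a2: "algebroid_hom V H1 H2 p2"
    and z2: "r \<in> R1 \<Longrightarrow> p2 r = \<zero>\<^bsub>H2\<^esub>" for r
    unfolding H2_def p2_def by (rule quot_hopf_proj[OF S1 R1]; assumption?)+
  have kill1: "f1 r = \<zero>\<^bsub>?K\<^esub>" if "r \<in> R1" for r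
  proof -
    obtain u where u: "u \<in> dx_rels D ch" "r = p1 u" using \<open>r \<in> R1\<close> by (auto simp: R1_def)
    then show ?thesis using fp1[of u] dx Phi_dx_rels[OF ch u(1)] by (auto simp: Pi.alg_simps)
  qed
  obtain f2 where f2: "hopf_hom V H2 ?K f2" and fp2: "\<And>u. u \<in> carrier H1 \<Longrightarrow> f2 (p2 u) = f1 u"
    unfolding H2_def p2_def
    using hopf_hom_quot[OF S1 R1 K(1) comul f1 kill1] by blast
  interpret H2: ring H2 by (rule algebroid_structD(1)[OF S2])
  have R2: "R2 \<subseteq> carrier H2" using algebroid_structD(4,5)[OF S2] by (auto simp: R2_def)
  have S3: "algebroid_struct V H3" and a3: "algebroid_hom V H2 H3 p3"
    and z3: "r \<in> R2 \<Longrightarrow> p3 r = \<zero>\<^bsub>H3\<^esub>" for r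
    unfolding H3_def p3_def by (rule quot_hopf_proj[OF S2 R2]; assumption?)+
  have f2a: "algebroid_hom V H2 ?K f2" using f2 by (simp add: hopf_hom_def)
  interpret f2: ring_hom_ring H2 ?K f2
    by (rule ring_hom_ringI2[OF H2.ring_axioms Pi.ring_alg]) (use f2a in \<open>simp add: algebroid_hom_def\<close>)
  have kill2: "f2 r = \<zero>\<^bsub>?K\<^esub>" if "r \<in> R2" for r
  proof -
    obtain a where a: "a \<in> fun_on V" "r = src H2 a \<ominus>\<^bsub>H2\<^esub> tgt H2 a" using \<open>r \<in> R2\<close> by (auto simp: R2_def)
    have c: "src H2 a \<in> carrier H2" "tgt H2 a \<in> carrier H2" using algebroid_structD(4,5)[OF S2 a(1)] .
    have "f2 (src H2 a) = f2 (tgt H2 a)"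
      using f2a a(1) by (simp add: algebroid_hom_def Pi.alg_simps)
    then show ?thesis using c f2.hom_closed[OF c(2)]
      by (simp add: a(2) a_minus_def f2.S.r_neg)
  qed
  obtain f3 where f3: "hopf_hom V H3 ?K f3" and fp3: "\<And>u. u \<in> carrier H2 \<Longrightarrow> f3 (p3 u) = f2 u"
    unfolding H3_def p3_def
    using hopf_hom_quot[OF S2 R2 K(1) comul f2 kill2] by blast
  have p2: "p2 \<in> ring_hom H1 H2" and p3: "p3 \<in> ring_hom H2 H3"
    using a2 a3 by (simp_all add: algebroid_hom_def)

  define \<pi> where "\<pi> u = p3 (p2 (p1 u))" for u
  have \<pi>: "\<pi> \<in> ring_hom H0 H3"
    using ring_hom_trans[OF ring_hom_trans[OF p1 p2] p3] by (simp add: \<pi>_def[abs_def] o_def)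
  have f\<pi>: "f3 (\<pi> u) = Phi u" if "u \<in> carrier H0" for u
    using that ring_hom_closed[OF p1] ring_hom_closed[OF p2] by (simp add: \<pi>_def fp1 fp2 fp3)
  have surj: "carrier H3 = \<pi> ` carrier H0"
    unfolding \<pi>_def H3_def quot_hopf_carrier p3_def[symmetric]
    unfolding H2_def quot_hopf_carrier p2_def[symmetric]
    unfolding H1_def quot_hopf_carrier p1_def[symmetric]
    by (simp add: image_image)
  interpret \<pi>: ring_hom_ring H0 H3 \<pi>
    by (rule ring_hom_ringI2[OF algebroid_structD(1)[OF S0] algebroid_structD(1)[OF S3] \<pi>])
  interpret P1: ring_hom_ring H0 H1 p1
    by (rule ring_hom_ringI2[OF algebroid_structD(1)[OF S0] algebroid_structD(1)[OF S1] p1])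
  interpret P2: ring_hom_ring H1 H2 p2
    by (rule ring_hom_ringI2[OF algebroid_structD(1)[OF S1] algebroid_structD(1)[OF S2] p2])
  interpret P3: ring_hom_ring H2 H3 p3
    by (rule ring_hom_ringI2[OF algebroid_structD(1)[OF S2] algebroid_structD(1)[OF S3] p3])
  interpret f3: ring_hom_ring H3 ?K f3
    by (rule ring_hom_ringI2[OF algebroid_structD(1)[OF S3] Pi.ring_alg])
      (use f3 in \<open>simp add: hopf_hom_def algebroid_hom_def\<close>)
  define J where "J = a_kernel H0 H3 \<pi>"
  have J_iff: "u \<in> J \<longleftrightarrow> u \<in> carrier H0 \<and> \<pi> u = \<zero>\<^bsub>H3\<^esub>" for u
    unfolding J_def a_kernel_def' by blast
  have J_Phi: "Phi u = 0" if "u \<in> J" for u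
    using that f\<pi>[of u] f3.hom_zero by (simp add: J_iff Pi.alg_simps)
  note ker = ideal_kernel_props[OF \<pi>.ring_hom_ring_axioms, folded J_def]
  have J1: "R0 \<subseteq> J"
    using R0 z1 P2.hom_zero P3.hom_zero by (auto simp: J_iff \<pi>_def)
  have J2: "dx_rels D ch \<subseteq> J"
    using dx z2 P3.hom_zero by (auto simp: J_iff \<pi>_def R1_def)
  have J3: "gsrc a - gtgt a \<in> J" if a: "a \<in> algA D" for a
  proof -
    have aV: "a \<in> fun_on V" using a by (simp add: algA_def V_def)
    have c: "gsrc a \<in> carrier H0" "gtgt a \<in> carrier H0" "gsrc a - gtgt a \<in> carrier H0"
      using a by (simp_all add: H0_def)
    have s: "src H2 a = p2 (p1 (gsrc a))" "tgt H2 a = p2 (p1 (gtgt a))"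
      using a1 a2 aV by (simp_all add: algebroid_hom_def H0_def free_simps)
    have "gsrc a = (gsrc a - gtgt a) \<oplus>\<^bsub>H0\<^esub> gtgt a" by (simp add: H0_def free_simps)
    then have "p2 (p1 (gsrc a)) = p2 (p1 (gsrc a - gtgt a)) \<oplus>\<^bsub>H2\<^esub> p2 (p1 (gtgt a))"
      using c by (metis P1.hom_add P2.hom_add P1.hom_closed)
    then have "p2 (p1 (gsrc a - gtgt a)) = src H2 a \<ominus>\<^bsub>H2\<^esub> tgt H2 a"
      using c by (simp add: s a_minus_def H2.a_assoc H2.r_neg)
    then have "p2 (p1 (gsrc a - gtgt a)) \<in> R2" using aV by (auto simp: R2_def)
    then show ?thesis using z3 c(3) by (simp add: J_iff \<pi>_def)
  qed
  interpret J: isotopy_ideal D ch J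
    by unfold_locales
      (use ch ker J1 J2 J3 J_Phi in \<open>simp_all add: H0_def R0_def free_simps\<close>)
  have inj: "inj_on f3 (carrier H3)"
  proof (rule inj_onI)
    fix X Y assume XY: "X \<in> carrier H3" "Y \<in> carrier H3" "f3 X = f3 Y"
    then obtain u v where u: "u \<in> carrier H0" "X = \<pi> u" and v: "v \<in> carrier H0" "Y = \<pi> v"
      unfolding surj by auto
    have "Phi (u - v) = 0" using XY(3) u v by (simp add: f\<pi> Phi_lin)
    moreover have c: "u - v \<in> carrier H0" using u v by (simp add: H0_def)
    ultimately have "\<pi> (u - v) = \<zero>\<^bsub>H3\<^esub>" using J.Phi_kernel[of "u - v"] by (simp add: J_iff H0_def)
    moreover have "u = (u - v) \<oplus>\<^bsub>H0\<^esub> v" by (simp add: H0_def free_simps)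
    ultimately show "X = Y" using u v c by (metis \<pi>.hom_add \<pi>.S.l_zero \<pi>.hom_closed)
  qed
  have "f3 ` carrier H3 = carrier ?K"
  proof
    show "f3 ` carrier H3 \<subseteq> carrier ?K" using f3.hom_closed by blast
    show "carrier ?K \<subseteq> f3 ` carrier H3"
    proof
      fix y assume "y \<in> carrier ?K"
      then obtain u where "u \<in> carrier H0" "Phi u = y"
        using J.Phi_surj[of y] by (auto simp: Pi.alg_simps H0_def)
      then have "y = f3 (\<pi> u)" "\<pi> u \<in> carrier H3" using f\<pi>[of u] by simp_all
      then show "y \<in> f3 ` carrier H3" by (rule image_eqI)
    qed
  qed
  with inj have "bij_betw f3 (carrier H3) (carrier ?K)" by (simp add: bij_betw_def)
  then have "hopf_algebroid_iso V H3 ?K f3"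
    by (rule hopf_hom_bij_iso[OF S2 R2 H3_def K comul f3])
  then show ?thesis unfolding H3 V_def by blast
qed

end

theorem corollary5p8:
  fixes D :: "'v pair_pre_digraph" and ch :: "'v \<Rightarrow> 'v \<Rightarrow> 'v"
  assumes "pair_digraph D"
    and "path_choice D ch"
  shows "\<exists>\<phi>. hopf_algebroid_iso (pverts D)
           (isotopy_quotient (pverts D)
             (DX D ch :: ('k::field, ('v, 'k) free set set, 'v) hopf_algebroid))
           (groupoid_algebra (fundamental_groupoid D)) \<phi>"
proof -
  interpret pair_digraph D by fact
  interpret finite_digraph D
  proof
    show "finite (pverts D)" "finite (parcs D)" by (fact pair_finite_verts pair_finite_arcs)+
    fix a b assume "(a, b) \<in> parcs D"
    then show "a \<in> pverts D" "b \<in> pverts D" "a \<noteq> b"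
      using arc_fst_in_verts arc_snd_in_verts pair_no_loops by fastforce+
  qed
  show ?thesis by (rule isotopy_quotient_iso[OF assms(2)])
qed

end
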